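(* Let $(M,g)$ be a smooth Riemannian manifold of dimension $n>1$, let $A>0$ be a real constant, and let $\lambda,b_1:[0,\infty)\to\mathbb{R}$ be smooth functions with $\lambda(t)>0$ and $A+2t\lambda(t)b_1(t)>0$ for all $t\ge0$. Let $J$ be the almost complex structure on $T^*M$ defined by $$J\frac{\delta}{\delta q^i}=J^{(1)}_{ij}\frac{\partial}{\partial p_j},\qquad J\frac{\partial}{\partial p_i}=-J_{(2)}^{ij}\frac{\delta}{\delta q^j},$$ $$J^{(1)}_{ij}=\frac{A}{\lambda}g_{ij}+b_1p_ip_j,\qquad J_{(2)}^{ij}=\frac{\lambda}{A}g^{ij}-\frac{\lambda^2b_1}{A(A+2t\lambda b_1)}g^{0i}g^{0j}.$$ Then $J$ is integrable if and only if there is a real constant $c$ such that $(M,g)$ has constant sectional curvature $c$ and the function $b_1$ is given by $$b_1=-\frac{c\lambda^3+A^2\lambda'}{A\lambda(\lambda+2t\lambda')}.$$ Moreover, in this case the parameter $\lambda$ must fulfill the conditions $$\lambda>0,\qquad \frac{A^2-2ct\lambda^2}{\lambda+2t\lambda'}>0\qquad\text{for all } t\ge0,\qquad A>0.$$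
   Context: Let $\pi:T^*M\to M$ be the cotangent bundle of $M$. A local chart $(U,x^1,\dots,x^n)$ on $M$ induces the local chart $(\pi^{-1}(U),q^1,\dots,q^n,p_1,\dots,p_n)$ on $T^*M$ with $q^i=x^i\circ\pi$ and $p=p_i\,dx^i_{\pi(p)}$. The summation convention is used and all indices run over $1,\dots,n$. $g_{ij}$ are the components of $g$, $(g^{ij})$ is the inverse matrix (both evaluated at $\pi(p)$), and $g^{0i}=p_hg^{hi}$. With $\Gamma^k_{ih}$ the Christoffel symbols of $g$, put $\frac{\delta}{\delta q^i}=\frac{\partial}{\partial q^i}+p_k\Gamma^k_{ih}\frac{\partial}{\partial p_h}$; the fields $\frac{\delta}{\delta q^1},\dots,\frac{\delta}{\delta q^n},\frac{\partial}{\partial p_1},\dots,\frac{\partial}{\partial p_n}$ form a local frame on $T^*M$ (the adapted local frame). The energy density is $t=\frac12 g^{ik}(\pi(p))p_ip_k\in[0,\infty)$; functions of $t$ such as $\lambda$, $b_1$ and $\lambda'=d\lambda/dt$ are viewed as functions on $T^*M$ by evaluating them at the energy density. $J$ is integrable if its Nijenhuis tensor $N(X,Y)=[JX,JY]-J[JX,Y]-J[X,JY]-[X,Y]$ vanishes. *)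

theory Defs
  imports "HOL-Analysis.Analysis"
begin

section \<open>Smooth maps\<close>

text \<open>Derivatives are taken within the domain, so that one definition covers open subsets of a
  Euclidean space and the half line \<open>{0..}\<close> (with one-sided derivatives at \<open>0\<close>). It is only
  used for such sets, where derivatives within the set are unique.\<close>

primrec k_smooth_on ::
  "nat \<Rightarrow> 'a::real_normed_vector set \<Rightarrow> ('a \<Rightarrow> 'b::real_normed_vector) \<Rightarrow> bool" where
  "k_smooth_on 0 S f \<longleftrightarrow> continuous_on S f"
| "k_smooth_on (Suc k) S f \<longleftrightarrow>
     f differentiable_on S \<and>
     (\<forall>v. k_smooth_on k S (\<lambda>x. frechet_derivative f (at x within S) v))"

definition smooth_on ::
  "'a::real_normed_vector set \<Rightarrow> ('a \<Rightarrow> 'b::real_normed_vector) \<Rightarrow> bool" where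
  "smooth_on S f \<longleftrightarrow> (\<forall>k. k_smooth_on k S f)"


section \<open>Smooth manifolds, tangent vectors and vector fields\<close>

text \<open>A chart is a pair of a domain and a coordinate map; the values of the coordinate map
  outside the domain are irrelevant.\<close>

type_synonym ('m, 'e) chart = "'m set \<times> ('m \<Rightarrow> 'e)"

abbreviation chart_inv :: "('m, 'e) chart \<Rightarrow> 'e \<Rightarrow> 'm" where
  "chart_inv c \<equiv> inv_into (fst c) (snd c)"

definition transition :: "('m, 'e) chart \<Rightarrow> ('m, 'e) chart \<Rightarrow> 'e \<Rightarrow> 'e" where
  "transition c d = snd d \<circ> chart_inv c"

definition smooth_manifold :: "'m topology \<Rightarrow> ('m, 'e::euclidean_space) chart set \<Rightarrow> bool" where
  "smooth_manifold M \<A> \<longleftrightarrow>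
     topspace M \<noteq> {} \<and> Hausdorff_space M \<and> second_countable M \<and>
     (\<forall>c\<in>\<A>. openin M (fst c) \<and> open (snd c ` fst c) \<and>
        homeomorphic_map (subtopology M (fst c)) (top_of_set (snd c ` fst c)) (snd c)) \<and>
     (\<Union>c\<in>\<A>. fst c) = topspace M \<and>
     (\<forall>c\<in>\<A>. \<forall>d\<in>\<A>. smooth_on (snd c ` (fst c \<inter> fst d)) (transition c d))"

text \<open>The open sets of the manifold topology determined by an atlas.\<close>

definition atlas_open :: "('m, 'e::euclidean_space) chart set \<Rightarrow> 'm set \<Rightarrow> bool" where
  "atlas_open \<A> W \<longleftrightarrow>
     W \<subseteq> (\<Union>c\<in>\<A>. fst c) \<and> (\<forall>c\<in>\<A>. open (snd c ` (W \<inter> fst c)))"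

text \<open>A tangent vector at \<open>p\<close> is the family of its components in all charts of the atlas around \<open>p\<close>,
  transforming by the derivatives of the transition maps (and padded by \<open>0\<close> for other charts).
  Linear combinations of tangent vectors are formed pointwise.\<close>

type_synonym ('m, 'e) tangent = "('m, 'e) chart \<Rightarrow> 'e"

definition tangent_space ::
  "('m, 'e::euclidean_space) chart set \<Rightarrow> 'm \<Rightarrow> ('m, 'e) tangent set" where
  "tangent_space \<A> p =
     {v. (\<forall>c\<in>\<A>. \<forall>d\<in>\<A>. p \<in> fst c \<and> p \<in> fst d \<longrightarrow>
            v d = frechet_derivative (transition c d) (at (snd c p)) (v c)) \<and>
         (\<forall>c. \<not> (c \<in> \<A> \<and> p \<in> fst c) \<longrightarrow> v c = 0)}"

text \<open>The tangent vector at \<open>p\<close> whose components in the chart \<open>c\<close> around \<open>p\<close> are \<open>w\<close>; for a basis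
  vector \<open>w\<close> this is the coordinate vector.\<close>

definition chart_vector ::
  "('m, 'e::euclidean_space) chart set \<Rightarrow> ('m, 'e) chart \<Rightarrow> 'm \<Rightarrow> 'e \<Rightarrow> ('m, 'e) tangent" where
  "chart_vector \<A> c p w =
     (\<lambda>d. if d \<in> \<A> \<and> p \<in> fst d
          then frechet_derivative (transition c d) (at (snd c p)) w else 0)"

type_synonym ('m, 'e) vector_field = "'m \<Rightarrow> ('m, 'e) tangent"

definition smooth_vector_field ::
  "('m, 'e::euclidean_space) chart set \<Rightarrow> 'm set \<Rightarrow> ('m, 'e) vector_field \<Rightarrow> bool" where
  "smooth_vector_field \<A> W X \<longleftrightarrow>
     (\<forall>p\<in>W. X p \<in> tangent_space \<A> p) \<and>
     (\<forall>c\<in>\<A>. smooth_on (snd c ` (W \<inter> fst c)) (\<lambda>y. X (chart_inv c y) c))"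

text \<open>In a chart, \<open>[X,Y]\<^sup>i = X\<^sup>j \<partial>\<^sub>jY\<^sup>i - Y\<^sup>j \<partial>\<^sub>jX\<^sup>i\<close>.\<close>

definition lie_bracket ::
  "('m, 'e::euclidean_space) chart set \<Rightarrow>
   ('m, 'e) vector_field \<Rightarrow> ('m, 'e) vector_field \<Rightarrow> ('m, 'e) vector_field" where
  "lie_bracket \<A> X Y =
     (\<lambda>p c. if c \<in> \<A> \<and> p \<in> fst c
        then frechet_derivative (\<lambda>y. Y (chart_inv c y) c) (at (snd c p)) (X p c)
           - frechet_derivative (\<lambda>y. X (chart_inv c y) c) (at (snd c p)) (Y p c)
        else 0)"


section \<open>Almost complex structures\<close>

definition almost_complex_structure ::
  "('m, 'e::euclidean_space) chart set \<Rightarrow>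
   ('m \<Rightarrow> ('m, 'e) tangent \<Rightarrow> ('m, 'e) tangent) \<Rightarrow> bool" where
  "almost_complex_structure \<A> J \<longleftrightarrow>
     (\<forall>p\<in>(\<Union>c\<in>\<A>. fst c). \<forall>u\<in>tangent_space \<A> p.
        J p u \<in> tangent_space \<A> p \<and> J p (J p u) = (\<lambda>c. - u c) \<and>
        (\<forall>v\<in>tangent_space \<A> p. \<forall>a b.
           J p (\<lambda>c. a *\<^sub>R u c + b *\<^sub>R v c) = (\<lambda>c. a *\<^sub>R J p u c + b *\<^sub>R J p v c))) \<and>
     (\<forall>W X. atlas_open \<A> W \<and> smooth_vector_field \<A> W X \<longrightarrow>
        smooth_vector_field \<A> W (\<lambda>p. J p (X p)))"

definition nijenhuis ::
  "('m, 'e::euclidean_space) chart set \<Rightarrow>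
   ('m \<Rightarrow> ('m, 'e) tangent \<Rightarrow> ('m, 'e) tangent) \<Rightarrow>
   ('m, 'e) vector_field \<Rightarrow> ('m, 'e) vector_field \<Rightarrow> ('m, 'e) vector_field" where
  "nijenhuis \<A> J X Y =
     (\<lambda>p c. lie_bracket \<A> (\<lambda>q. J q (X q)) (\<lambda>q. J q (Y q)) p c
          - J p (lie_bracket \<A> (\<lambda>q. J q (X q)) Y p) c
          - J p (lie_bracket \<A> X (\<lambda>q. J q (Y q)) p) c
          - lie_bracket \<A> X Y p c)"

definition integrable_acs ::
  "('m, 'e::euclidean_space) chart set \<Rightarrow>
   ('m \<Rightarrow> ('m, 'e) tangent \<Rightarrow> ('m, 'e) tangent) \<Rightarrow> bool" where
  "integrable_acs \<A> J \<longleftrightarrow>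
     (\<forall>W X Y. atlas_open \<A> W \<and> smooth_vector_field \<A> W X \<and> smooth_vector_field \<A> W Y \<longrightarrow>
        (\<forall>p\<in>W. nijenhuis \<A> J X Y p = (\<lambda>c. 0)))"


section \<open>Riemannian metrics and sectional curvature\<close>

type_synonym ('m, 'n) metric =
  "'m \<Rightarrow> ('m, real^'n) tangent \<Rightarrow> ('m, real^'n) tangent \<Rightarrow> real"

text \<open>Components of the metric in a chart, as functions of the coordinates \<open>y\<close>.\<close>

definition metric_comp ::
  "('m, real^'n) chart set \<Rightarrow> ('m, 'n::finite) metric \<Rightarrow> ('m, real^'n) chart \<Rightarrow>
   real^'n \<Rightarrow> real^'n^'n" where
  "metric_comp \<A> g c y =
     (\<chi> i j. g (chart_inv c y) (chart_vector \<A> c (chart_inv c y) (axis i 1))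
                              (chart_vector \<A> c (chart_inv c y) (axis j 1)))"

definition riemannian_metric ::
  "('m, real^'n) chart set \<Rightarrow> ('m, 'n::finite) metric \<Rightarrow> bool" where
  "riemannian_metric \<A> g \<longleftrightarrow>
     (\<forall>p\<in>(\<Union>c\<in>\<A>. fst c). \<forall>u\<in>tangent_space \<A> p.
        (u \<noteq> (\<lambda>c. 0) \<longrightarrow> g p u u > 0) \<and>
        (\<forall>v\<in>tangent_space \<A> p. g p u v = g p v u \<and>
           (\<forall>w\<in>tangent_space \<A> p. \<forall>a b.
              g p (\<lambda>c. a *\<^sub>R u c + b *\<^sub>R v c) w = a * g p u w + b * g p v w))) \<and>
     (\<forall>c\<in>\<A>. \<forall>i j. smooth_on (snd c ` fst c) (\<lambda>y. metric_comp \<A> g c y $ i $ j))"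

definition metric_inv ::
  "('m, real^'n) chart set \<Rightarrow> ('m, 'n::finite) metric \<Rightarrow> ('m, real^'n) chart \<Rightarrow>
   real^'n \<Rightarrow> real^'n^'n" where
  "metric_inv \<A> g c y = matrix_inv (metric_comp \<A> g c y)"

definition partial_deriv :: "'n::finite \<Rightarrow> (real^'n \<Rightarrow> real) \<Rightarrow> real^'n \<Rightarrow> real" where
  "partial_deriv i f y = frechet_derivative f (at y) (axis i 1)"

text \<open>\<open>christoffel \<A> g c y k i j\<close> is \<open>\<Gamma>\<close> with upper index \<open>k\<close> and lower indices \<open>i\<close>, \<open>j\<close>.\<close>

definition christoffel ::
  "('m, real^'n) chart set \<Rightarrow> ('m, 'n::finite) metric \<Rightarrow> ('m, real^'n) chart \<Rightarrow>
   real^'n \<Rightarrow> 'n \<Rightarrow> 'n \<Rightarrow> 'n \<Rightarrow> real" where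
  "christoffel \<A> g c y k i j =
     (\<Sum>h\<in>UNIV. metric_inv \<A> g c y $ k $ h *
        (partial_deriv i (\<lambda>z. metric_comp \<A> g c z $ h $ j) y
       + partial_deriv j (\<lambda>z. metric_comp \<A> g c z $ h $ i) y
       - partial_deriv h (\<lambda>z. metric_comp \<A> g c z $ i $ j) y)) / 2"

text \<open>\<open>curvature_comp \<A> g c y l k i j\<close> is the \<open>l\<close>-th component of \<open>R(\<partial>\<^sub>i,\<partial>\<^sub>j)\<partial>\<^sub>k\<close>, where
  \<open>R(X,Y)Z = \<nabla>\<^sub>X\<nabla>\<^sub>YZ - \<nabla>\<^sub>Y\<nabla>\<^sub>XZ - \<nabla>\<^bsub>[X,Y]\<^esub>Z\<close>.\<close>

definition curvature_comp ::
  "('m, real^'n) chart set \<Rightarrow> ('m, 'n::finite) metric \<Rightarrow> ('m, real^'n) chart \<Rightarrow>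
   real^'n \<Rightarrow> 'n \<Rightarrow> 'n \<Rightarrow> 'n \<Rightarrow> 'n \<Rightarrow> real" where
  "curvature_comp \<A> g c y l k i j =
     partial_deriv i (\<lambda>z. christoffel \<A> g c z l j k) y
   - partial_deriv j (\<lambda>z. christoffel \<A> g c z l i k) y
   + (\<Sum>h\<in>UNIV. christoffel \<A> g c y l i h * christoffel \<A> g c y h j k
              - christoffel \<A> g c y l j h * christoffel \<A> g c y h i k)"

text \<open>\<open>g(R(u,v)v,u) / (g(u,u) g(v,v) - g(u,v)\<^sup>2)\<close>, the numerator being computed in the chart \<open>c\<close>.\<close>

definition sectional_curvature ::
  "('m, real^'n) chart set \<Rightarrow> ('m, 'n::finite) metric \<Rightarrow> ('m, real^'n) chart \<Rightarrow>
   'm \<Rightarrow> ('m, real^'n) tangent \<Rightarrow> ('m, real^'n) tangent \<Rightarrow> real" where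
  "sectional_curvature \<A> g c p u v =
     (\<Sum>m\<in>UNIV. \<Sum>l\<in>UNIV. \<Sum>k\<in>UNIV. \<Sum>i\<in>UNIV. \<Sum>j\<in>UNIV.
        metric_comp \<A> g c (snd c p) $ l $ m * curvature_comp \<A> g c (snd c p) l k i j
        * u c $ i * v c $ j * v c $ k * u c $ m)
     / (g p u u * g p v v - (g p u v)\<^sup>2)"

definition constant_sectional_curvature ::
  "('m, real^'n) chart set \<Rightarrow> ('m, 'n::finite) metric \<Rightarrow> real \<Rightarrow> bool" where
  "constant_sectional_curvature \<A> g \<kappa> \<longleftrightarrow>
     (\<forall>c\<in>\<A>. \<forall>p\<in>fst c. \<forall>u\<in>tangent_space \<A> p. \<forall>v\<in>tangent_space \<A> p.
        (\<forall>a b. (\<lambda>d. a *\<^sub>R u d + b *\<^sub>R v d) = (\<lambda>d. 0) \<longrightarrow> a = 0 \<and> b = 0) \<longrightarrow>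
        sectional_curvature \<A> g c p u v = \<kappa>)"


section \<open>The cotangent bundle\<close>

text \<open>Covectors are linear functionals on the tangent space (made extensional, so that equality of
  covectors is equality of functions). Points of the cotangent bundle are pairs of a base point and
  a covector there; \<open>fst\<close> is the bundle projection.\<close>

type_synonym ('m, 'e) covector = "('m, 'e) tangent \<Rightarrow> real"
type_synonym ('m, 'e) cotangent = "'m \<times> ('m, 'e) covector"

definition cotangent_space ::
  "('m, 'e::euclidean_space) chart set \<Rightarrow> 'm \<Rightarrow> ('m, 'e) covector set" where
  "cotangent_space \<A> p =
     {\<omega> \<in> extensional (tangent_space \<A> p).
        \<forall>u\<in>tangent_space \<A> p. \<forall>v\<in>tangent_space \<A> p. \<forall>a b.
          \<omega> (\<lambda>c. a *\<^sub>R u c + b *\<^sub>R v c) = a * \<omega> u + b * \<omega> v}"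

text \<open>The coordinates \<open>p\<^sub>i\<close> of a covector with respect to the coordinate coframe \<open>dx\<^sup>i\<close>.\<close>

definition momenta ::
  "('m, real^'n) chart set \<Rightarrow> ('m, real^'n::finite) chart \<Rightarrow> ('m, real^'n) cotangent \<Rightarrow> real^'n" where
  "momenta \<A> c P = (\<chi> i. snd P (chart_vector \<A> c (fst P) (axis i 1)))"

definition cotangent_chart ::
  "('m, real^'n) chart set \<Rightarrow> ('m, real^'n::finite) chart \<Rightarrow>
   (('m, real^'n) cotangent, (real^'n) \<times> (real^'n)) chart" where
  "cotangent_chart \<A> c =
     ({P. fst P \<in> fst c \<and> snd P \<in> cotangent_space \<A> (fst P)},
      (\<lambda>P. (snd c (fst P), momenta \<A> c P)))"

definition cotangent_atlas ::
  "('m, real^'n::finite) chart set \<Rightarrow>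
   (('m, real^'n) cotangent, (real^'n) \<times> (real^'n)) chart set" where
  "cotangent_atlas \<A> = cotangent_chart \<A> ` \<A>"

type_synonym ('m, 'n) bitangent =
  "(('m, real^'n) cotangent, (real^'n) \<times> (real^'n)) tangent"

text \<open>The coordinate vectors \<open>\<partial>/\<partial>q\<^sup>i\<close>, \<open>\<partial>/\<partial>p\<^sub>i\<close> and the horizontal vectors \<open>\<delta>/\<delta>q\<^sup>i\<close> at \<open>P\<close>.\<close>

definition d_dq ::
  "('m, real^'n) chart set \<Rightarrow> ('m, real^'n) chart \<Rightarrow> 'n::finite \<Rightarrow>
   ('m, real^'n) cotangent \<Rightarrow> ('m, 'n) bitangent" where
  "d_dq \<A> c i P = chart_vector (cotangent_atlas \<A>) (cotangent_chart \<A> c) P (axis i 1, 0)"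

definition d_dp ::
  "('m, real^'n) chart set \<Rightarrow> ('m, real^'n) chart \<Rightarrow> 'n::finite \<Rightarrow>
   ('m, real^'n) cotangent \<Rightarrow> ('m, 'n) bitangent" where
  "d_dp \<A> c i P = chart_vector (cotangent_atlas \<A>) (cotangent_chart \<A> c) P (0, axis i 1)"

definition delta_dq ::
  "('m, real^'n) chart set \<Rightarrow> ('m, 'n) metric \<Rightarrow> ('m, real^'n) chart \<Rightarrow> 'n::finite \<Rightarrow>
   ('m, real^'n) cotangent \<Rightarrow> ('m, 'n) bitangent" where
  "delta_dq \<A> g c i P =
     (\<lambda>d. d_dq \<A> c i P d
        + (\<Sum>k\<in>UNIV. \<Sum>h\<in>UNIV.
             (momenta \<A> c P $ k * christoffel \<A> g c (snd c (fst P)) k i h) *\<^sub>R d_dp \<A> c h P d))"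

definition energy ::
  "('m, real^'n) chart set \<Rightarrow> ('m, 'n::finite) metric \<Rightarrow> ('m, real^'n) chart \<Rightarrow>
   ('m, real^'n) cotangent \<Rightarrow> real" where
  "energy \<A> g c P =
     (\<Sum>i\<in>UNIV. \<Sum>k\<in>UNIV.
        metric_inv \<A> g c (snd c (fst P)) $ i $ k * momenta \<A> c P $ i * momenta \<A> c P $ k) / 2"

text \<open>The components \<open>g\<^sup>0\<^sup>i = p\<^sub>h g\<^sup>h\<^sup>i\<close>.\<close>

definition raised_momenta ::
  "('m, real^'n) chart set \<Rightarrow> ('m, 'n::finite) metric \<Rightarrow> ('m, real^'n) chart \<Rightarrow>
   ('m, real^'n) cotangent \<Rightarrow> real^'n" where
  "raised_momenta \<A> g c P =
     (\<chi> i. \<Sum>h\<in>UNIV. momenta \<A> c P $ h * metric_inv \<A> g c (snd c (fst P)) $ h $ i)"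


section \<open>The natural almost complex structure\<close>

definition J1 ::
  "('m, real^'n) chart set \<Rightarrow> ('m, 'n::finite) metric \<Rightarrow> real \<Rightarrow> (real \<Rightarrow> real) \<Rightarrow> (real \<Rightarrow> real) \<Rightarrow>
   ('m, real^'n) chart \<Rightarrow> ('m, real^'n) cotangent \<Rightarrow> 'n \<Rightarrow> 'n \<Rightarrow> real" where
  "J1 \<A> g A lam b1 c P i j =
     (let t = energy \<A> g c P in
        A / lam t * metric_comp \<A> g c (snd c (fst P)) $ i $ j
        + b1 t * momenta \<A> c P $ i * momenta \<A> c P $ j)"

definition J2 ::
  "('m, real^'n) chart set \<Rightarrow> ('m, 'n::finite) metric \<Rightarrow> real \<Rightarrow> (real \<Rightarrow> real) \<Rightarrow> (real \<Rightarrow> real) \<Rightarrow>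
   ('m, real^'n) chart \<Rightarrow> ('m, real^'n) cotangent \<Rightarrow> 'n \<Rightarrow> 'n \<Rightarrow> real" where
  "J2 \<A> g A lam b1 c P i j =
     (let t = energy \<A> g c P in
        lam t / A * metric_inv \<A> g c (snd c (fst P)) $ i $ j
        - (lam t)\<^sup>2 * b1 t / (A * (A + 2 * t * lam t * b1 t))
          * raised_momenta \<A> g c P $ i * raised_momenta \<A> g c P $ j)"

text \<open>Together with fibrewise linearity these frame equations, imposed in every induced chart,
  determine \<open>J\<close> on the cotangent bundle uniquely.\<close>

definition is_natural_acs ::
  "('m, real^'n) chart set \<Rightarrow> ('m, 'n::finite) metric \<Rightarrow> real \<Rightarrow> (real \<Rightarrow> real) \<Rightarrow> (real \<Rightarrow> real) \<Rightarrow>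
   (('m, real^'n) cotangent \<Rightarrow> ('m, 'n) bitangent \<Rightarrow> ('m, 'n) bitangent) \<Rightarrow> bool" where
  "is_natural_acs \<A> g A lam b1 J \<longleftrightarrow>
     almost_complex_structure (cotangent_atlas \<A>) J \<and>
     (\<forall>c\<in>\<A>. \<forall>P\<in>fst (cotangent_chart \<A> c). \<forall>i.
        J P (delta_dq \<A> g c i P) =
          (\<lambda>d. \<Sum>j\<in>UNIV. J1 \<A> g A lam b1 c P i j *\<^sub>R d_dp \<A> c j P d) \<and>
        J P (d_dp \<A> c i P) =
          (\<lambda>d. - (\<Sum>j\<in>UNIV. J2 \<A> g A lam b1 c P i j *\<^sub>R delta_dq \<A> g c j P d)))"

definition half_line_deriv :: "(real \<Rightarrow> real) \<Rightarrow> real \<Rightarrow> real" where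
  "half_line_deriv f t = vector_derivative f (at t within {0..})"

text \<open>The formula for \<open>b\<^sub>1\<close>. Division by \<open>0\<close> is total here, so that the formula makes sense
  (nonvanishing denominator) is stated explicitly; \<open>A\<close> and \<open>lam\<close> are positive in all uses.\<close>

definition b1_given_by :: "real \<Rightarrow> (real \<Rightarrow> real) \<Rightarrow> (real \<Rightarrow> real) \<Rightarrow> real \<Rightarrow> bool" where
  "b1_given_by A lam b1 \<kappa> \<longleftrightarrow>
     (\<forall>t\<ge>0. lam t + 2 * t * half_line_deriv lam t \<noteq> 0 \<and>
        b1 t = - ((\<kappa> * lam t ^ 3 + A\<^sup>2 * half_line_deriv lam t)
                  / (A * lam t * (lam t + 2 * t * half_line_deriv lam t))))"

end

theory Submission
  imports Defs
begin

text \<open>The Nijenhuis tensor \<open>N\<close> is a tensor, so integrability can be tested pointwise and in one induced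
  chart at a time. There the covectors are pairs \<open>(x, p)\<close>, and the coordinate vector \<open>a\<close> has the
  horizontal lift with components \<open>(a, p \<cdot> \<Gamma>(a,_))\<close>. By definition \<open>J\<close> maps the horizontal vectors
  isomorphically onto the vertical ones, and \<open>N(JX,Y) = -J N(X,Y)\<close>; hence \<open>N = 0\<close> as soon as \<open>N\<close>
  vanishes on pairs of horizontal lifts \<open>X\<close>, \<open>Y\<close> of coordinate vectors \<open>a\<close>, \<open>b\<close>. Of the four brackets
  in \<open>N(X,Y)\<close> the two mixed ones \<open>[JX,Y]\<close> and \<open>[X,JY]\<close> cancel, because \<open>g\<close>, \<open>p\<close> and \<open>t\<close> are
  horizontally parallel and \<open>\<Gamma>\<close> is symmetric. The bracket \<open>[X,Y]\<close> is vertical and equals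
  \<open>p \<cdot> R(a,b)\<close>, and \<open>[JX,JY]\<close> is vertical and comes from differentiating \<open>J\<^sup>(\<^sup>1\<^sup>)\<close> along the fibre
  only. Lemma \<open>nijenhuis_horizontal\<close> evaluates the sum: \<open>N = 0\<close> if and only if
  \<open>p \<cdot> R(a,b)v = -K(t) ((p \<cdot> a) g(b,v) - (p \<cdot> b) g(a,v))\<close> for all \<open>p\<close>, \<open>a\<close>, \<open>b\<close>, \<open>v\<close>, where
  \<open>K = ((A + 2 t \<lambda> b\<^sub>1) A \<lambda>' + A b\<^sub>1 \<lambda>\<^sup>2) / \<lambda>\<^sup>3\<close> (the function \<open>obstruction\<close>).

  Replacing \<open>p\<close> by \<open>s p\<close> multiplies \<open>t\<close> by \<open>s\<^sup>2\<close> and the rest of this equation by \<open>s\<close>. So \<open>K\<close> is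
  constant, say \<open>-c\<close>, and what remains is \<open>R(a,b)v = c (g(b,v) a - g(a,v) b)\<close>, which by polarization
  is constant sectional curvature \<open>c\<close> (lemma \<open>constant_curvature_iff\<close>). The same function \<open>K\<close> serves
  all points of the manifold, so \<open>c\<close> does not depend on the point, even in dimension two or on a
  disconnected manifold.

  Solving \<open>K = -c\<close> for \<open>b\<^sub>1\<close> gives the asserted formula, provided that \<open>\<lambda> + 2 t \<lambda>'\<close> has no zero.
  Indeed \<open>K = -c\<close> implies
  \<open>A (A + 2 t \<lambda> b\<^sub>1) (\<lambda> + 2 t \<lambda>') = \<lambda> (A\<^sup>2 - 2 c t \<lambda>\<^sup>2)\<close> (lemma \<open>denominator_identity\<close>). This makes
  \<open>u = A\<^sup>2 - 2 c t \<lambda>\<^sup>2\<close> a solution of a linear equation \<open>u' = -h u\<close> with \<open>u(0) = A\<^sup>2 > 0\<close>, so \<open>u\<close> never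
  vanishes (lemma \<open>space_form_factor_pos\<close>). The same identity yields the positivity of
  \<open>(A\<^sup>2 - 2 c t \<lambda>\<^sup>2) / (\<lambda> + 2 t \<lambda>')\<close>.\<close>


section \<open>Calculus of smooth maps on open sets\<close>

abbreviation dir_deriv ::
  "('a::real_normed_vector \<Rightarrow> 'b::real_normed_vector) \<Rightarrow> 'a \<Rightarrow> 'a \<Rightarrow> 'b" where
  "dir_deriv f x \<equiv> frechet_derivative f (at x)"

lemma k_smooth_on_cong:
  assumes "\<And>x. x \<in> S \<Longrightarrow> f x = g x"
  shows "k_smooth_on k S f \<longleftrightarrow> k_smooth_on k S g"
  using assms
proof (induction k arbitrary: f g)
  case 0
  then show ?case by (simp cong: continuous_on_cong)
next
  case (Suc k)
  have eq: "(f has_derivative f') (at x within S) \<longleftrightarrow> (g has_derivative f') (at x within S)"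
    if "x \<in> S" for f' x
    using that Suc.prems has_derivative_transform[of x S] by metis
  have "f differentiable_on S \<longleftrightarrow> g differentiable_on S"
    unfolding differentiable_on_def differentiable_def using eq by blast
  moreover have "k_smooth_on k S (\<lambda>x. frechet_derivative f (at x within S) v)
      \<longleftrightarrow> k_smooth_on k S (\<lambda>x. frechet_derivative g (at x within S) v)" for v
    by (rule Suc.IH) (simp add: frechet_derivative_def eq)
  ultimately show ?case by simp
qed

lemma k_smooth_on_Suc_open:
  assumes "open S"
  shows "k_smooth_on (Suc k) S f \<longleftrightarrow>
    (\<forall>x\<in>S. f differentiable at x) \<and> (\<forall>v. k_smooth_on k S (\<lambda>x. dir_deriv f x v))"
proof -
  have "k_smooth_on k S (\<lambda>x. frechet_derivative f (at x within S) v)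
      \<longleftrightarrow> k_smooth_on k S (\<lambda>x. dir_deriv f x v)" for v
    by (rule k_smooth_on_cong) (simp add: at_within_open[OF _ assms])
  then show ?thesis
    by (simp add: differentiable_on_eq_differentiable_at assms)
qed

lemma k_smooth_on_SucI:
  assumes "open S" "\<And>x. x \<in> S \<Longrightarrow> (f has_derivative f' x) (at x)"
    and "\<And>v. k_smooth_on k S (\<lambda>x. f' x v)"
  shows "k_smooth_on (Suc k) S f"
proof -
  have "k_smooth_on k S (\<lambda>x. dir_deriv f x v) \<longleftrightarrow> k_smooth_on k S (\<lambda>x. f' x v)" for v
    by (rule k_smooth_on_cong) (metis assms(2) frechet_derivative_at)
  then show ?thesis
    using assms unfolding k_smooth_on_Suc_open[OF assms(1)] differentiable_def by blast
qed

lemma k_smooth_on_SucD: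
  assumes "open S" "k_smooth_on (Suc k) S f"
  shows "\<And>x. x \<in> S \<Longrightarrow> (f has_derivative dir_deriv f x) (at x)"
    and "\<And>v. k_smooth_on k S (\<lambda>x. dir_deriv f x v)"
  using assms k_smooth_on_Suc_open frechet_derivative_works by blast+

lemma k_smooth_on_lower: "open S \<Longrightarrow> k_smooth_on (Suc k) S f \<Longrightarrow> k_smooth_on k S f"
proof (induction k arbitrary: f)
  case 0
  then show ?case
    by (auto intro!: differentiable_imp_continuous_on)
next
  case (Suc k)
  show ?case
    unfolding k_smooth_on_Suc_open[OF Suc.prems(1)]
    using Suc k_smooth_on_Suc_open[OF Suc.prems(1)] by blast
qed

lemma k_smooth_on_const: "open S \<Longrightarrow> k_smooth_on k S (\<lambda>x. c)"
proof (induction k arbitrary: c)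
  case (Suc k)
  show ?case
    by (rule k_smooth_on_SucI[where f' = "\<lambda>x h. 0"]) (use Suc in auto)
qed auto

lemma k_smooth_on_add:
  assumes "open S"
  shows "k_smooth_on k S f \<Longrightarrow> k_smooth_on k S g \<Longrightarrow> k_smooth_on k S (\<lambda>x. f x + g x)"
proof (induction k arbitrary: f g)
  case 0
  then show ?case by (auto intro: continuous_on_add)
next
  case (Suc k)
  note f = k_smooth_on_SucD[OF assms Suc.prems(1)] and g = k_smooth_on_SucD[OF assms Suc.prems(2)]
  show ?case
    by (rule k_smooth_on_SucI[OF assms has_derivative_add[OF f(1) g(1)] Suc.IH[OF f(2) g(2)]])
qed

lemma k_smooth_on_sum:
  assumes "open S" "finite I" "\<And>i. i \<in> I \<Longrightarrow> k_smooth_on k S (f i)"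
  shows "k_smooth_on k S (\<lambda>x. \<Sum>i\<in>I. f i x)"
  using assms(2,3)
  by (induction I rule: finite_induct) (auto intro: k_smooth_on_const k_smooth_on_add assms(1))

lemma k_smooth_on_linear_comp:
  assumes "open S" "bounded_linear L"
  shows "k_smooth_on k S f \<Longrightarrow> k_smooth_on k S (\<lambda>x. L (f x))"
proof (induction k arbitrary: f)
  case 0
  then have "continuous_on S f" by simp
  from bounded_linear.continuous_on[OF assms(2) this] show ?case by simp
next
  case (Suc k)
  note f = k_smooth_on_SucD[OF assms(1) Suc.prems]
  show ?case
    by (rule k_smooth_on_SucI[OF assms(1) bounded_linear.has_derivative[OF assms(2) f(1)]
          Suc.IH[OF f(2)]])
qed

text \<open>By the product rule the derivative of order \<open>k + 1\<close> of a product contains the factors themselves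
  besides their derivatives, which is where \<open>k_smooth_on_lower\<close> enters.\<close>

lemma k_smooth_on_bilinear:
  assumes "open S" "bounded_bilinear bop"
  shows "k_smooth_on k S f \<Longrightarrow> k_smooth_on k S g \<Longrightarrow> k_smooth_on k S (\<lambda>x. bop (f x) (g x))"
proof (induction k arbitrary: f g)
  case 0
  then have "continuous_on S f" "continuous_on S g" by simp_all
  from bounded_bilinear.continuous_on[OF assms(2) this] show ?case by simp
next
  case (Suc k)
  note f = k_smooth_on_SucD[OF assms(1) Suc.prems(1)] and g = k_smooth_on_SucD[OF assms(1) Suc.prems(2)]
  have lower: "k_smooth_on k S f" "k_smooth_on k S g"
    using Suc.prems assms(1) k_smooth_on_lower by blast+
  show ?case
    by (rule k_smooth_on_SucI[OF assms(1) bounded_bilinear.FDERIV[OF assms(2) f(1) g(1)]])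
      (auto intro!: k_smooth_on_add assms(1) Suc.IH f(2) g(2) lower)
qed

lemma k_smooth_on_linear:
  assumes "open S" "bounded_linear L"
  shows "k_smooth_on k S L"
proof (cases k)
  case 0
  then show ?thesis
    using bounded_linear.continuous_on[OF assms(2) continuous_on_id] by simp
next
  case (Suc m)
  show ?thesis
    unfolding Suc by (rule k_smooth_on_SucI[OF assms(1) bounded_linear_imp_has_derivative[OF assms(2)]])
      (rule k_smooth_on_const[OF assms(1)])
qed

lemma linear_expand_Basis:
  fixes L :: "'a::euclidean_space \<Rightarrow> 'b::real_vector"
  assumes "linear L"
  shows "L v = (\<Sum>b\<in>Basis. (v \<bullet> b) *\<^sub>R L b)"
proof -
  have "L v = L (\<Sum>b\<in>Basis. (v \<bullet> b) *\<^sub>R b)"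
    by (simp add: euclidean_representation)
  then show ?thesis
    by (simp add: linear_sum[OF assms] linear_scale[OF assms])
qed

text \<open>The chain rule expresses the derivative of a composition by the directional derivatives of the
  outer map along a fixed basis; only these are smooth functions of the base point by definition,
  which is why the expansion in a basis is needed.\<close>

lemma k_smooth_on_compose:
  fixes f :: "'a::real_normed_vector \<Rightarrow> 'b::euclidean_space"
    and h :: "'b \<Rightarrow> 'c::real_normed_vector"
  assumes "open S" "open T" "f ` S \<subseteq> T"
  shows "k_smooth_on k T h \<Longrightarrow> k_smooth_on k S f \<Longrightarrow> k_smooth_on k S (\<lambda>x. h (f x))"
proof (induction k arbitrary: h)
  case 0
  then have "continuous_on T h" "continuous_on S f" by simp_all
  from continuous_on_compose2[OF this assms(3)] show ?case by simp
next
  case (Suc k)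
  note h = k_smooth_on_SucD[OF assms(2) Suc.prems(1)]
    and f = k_smooth_on_SucD[OF assms(1) Suc.prems(2)]
  have lower: "k_smooth_on k S f"
    using Suc.prems assms(1) k_smooth_on_lower by blast
  have chain: "((\<lambda>x. h (f x)) has_derivative
      (\<lambda>v. \<Sum>b\<in>Basis. (dir_deriv f x v \<bullet> b) *\<^sub>R dir_deriv h (f x) b)) (at x)" if "x \<in> S" for x
  proof -
    have fx: "f x \<in> T" using that assms(3) by auto
    have "((\<lambda>x. h (f x)) has_derivative (\<lambda>v. dir_deriv h (f x) (dir_deriv f x v))) (at x)"
      using has_derivative_compose[OF f(1)[OF that] h(1)[OF fx]] by simp
    moreover have "linear (dir_deriv h (f x))"
      using h(1)[OF fx] has_derivative_linear by blast
    ultimately show ?thesis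
      by (subst linear_expand_Basis[symmetric])
  qed
  show ?case
  proof (rule k_smooth_on_SucI[OF assms(1) chain])
    fix v
    show "k_smooth_on k S (\<lambda>x. \<Sum>b\<in>Basis. (dir_deriv f x v \<bullet> b) *\<^sub>R dir_deriv h (f x) b)"
      by (intro k_smooth_on_sum k_smooth_on_bilinear[OF _ bounded_bilinear_scaleR]
          k_smooth_on_linear_comp[OF _ bounded_linear_inner_left] Suc.IH h(2) f(2) assms lower)
        auto
  qed
qed

lemma k_smooth_on_Pair:
  assumes "open S" "k_smooth_on k S f" "k_smooth_on k S g"
  shows "k_smooth_on k S (\<lambda>x. (f x, g x))"
proof -
  have "k_smooth_on k S (\<lambda>x. (f x, 0) + (0, g x))"
    by (intro k_smooth_on_add k_smooth_on_linear_comp[of S "\<lambda>y. (y, 0)"]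
        k_smooth_on_linear_comp[of S "\<lambda>y. (0, y)"] assms)
      (auto intro: bounded_linear_Pair bounded_linear_ident bounded_linear_zero)
  then show ?thesis by simp
qed

lemma smooth_on_differentiable:
  "open S \<Longrightarrow> smooth_on S f \<Longrightarrow> x \<in> S \<Longrightarrow> f differentiable at x"
  using k_smooth_on_Suc_open unfolding smooth_on_def by blast

lemma smooth_on_has_derivative:
  "open S \<Longrightarrow> smooth_on S f \<Longrightarrow> x \<in> S \<Longrightarrow> (f has_derivative dir_deriv f x) (at x)"
  using smooth_on_differentiable frechet_derivative_works by blast

lemma smooth_on_dir_deriv: "open S \<Longrightarrow> smooth_on S f \<Longrightarrow> smooth_on S (\<lambda>x. dir_deriv f x v)"
  using k_smooth_on_Suc_open unfolding smooth_on_def by blast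

lemma smooth_on_cong: "(\<And>x. x \<in> S \<Longrightarrow> f x = g x) \<Longrightarrow> smooth_on S f \<longleftrightarrow> smooth_on S g"
  unfolding smooth_on_def using k_smooth_on_cong by blast

lemma smooth_on_compose:
  fixes f :: "'a::real_normed_vector \<Rightarrow> 'b::euclidean_space"
  assumes "open S" "open T" "f ` S \<subseteq> T" "smooth_on T h" "smooth_on S f"
  shows "smooth_on S (\<lambda>x. h (f x))"
  using k_smooth_on_compose[OF assms(1-3) spec[OF assms(4)[unfolded smooth_on_def]]
      spec[OF assms(5)[unfolded smooth_on_def]]]
  unfolding smooth_on_def by (rule allI)

lemma dir_deriv_eqI: "(f has_derivative f') (at x) \<Longrightarrow> dir_deriv f x h = f' h"
  by (rule fun_cong[OF frechet_derivative_at[symmetric]])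

lemma has_derivative_dir_deriv: "f differentiable at x \<Longrightarrow> (f has_derivative dir_deriv f x) (at x)"
  by (simp add: frechet_derivative_works)

lemma inner_dir_deriv:
  "f differentiable at x \<Longrightarrow> dir_deriv f x h \<bullet> c = dir_deriv (\<lambda>y. f y \<bullet> c) x h"
  by (rule dir_deriv_eqI[OF has_derivative_inner_left[OF has_derivative_dir_deriv], symmetric])

lemma linear_inner_vec:
  fixes f :: "real^'n::finite \<Rightarrow> real"
  assumes "linear f"
  shows "(\<chi> h. f (axis h 1)) \<bullet> c = f c"
proof -
  have "(\<Sum>h\<in>UNIV. c $ h *\<^sub>R axis h 1) = c"
    by (simp add: vec_eq_iff axis_def if_distrib cong: if_cong)
  then have "f c = (\<Sum>h\<in>UNIV. c $ h *\<^sub>R f (axis h 1))"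
    using linear_sum[OF assms, of "\<lambda>h. c $ h *\<^sub>R axis h 1" UNIV]
    by (simp add: linear_scale[OF assms])
  then show ?thesis
    by (simp add: inner_vec_def mult.commute)
qed

lemma linear_expand_axis:
  fixes f :: "real^'n::finite \<Rightarrow> real"
  assumes "linear f"
  shows "f w = (\<Sum>k\<in>UNIV. w $ k * f (axis k 1))"
  using linear_inner_vec[OF assms, of w] by (simp add: inner_vec_def mult.commute)

text \<open>Both iterated second derivatives are limits of the same symmetric second difference, by the
  mean value theorem applied twice.\<close>

lemma second_difference_mean_value:
  fixes f :: "'a::real_normed_vector \<Rightarrow> real"
  assumes "open S" "k_smooth_on 2 S f" "x \<in> S"
  obtains d where "d > 0"
    and "\<And>h. 0 < h \<Longrightarrow> h < d \<Longrightarrow> \<exists>s r. 0 < s \<and> s < h \<and> 0 < r \<and> r < h \<and>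
      f (x + h *\<^sub>R u + h *\<^sub>R v) - f (x + h *\<^sub>R u) - f (x + h *\<^sub>R v) + f x
        = h\<^sup>2 * dir_deriv (\<lambda>y. dir_deriv f y u) (x + s *\<^sub>R u + r *\<^sub>R v) v"
proof -
  from assms obtain e where e: "e > 0" "ball x e \<subseteq> S"
    using open_contains_ball by blast
  define d where "d = e / (norm u + norm v + 1)"
  have d_kinetic: "norm u + norm v + 1 > 0"
    by (simp add: add_nonneg_pos)
  have d0: "d > 0"
    using e d_kinetic by (simp add: d_def)
  have smooth: "k_smooth_on (Suc (Suc 0)) S f"
    using assms(2) by (simp add: numeral_2_eq_2)
  note f1 = k_smooth_on_SucD[OF assms(1) smooth]
  note f2 = k_smooth_on_SucD[OF assms(1) f1(2)]
  have in_S: "x + s *\<^sub>R u + r *\<^sub>R v \<in> S" if "0 \<le> s" "s < d" "0 \<le> r" "r < d" for s r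
  proof -
    have "norm (s *\<^sub>R u + r *\<^sub>R v) \<le> s * norm u + r * norm v"
      using norm_triangle_ineq[of "s *\<^sub>R u" "r *\<^sub>R v"] that by simp
    also have "\<dots> \<le> d * norm u + d * norm v"
      using that by (intro add_mono mult_right_mono) auto
    also have "\<dots> < d * (norm u + norm v + 1)"
      using d0 by (simp add: algebra_simps)
    also have "\<dots> = e"
      using d_kinetic by (simp add: d_def)
    finally have "norm (s *\<^sub>R u + r *\<^sub>R v) < e" .
    then have "x + (s *\<^sub>R u + r *\<^sub>R v) \<in> ball x e"
      by (metis add_diff_cancel_left' dist_commute dist_norm mem_ball)
    then show ?thesis using e(2) by (auto simp: add.assoc)
  qed
  have "\<exists>s r. 0 < s \<and> s < h \<and> 0 < r \<and> r < h \<and>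
      f (x + h *\<^sub>R u + h *\<^sub>R v) - f (x + h *\<^sub>R u) - f (x + h *\<^sub>R v) + f x
        = h\<^sup>2 * dir_deriv (\<lambda>y. dir_deriv f y u) (x + s *\<^sub>R u + r *\<^sub>R v) v" if h: "0 < h" "h < d" for h
  proof -
    define \<phi> where "\<phi> s = f (x + s *\<^sub>R u + h *\<^sub>R v) - f (x + s *\<^sub>R u)" for s
    define \<psi> where "\<psi> s = dir_deriv f (x + s *\<^sub>R u + h *\<^sub>R v) u - dir_deriv f (x + s *\<^sub>R u) u" for s
    have "(\<phi> has_real_derivative \<psi> s) (at s)" if "0 \<le> s" "s \<le> h" for s
    proof -
      have 1: "x + s *\<^sub>R u + h *\<^sub>R v \<in> S" using in_S[of s h] that h by simp
      have 2: "x + s *\<^sub>R u \<in> S" using in_S[of s 0] that h by simp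
      have "((\<lambda>s. x + s *\<^sub>R u + h *\<^sub>R v) has_derivative (\<lambda>k. k *\<^sub>R u)) (at s)"
        by (auto intro!: derivative_eq_intros)
      from has_derivative_compose[OF this f1(1)[OF 1]]
      have "((\<lambda>s. f (x + s *\<^sub>R u + h *\<^sub>R v)) has_derivative
          (\<lambda>k. dir_deriv f (x + s *\<^sub>R u + h *\<^sub>R v) (k *\<^sub>R u))) (at s)" .
      moreover have "((\<lambda>s. x + s *\<^sub>R u) has_derivative (\<lambda>k. k *\<^sub>R u)) (at s)"
        by (auto intro!: derivative_eq_intros)
      from has_derivative_compose[OF this f1(1)[OF 2]]
      have "((\<lambda>s. f (x + s *\<^sub>R u)) has_derivative
          (\<lambda>k. dir_deriv f (x + s *\<^sub>R u) (k *\<^sub>R u))) (at s)" .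
      ultimately have "(\<phi> has_derivative (\<lambda>k. dir_deriv f (x + s *\<^sub>R u + h *\<^sub>R v) (k *\<^sub>R u)
          - dir_deriv f (x + s *\<^sub>R u) (k *\<^sub>R u))) (at s)"
        unfolding \<phi>_def by (rule has_derivative_diff)
      moreover have "(\<lambda>k. dir_deriv f (x + s *\<^sub>R u + h *\<^sub>R v) (k *\<^sub>R u)
          - dir_deriv f (x + s *\<^sub>R u) (k *\<^sub>R u)) = (*) (\<psi> s)"
        unfolding \<psi>_def
        using linear_scale[OF has_derivative_linear[OF f1(1)[OF 1]]]
          linear_scale[OF has_derivative_linear[OF f1(1)[OF 2]]]
        by (simp add: fun_eq_iff algebra_simps)
      ultimately show ?thesis
        by (simp add: has_field_derivative_def)
    qed
    then obtain s where s: "0 < s" "s < h" "\<phi> h - \<phi> 0 = (h - 0) * \<psi> s"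
      using MVT2[of 0 h \<phi> \<psi>] h by auto
    define \<theta> where "\<theta> r = dir_deriv f (x + s *\<^sub>R u + r *\<^sub>R v) u" for r
    define \<omega> where "\<omega> r = dir_deriv (\<lambda>y. dir_deriv f y u) (x + s *\<^sub>R u + r *\<^sub>R v) v" for r
    have "(\<theta> has_real_derivative \<omega> r) (at r)" if "0 \<le> r" "r \<le> h" for r
    proof -
      have 1: "x + s *\<^sub>R u + r *\<^sub>R v \<in> S" using in_S[of s r] that h s by simp
      have "((\<lambda>r. x + s *\<^sub>R u + r *\<^sub>R v) has_derivative (\<lambda>k. k *\<^sub>R v)) (at r)"
        by (auto intro!: derivative_eq_intros)
      from has_derivative_compose[OF this f2(1)[OF 1]]
      have "(\<theta> has_derivative
          (\<lambda>k. dir_deriv (\<lambda>y. dir_deriv f y u) (x + s *\<^sub>R u + r *\<^sub>R v) (k *\<^sub>R v))) (at r)"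
        unfolding \<theta>_def .
      moreover have "(\<lambda>k. dir_deriv (\<lambda>y. dir_deriv f y u) (x + s *\<^sub>R u + r *\<^sub>R v) (k *\<^sub>R v)) = (*) (\<omega> r)"
        unfolding \<omega>_def using linear_scale[OF has_derivative_linear[OF f2(1)[OF 1]]]
        by (simp add: fun_eq_iff algebra_simps)
      ultimately show ?thesis
        by (simp add: has_field_derivative_def)
    qed
    then obtain r where r: "0 < r" "r < h" "\<theta> h - \<theta> 0 = (h - 0) * \<omega> r"
      using MVT2[of 0 h \<theta> \<omega>] h by auto
    have "\<phi> h - \<phi> 0 = h\<^sup>2 * \<omega> r"
      using s(3) r(3) by (simp add: \<psi>_def \<theta>_def power2_eq_square)
    then show ?thesis
      using s r unfolding \<phi>_def \<omega>_def by (intro exI[of _ s] exI[of _ r]) simp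
  qed
  with d0 that show thesis by blast
qed

text \<open>If the two mixed derivatives differed at \<open>x\<close>, they would by continuity differ at all pairs of
  points near \<open>x\<close>; but the second difference equals both, at some pair of points as near as desired.\<close>

lemma dir_deriv_commute_real:
  fixes f :: "'a::real_normed_vector \<Rightarrow> real"
  assumes "open S" "k_smooth_on 2 S f" "x \<in> S"
  shows "dir_deriv (\<lambda>y. dir_deriv f y u) x v = dir_deriv (\<lambda>y. dir_deriv f y v) x u"
proof (rule ccontr)
  define a where "a = (\<lambda>y. dir_deriv (\<lambda>y. dir_deriv f y u) y v)"
  define b where "b = (\<lambda>y. dir_deriv (\<lambda>y. dir_deriv f y v) y u)"
  assume "\<not> ?thesis"
  then have "dist (a x) (b x) / 2 > 0"
    by (simp add: a_def b_def)
  have smooth: "k_smooth_on (Suc (Suc 0)) S f"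
    using assms(2) by (simp add: numeral_2_eq_2)
  have "k_smooth_on 0 S a" "k_smooth_on 0 S b"
    unfolding a_def b_def
    by (rule k_smooth_on_SucD(2)[OF assms(1) k_smooth_on_SucD(2)[OF assms(1) smooth]])+
  then have "isCont a x" "isCont b x"
    using continuous_on_eq_continuous_at[OF assms(1), THEN iffD1] assms(3) by fastforce+
  then have cont: "\<exists>d>0. \<forall>y. dist y x < d \<longrightarrow> dist (a y) (a x) < dist (a x) (b x) / 2"
      "\<exists>d>0. \<forall>y. dist y x < d \<longrightarrow> dist (b y) (b x) < dist (a x) (b x) / 2"
    using \<open>dist (a x) (b x) / 2 > 0\<close> unfolding continuous_at_eps_delta by blast+
  obtain e1 where e1: "e1 > 0"
    "\<And>y. dist y x < e1 \<Longrightarrow> dist (a y) (a x) < dist (a x) (b x) / 2"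
    using cont(1) by blast
  obtain e2 where e2: "e2 > 0"
    "\<And>y. dist y x < e2 \<Longrightarrow> dist (b y) (b x) < dist (a x) (b x) / 2"
    using cont(2) by blast
  obtain d1 where d1: "d1 > 0" "\<And>h. 0 < h \<Longrightarrow> h < d1 \<Longrightarrow> \<exists>s r. 0 < s \<and> s < h \<and> 0 < r \<and> r < h \<and>
      f (x + h *\<^sub>R u + h *\<^sub>R v) - f (x + h *\<^sub>R u) - f (x + h *\<^sub>R v) + f x
        = h\<^sup>2 * a (x + s *\<^sub>R u + r *\<^sub>R v)"
    using second_difference_mean_value[OF assms, of u v] unfolding a_def by blast
  obtain d2 where d2: "d2 > 0" "\<And>h. 0 < h \<Longrightarrow> h < d2 \<Longrightarrow> \<exists>s r. 0 < s \<and> s < h \<and> 0 < r \<and> r < h \<and>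
      f (x + h *\<^sub>R v + h *\<^sub>R u) - f (x + h *\<^sub>R v) - f (x + h *\<^sub>R u) + f x
        = h\<^sup>2 * b (x + s *\<^sub>R v + r *\<^sub>R u)"
    using second_difference_mean_value[OF assms, of v u] unfolding b_def by blast
  define m where "m = norm u + norm v + 1"
  have m: "m > 0" "norm u + norm v < m" by (auto simp: m_def add_nonneg_pos)
  have "0 < min (min d1 d2) (min (e1 / m) (e2 / m))"
    using d1(1) d2(1) e1(1) e2(1) m by simp
  then obtain h where h: "0 < h" "h < d1" "h < d2" "h < e1 / m" "h < e2 / m"
    using dense by (metis min_less_iff_conj)
  have near: "dist (x + s *\<^sub>R u' + r *\<^sub>R v') x \<le> h * m"
    if "0 < s" "s < h" "0 < r" "r < h" "norm u' + norm v' = norm u + norm v" for s r u' v'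
  proof -
    have "norm (s *\<^sub>R u' + r *\<^sub>R v') \<le> s * norm u' + r * norm v'"
      using norm_triangle_ineq[of "s *\<^sub>R u'" "r *\<^sub>R v'"] that by simp
    also have "\<dots> \<le> h * norm u' + h * norm v'"
      using that by (intro add_mono mult_right_mono) auto
    also have "\<dots> \<le> h * m"
      using h(1) m that(5) by (simp add: distrib_left[symmetric])
    finally show ?thesis by (simp add: dist_norm add.assoc)
  qed
  have hm: "h * m < e1" "h * m < e2"
    using h m by (auto simp: field_simps)
  obtain s r where 1: "0 < s" "s < h" "0 < r" "r < h"
      "f (x + h *\<^sub>R u + h *\<^sub>R v) - f (x + h *\<^sub>R u) - f (x + h *\<^sub>R v) + f x
        = h\<^sup>2 * a (x + s *\<^sub>R u + r *\<^sub>R v)"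
    using d1(2)[of h] h by blast
  obtain s' r' where 2: "0 < s'" "s' < h" "0 < r'" "r' < h"
      "f (x + h *\<^sub>R v + h *\<^sub>R u) - f (x + h *\<^sub>R v) - f (x + h *\<^sub>R u) + f x
        = h\<^sup>2 * b (x + s' *\<^sub>R v + r' *\<^sub>R u)"
    using d2(2)[of h] h by blast
  have "x + h *\<^sub>R v + h *\<^sub>R u = x + h *\<^sub>R u + h *\<^sub>R v" by simp
  with 1(5) 2(5) have "h\<^sup>2 * a (x + s *\<^sub>R u + r *\<^sub>R v) = h\<^sup>2 * b (x + s' *\<^sub>R v + r' *\<^sub>R u)"
    by (simp add: algebra_simps)
  then have ab: "a (x + s *\<^sub>R u + r *\<^sub>R v) = b (x + s' *\<^sub>R v + r' *\<^sub>R u)"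
    using h(1) by simp
  have "dist (a (x + s *\<^sub>R u + r *\<^sub>R v)) (a x) < dist (a x) (b x) / 2"
    using near[OF 1(1-4), of u v] hm(1) by (intro e1(2)) force
  moreover have "dist (b (x + s' *\<^sub>R v + r' *\<^sub>R u)) (b x) < dist (a x) (b x) / 2"
    using near[OF 2(1-4), of v u] hm(2) by (intro e2(2)) force
  ultimately show False
    using ab dist_triangle_half_l by (metis dist_commute less_irrefl)
qed

lemma dir_deriv_commute:
  fixes f :: "'a::real_normed_vector \<Rightarrow> 'b::euclidean_space"
  assumes "open S" "smooth_on S f" "x \<in> S"
  shows "dir_deriv (\<lambda>y. dir_deriv f y u) x v = dir_deriv (\<lambda>y. dir_deriv f y v) x u"
proof (rule euclidean_eqI)
  fix b :: 'b assume "b \<in> Basis"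
  have component: "dir_deriv h y w \<bullet> b = dir_deriv (\<lambda>y. h y \<bullet> b) y w"
    if "smooth_on S h" "y \<in> S" for h :: "'a \<Rightarrow> 'b" and y w
    using frechet_derivative_at[OF has_derivative_inner_left[OF smooth_on_has_derivative[OF assms(1) that]],
        of b] by (metis (no_types))
  have smooth_b: "k_smooth_on 2 S (\<lambda>y. f y \<bullet> b)"
    using assms(2) unfolding smooth_on_def
    by (intro k_smooth_on_linear_comp[OF assms(1) bounded_linear_inner_left]) auto
  have second: "dir_deriv (\<lambda>y. dir_deriv f y w) x z \<bullet> b
      = dir_deriv (\<lambda>y. dir_deriv (\<lambda>y. f y \<bullet> b) y w) x z" for w z
  proof -
    have d: "smooth_on S (\<lambda>y. dir_deriv f y w)"
      by (rule smooth_on_dir_deriv[OF assms(1,2)])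
    have diff: "(\<lambda>y. dir_deriv f y w \<bullet> b) differentiable at x"
      using has_derivative_inner_left[OF smooth_on_has_derivative[OF assms(1) d assms(3)]]
      unfolding differentiable_def by blast
    show ?thesis
      unfolding component[OF d assms(3)]
      by (rule fun_cong[OF frechet_derivative_transform_within_open[OF diff assms(1,3)
              component[OF assms(2)]]])
  qed
  show "dir_deriv (\<lambda>y. dir_deriv f y u) x v \<bullet> b = dir_deriv (\<lambda>y. dir_deriv f y v) x u \<bullet> b"
    unfolding second by (rule dir_deriv_commute_real[OF assms(1) smooth_b assms(3)])
qed


section \<open>Almost complex structures on open subsets of a Euclidean space\<close>

definition euclidean_bracket ::
  "('a::real_normed_vector \<Rightarrow> 'a) \<Rightarrow> ('a \<Rightarrow> 'a) \<Rightarrow> 'a \<Rightarrow> 'a" where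
  "euclidean_bracket X Y z = dir_deriv Y z (X z) - dir_deriv X z (Y z)"

text \<open>The value of \<open>N(X,Y)\<close> at \<open>z\<close> when \<open>X\<close> and \<open>Y\<close> are the constant fields \<open>u\<close> and \<open>v\<close>.\<close>

definition nijenhuis_tensor ::
  "('a::real_normed_vector \<Rightarrow> 'a \<Rightarrow> 'a) \<Rightarrow> 'a \<Rightarrow> 'a \<Rightarrow> 'a \<Rightarrow> 'a" where
  "nijenhuis_tensor J z u v =
     dir_deriv (\<lambda>y. J y v) z (J z u) - dir_deriv (\<lambda>y. J y u) z (J z v)
     + J z (dir_deriv (\<lambda>y. J y u) z v) - J z (dir_deriv (\<lambda>y. J y v) z u)"

locale euclidean_acs =
  fixes \<Omega> :: "'a::euclidean_space set" and J :: "'a \<Rightarrow> 'a \<Rightarrow> 'a"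
  assumes open_domain: "open \<Omega>"
    and linear_J: "z \<in> \<Omega> \<Longrightarrow> linear (J z)"
    and J_J: "z \<in> \<Omega> \<Longrightarrow> J z (J z u) = - u"
    and differentiable_J: "z \<in> \<Omega> \<Longrightarrow> (\<lambda>y. J y u) differentiable at z"
begin

lemma has_derivative_J: "z \<in> \<Omega> \<Longrightarrow> ((\<lambda>y. J y u) has_derivative dir_deriv (\<lambda>y. J y u) z) (at z)"
  using differentiable_J frechet_derivative_works by blast

lemma dir_deriv_J_expand:
  assumes "z \<in> \<Omega>"
  shows "dir_deriv (\<lambda>y. J y u) z h = (\<Sum>b\<in>Basis. (u \<bullet> b) *\<^sub>R dir_deriv (\<lambda>y. J y b) z h)"
proof -
  have "((\<lambda>y. \<Sum>b\<in>Basis. (u \<bullet> b) *\<^sub>R J y b) has_derivative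
      (\<lambda>h. \<Sum>b\<in>Basis. (u \<bullet> b) *\<^sub>R dir_deriv (\<lambda>y. J y b) z h)) (at z)"
    by (intro has_derivative_sum has_derivative_scaleR_right has_derivative_J assms)
  then have "((\<lambda>y. J y u) has_derivative
      (\<lambda>h. \<Sum>b\<in>Basis. (u \<bullet> b) *\<^sub>R dir_deriv (\<lambda>y. J y b) z h)) (at z)"
    by (rule has_derivative_transform_within_open[OF _ open_domain assms])
      (rule linear_expand_Basis[OF linear_J, symmetric])
  then show ?thesis
    by (rule fun_cong[OF frechet_derivative_at[symmetric]])
qed

lemma linear_dir_deriv_J:
  assumes "z \<in> \<Omega>"
  shows "linear (\<lambda>u. dir_deriv (\<lambda>y. J y u) z h)"
proof -
  have "linear (\<lambda>u. \<Sum>b\<in>Basis. (u \<bullet> b) *\<^sub>R dir_deriv (\<lambda>y. J y b) z h)"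
    by (rule linearI)
      (simp_all add: inner_add_left scaleR_add_left sum.distrib scaleR_sum_right)
  then show ?thesis
    by (simp only: dir_deriv_J_expand[OF assms, symmetric])
qed

lemma linear_dir_deriv_J_dir: "z \<in> \<Omega> \<Longrightarrow> linear (dir_deriv (\<lambda>y. J y u) z)"
  using has_derivative_J has_derivative_linear by blast

lemma has_derivative_J_field:
  assumes "z \<in> \<Omega>" "(X has_derivative X') (at z)"
  shows "((\<lambda>y. J y (X y)) has_derivative
    (\<lambda>h. dir_deriv (\<lambda>y. J y (X z)) z h + J z (X' h))) (at z)"
proof -
  have "((\<lambda>y. \<Sum>b\<in>Basis. (X y \<bullet> b) *\<^sub>R J y b) has_derivative
      (\<lambda>h. \<Sum>b\<in>Basis. (X z \<bullet> b) *\<^sub>R dir_deriv (\<lambda>y. J y b) z h + (X' h \<bullet> b) *\<^sub>R J z b)) (at z)"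
    by (intro has_derivative_sum has_derivative_scaleR has_derivative_J assms
        has_derivative_inner_left)
  moreover have "(\<Sum>b\<in>Basis. (X z \<bullet> b) *\<^sub>R dir_deriv (\<lambda>y. J y b) z h + (X' h \<bullet> b) *\<^sub>R J z b)
      = dir_deriv (\<lambda>y. J y (X z)) z h + J z (X' h)" for h
    by (simp add: sum.distrib dir_deriv_J_expand[OF assms(1), symmetric]
        linear_expand_Basis[OF linear_J[OF assms(1)], symmetric])
  ultimately have "((\<lambda>y. \<Sum>b\<in>Basis. (X y \<bullet> b) *\<^sub>R J y b) has_derivative
      (\<lambda>h. dir_deriv (\<lambda>y. J y (X z)) z h + J z (X' h))) (at z)"
    by simp
  then show ?thesis
    by (rule has_derivative_transform_within_open[OF _ open_domain assms(1)])
      (rule linear_expand_Basis[OF linear_J, symmetric])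
qed

lemma dir_deriv_J_field:
  assumes "z \<in> \<Omega>" "X differentiable at z"
  shows "dir_deriv (\<lambda>y. J y (X y)) z h = dir_deriv (\<lambda>y. J y (X z)) z h + J z (dir_deriv X z h)"
  by (rule fun_cong[OF frechet_derivative_at[OF has_derivative_J_field[OF assms(1)
            assms(2)[unfolded frechet_derivative_works]], symmetric]])

text \<open>This is the derivative of \<open>J\<^sup>2 = -1\<close>.\<close>

lemma dir_deriv_J_anticommute:
  assumes "z \<in> \<Omega>"
  shows "dir_deriv (\<lambda>y. J y (J z u)) z h = - J z (dir_deriv (\<lambda>y. J y u) z h)"
proof -
  have 1: "((\<lambda>y. J y (J y u)) has_derivative
      (\<lambda>h. dir_deriv (\<lambda>y. J y (J z u)) z h + J z (dir_deriv (\<lambda>y. J y u) z h))) (at z)"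
    by (rule has_derivative_J_field[OF assms has_derivative_J[OF assms]])
  have 2: "((\<lambda>y. J y (J y u)) has_derivative (\<lambda>h. 0)) (at z)"
    by (rule has_derivative_transform_within_open[OF has_derivative_const[of "- u"] open_domain assms])
      (simp add: J_J)
  have "dir_deriv (\<lambda>y. J y (J z u)) z h + J z (dir_deriv (\<lambda>y. J y u) z h) = 0"
    by (rule fun_cong[OF has_derivative_unique[OF 1 2]])
  then show ?thesis
    by (simp add: eq_neg_iff_add_eq_0)
qed

text \<open>The derivatives of \<open>X\<close> and \<open>Y\<close> cancel in the Nijenhuis bracket expression because
  \<open>J\<^sup>2 = -1\<close>; only derivatives of \<open>J\<close> remain.\<close>

lemma nijenhuis_tensor_eq_brackets:
  assumes "z \<in> \<Omega>" "X differentiable at z" "Y differentiable at z"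
  shows "nijenhuis_tensor J z (X z) (Y z) =
    euclidean_bracket (\<lambda>y. J y (X y)) (\<lambda>y. J y (Y y)) z
    - J z (euclidean_bracket (\<lambda>y. J y (X y)) Y z)
    - J z (euclidean_bracket X (\<lambda>y. J y (Y y)) z)
    - euclidean_bracket X Y z"
  unfolding nijenhuis_tensor_def euclidean_bracket_def
  using assms linear_J[OF assms(1)]
  by (simp add: dir_deriv_J_field[of z X] dir_deriv_J_field[of z Y] linear_diff linear_add J_J)

lemma nijenhuis_tensor_antisym: "nijenhuis_tensor J z v u = - nijenhuis_tensor J z u v"
  by (simp add: nijenhuis_tensor_def)

lemma nijenhuis_tensor_add_left:
  assumes "z \<in> \<Omega>"
  shows "nijenhuis_tensor J z (u + u') v = nijenhuis_tensor J z u v + nijenhuis_tensor J z u' v"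
  unfolding nijenhuis_tensor_def
  using linear_J[OF assms] linear_dir_deriv_J[OF assms] linear_dir_deriv_J_dir[OF assms]
  by (simp add: linear_add[of "J z"] linear_add[of "dir_deriv _ z"]
      linear_add[of "\<lambda>u. dir_deriv (\<lambda>y. J y u) z _"])

lemma nijenhuis_tensor_J_left:
  assumes "z \<in> \<Omega>"
  shows "nijenhuis_tensor J z (J z u) v = - J z (nijenhuis_tensor J z u v)"
  unfolding nijenhuis_tensor_def
  using assms linear_J[OF assms] linear_dir_deriv_J_dir[OF assms]
  by (simp add: linear_diff linear_add linear_neg J_J dir_deriv_J_anticommute)

text \<open>By \<open>N(JX,Y) = -J N(X,Y)\<close> the Nijenhuis tensor is determined by its values on a subspace
  that together with its image under \<open>J\<close> spans everything.\<close>

lemma nijenhuis_tensor_vanishes_iff: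
  assumes z: "z \<in> \<Omega>" and span: "\<And>u. \<exists>a\<in>H. \<exists>b\<in>H. u = a + J z b"
  shows "(\<forall>u v. nijenhuis_tensor J z u v = 0) \<longleftrightarrow> (\<forall>a\<in>H. \<forall>b\<in>H. nijenhuis_tensor J z a b = 0)"
proof (intro iffI allI)
  fix u v
  assume H: "\<forall>a\<in>H. \<forall>b\<in>H. nijenhuis_tensor J z a b = 0"
  have left: "nijenhuis_tensor J z u v = 0" if "\<forall>a\<in>H. nijenhuis_tensor J z a v = 0" for u v
    using span[of u] that linear_0[OF linear_J[OF z]]
    by (auto simp: nijenhuis_tensor_add_left[OF z] nijenhuis_tensor_J_left[OF z])
  show "nijenhuis_tensor J z u v = 0"
  proof (rule left, intro ballI)
    fix a assume "a \<in> H"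
    then have "nijenhuis_tensor J z v a = 0"
      using H by (intro left) auto
    then show "nijenhuis_tensor J z a v = 0"
      by (subst nijenhuis_tensor_antisym) simp
  qed
qed auto

end


section \<open>Smooth atlases and almost complex structures in charts\<close>

text \<open>What the atlas of the manifold and the induced atlas of the cotangent bundle have in common; the
  results below are applied to both.\<close>

locale smooth_atlas =
  fixes \<A> :: "('m, 'e::euclidean_space) chart set"
  assumes inj_chart: "c \<in> \<A> \<Longrightarrow> inj_on (snd c) (fst c)"
    and open_overlap: "c \<in> \<A> \<Longrightarrow> d \<in> \<A> \<Longrightarrow> open (snd c ` (fst c \<inter> fst d))"
    and smooth_transition:
      "c \<in> \<A> \<Longrightarrow> d \<in> \<A> \<Longrightarrow> smooth_on (snd c ` (fst c \<inter> fst d)) (transition c d)"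
begin

lemma chart_inv_chart [simp]: "c \<in> \<A> \<Longrightarrow> p \<in> fst c \<Longrightarrow> chart_inv c (snd c p) = p"
  using inj_chart inv_into_f_f by metis

lemma transition_chart [simp]: "c \<in> \<A> \<Longrightarrow> p \<in> fst c \<Longrightarrow> transition c d (snd c p) = snd d p"
  by (simp add: transition_def)

lemma open_chart_image: "c \<in> \<A> \<Longrightarrow> open (snd c ` fst c)"
  using open_overlap[of c c] by simp

lemma atlas_open_chart: "c \<in> \<A> \<Longrightarrow> atlas_open \<A> (fst c)"
  using open_overlap unfolding atlas_open_def by (auto simp: Int_commute)

lemma transition_has_derivative:
  assumes "c \<in> \<A>" "d \<in> \<A>" "p \<in> fst c" "p \<in> fst d"
  shows "(transition c d has_derivative dir_deriv (transition c d) (snd c p)) (at (snd c p))"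
  using assms by (intro smooth_on_has_derivative[OF open_overlap smooth_transition]) auto

lemma linear_transition_deriv:
  assumes "c \<in> \<A>" "d \<in> \<A>" "p \<in> fst c" "p \<in> fst d"
  shows "linear (dir_deriv (transition c d) (snd c p))"
  using transition_has_derivative[OF assms] has_derivative_linear by blast

text \<open>The chain rule for the transition maps. It makes the components of \<open>chart_vector\<close> transform
  like a tangent vector.\<close>

lemma transition_deriv_cocycle:
  assumes "c \<in> \<A>" "d \<in> \<A>" "e \<in> \<A>" "p \<in> fst c" "p \<in> fst d" "p \<in> fst e"
  shows "dir_deriv (transition d e) (snd d p) (dir_deriv (transition c d) (snd c p) w)
    = dir_deriv (transition c e) (snd c p) w"
proof -
  let ?S = "snd c ` (fst c \<inter> fst d) \<inter> snd c ` (fst c \<inter> fst e)"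
  have S: "?S = snd c ` (fst c \<inter> fst d \<inter> fst e)"
    using inj_chart[OF assms(1)] by (fastforce simp: inj_on_def)
  have "((\<lambda>y. transition d e (transition c d y)) has_derivative
      (\<lambda>w. dir_deriv (transition d e) (snd d p) (dir_deriv (transition c d) (snd c p) w))) (at (snd c p))"
    using transition_has_derivative[of d e p] assms
    by (intro has_derivative_compose[OF transition_has_derivative]) auto
  moreover have "open ?S"
    by (intro open_Int open_overlap assms)
  ultimately have "(transition c e has_derivative
      (\<lambda>w. dir_deriv (transition d e) (snd d p) (dir_deriv (transition c d) (snd c p) w))) (at (snd c p))"
    by (rule has_derivative_transform_within_open) (use assms in \<open>auto simp: S\<close>)
  then show ?thesis
    using transition_has_derivative[of c e p] assms has_derivative_unique by metis
qed

lemma transition_deriv_self: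
  assumes "c \<in> \<A>" "p \<in> fst c"
  shows "dir_deriv (transition c c) (snd c p) w = w"
proof -
  have "(transition c c has_derivative (\<lambda>w. w)) (at (snd c p))"
    by (rule has_derivative_transform_within_open[OF has_derivative_ident open_chart_image[OF assms(1)]])
      (use assms in auto)
  then show ?thesis
    using frechet_derivative_at by metis
qed

lemma chart_vector_self: "c \<in> \<A> \<Longrightarrow> p \<in> fst c \<Longrightarrow> chart_vector \<A> c p w c = w"
  by (simp add: chart_vector_def transition_deriv_self)

lemma tangent_transform:
  assumes "v \<in> tangent_space \<A> p" "c \<in> \<A>" "d \<in> \<A>" "p \<in> fst c" "p \<in> fst d"
  shows "v d = dir_deriv (transition c d) (snd c p) (v c)"
  using assms unfolding tangent_space_def by blast

lemma tangent_outside: "v \<in> tangent_space \<A> p \<Longrightarrow> \<not> (c \<in> \<A> \<and> p \<in> fst c) \<Longrightarrow> v c = 0"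
  unfolding tangent_space_def by blast

lemma tangentI:
  assumes "\<And>c d. c \<in> \<A> \<Longrightarrow> d \<in> \<A> \<Longrightarrow> p \<in> fst c \<Longrightarrow> p \<in> fst d \<Longrightarrow>
      v d = dir_deriv (transition c d) (snd c p) (v c)"
    and "\<And>c. \<not> (c \<in> \<A> \<and> p \<in> fst c) \<Longrightarrow> v c = 0"
  shows "v \<in> tangent_space \<A> p"
  using assms unfolding tangent_space_def by blast

lemma chart_vector_in_tangent_space:
  assumes "c \<in> \<A>" "p \<in> fst c"
  shows "chart_vector \<A> c p w \<in> tangent_space \<A> p"
  by (rule tangentI) (auto simp: chart_vector_def transition_deriv_cocycle assms)

lemma chart_vector_component:
  assumes "v \<in> tangent_space \<A> p" "c \<in> \<A>" "p \<in> fst c"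
  shows "chart_vector \<A> c p (v c) = v"
proof
  fix d
  show "chart_vector \<A> c p (v c) d = v d"
    using tangent_transform[OF assms(1,2) _ assms(3)] tangent_outside[OF assms(1)]
    by (simp add: chart_vector_def)
qed

lemma tangent_eqI:
  assumes "u \<in> tangent_space \<A> p" "v \<in> tangent_space \<A> p" "c \<in> \<A>" "p \<in> fst c" "u c = v c"
  shows "u = v"
  using assms chart_vector_component by metis

lemma chart_vector_lincomb:
  assumes "c \<in> \<A>" "p \<in> fst c"
  shows "chart_vector \<A> c p (a *\<^sub>R u + b *\<^sub>R v)
    = (\<lambda>d. a *\<^sub>R chart_vector \<A> c p u d + b *\<^sub>R chart_vector \<A> c p v d)"
  using linear_transition_deriv[OF assms(1) _ assms(2)]
  by (simp add: chart_vector_def fun_eq_iff linear_add linear_scale)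

lemma tangent_space_lincomb:
  assumes "u \<in> tangent_space \<A> p" "v \<in> tangent_space \<A> p"
  shows "(\<lambda>d. a *\<^sub>R u d + b *\<^sub>R v d) \<in> tangent_space \<A> p"
proof (rule tangentI)
  fix c d assume cd: "c \<in> \<A>" "d \<in> \<A>" "p \<in> fst c" "p \<in> fst d"
  show "a *\<^sub>R u d + b *\<^sub>R v d = dir_deriv (transition c d) (snd c p) (a *\<^sub>R u c + b *\<^sub>R v c)"
    using tangent_transform[OF assms(1) cd] tangent_transform[OF assms(2) cd]
    by (simp add: linear_add[OF linear_transition_deriv[OF cd]]
        linear_scale[OF linear_transition_deriv[OF cd]])
qed (simp add: assms[THEN tangent_outside])

lemma tangent_space_zero: "(\<lambda>d. 0) \<in> tangent_space \<A> p"
  by (rule tangentI) (simp_all add: linear_0[OF linear_transition_deriv])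

text \<open>In another chart the coordinate field has the components \<open>D(\<tau>)(\<tau>\<^sup>-\<^sup>1 y) w\<close> with the transition
  map \<open>\<tau>\<close>; their smoothness to all orders needs the chain rule for smooth maps.\<close>

lemma smooth_chart_vector_field:
  assumes "c \<in> \<A>"
  shows "smooth_vector_field \<A> (fst c) (\<lambda>p. chart_vector \<A> c p w)"
  unfolding smooth_vector_field_def
proof (intro conjI ballI)
  fix d assume d: "d \<in> \<A>"
  let ?S = "snd d ` (fst c \<inter> fst d)" and ?T = "snd c ` (fst c \<inter> fst d)"
  have S: "open ?S" and T: "open ?T"
    using open_overlap[of d c] open_overlap[of c d] assms d by (auto simp: Int_commute)
  have "smooth_on ?S (\<lambda>y. dir_deriv (transition c d) (transition d c y) w)"
  proof (rule smooth_on_compose[OF S T, where h = "\<lambda>x. dir_deriv (transition c d) x w" and f = "transition d c"])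
    show "transition d c ` ?S \<subseteq> ?T" using d by auto
    show "smooth_on ?T (\<lambda>x. dir_deriv (transition c d) x w)"
      by (rule smooth_on_dir_deriv[OF T smooth_transition[OF assms d]])
    show "smooth_on ?S (transition d c)"
      using smooth_transition[OF d assms] by (simp add: Int_commute)
  qed
  then show "smooth_on ?S (\<lambda>y. chart_vector \<A> c (chart_inv d y) w d)"
    by (rule smooth_on_cong[THEN iffD1, rotated]) (use d in \<open>auto simp: chart_vector_def\<close>)
qed (use assms chart_vector_in_tangent_space in blast)

lemma smooth_field_differentiable:
  assumes "atlas_open \<A> W" "smooth_vector_field \<A> W X" "p \<in> W" "c \<in> \<A>" "p \<in> fst c"
  shows "(\<lambda>y. X (chart_inv c y) c) differentiable at (snd c p)"
proof (rule smooth_on_differentiable)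
  show "open (snd c ` (W \<inter> fst c))"
    using assms by (simp add: atlas_open_def)
qed (use assms in \<open>auto simp: smooth_vector_field_def\<close>)

text \<open>The second derivatives of the transition map, which enter the transformed components of
  both terms of the bracket, cancel by their symmetry.\<close>

lemma lie_bracket_in_tangent_space:
  assumes W: "atlas_open \<A> W" and X: "smooth_vector_field \<A> W X" and Y: "smooth_vector_field \<A> W Y"
    and p: "p \<in> W"
  shows "lie_bracket \<A> X Y p \<in> tangent_space \<A> p"
proof -
  have "lie_bracket \<A> X Y p d = dir_deriv (transition c d) (snd c p) (lie_bracket \<A> X Y p c)"
    if c: "c \<in> \<A>" "p \<in> fst c" and d: "d \<in> \<A>" "p \<in> fst d" for c d
  proof -
    define T where "T = transition c d"
    define rep where "rep Z e = (\<lambda>y. Z (chart_inv e y) e)" for Z :: "('m, 'e) vector_field" and e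
    let ?x = "snd c p"
    let ?S = "snd c ` (W \<inter> fst c) \<inter> snd c ` (fst c \<inter> fst d)"
    have S: "?S = snd c ` (W \<inter> fst c \<inter> fst d)"
      using inj_chart[OF c(1)] by (fastforce simp: inj_on_def)
    have open_S: "open ?S"
      using W c(1) open_overlap[OF c(1) d(1)] by (auto simp: atlas_open_def)
    have x: "?x \<in> ?S" using S p c d by auto
    have T: "(T has_derivative dir_deriv T ?x) (at ?x)"
      unfolding T_def using c d by (intro transition_has_derivative)
    have T2: "((\<lambda>y. dir_deriv T y b) has_derivative dir_deriv (\<lambda>y. dir_deriv T y b) ?x) (at ?x)" for b
      unfolding T_def
      using smooth_on_has_derivative[OF _ smooth_on_dir_deriv[OF _ smooth_transition[OF c(1) d(1)]]]
        open_overlap[OF c(1) d(1)] x by blast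
    have lin: "linear (dir_deriv T y)" if "y \<in> ?S" for y
      using that linear_transition_deriv[OF c(1) d(1)] unfolding T_def S by auto
    have deriv: "dir_deriv (rep Z d) (snd d p) (dir_deriv T ?x h)
        = dir_deriv (\<lambda>y. dir_deriv T y (rep Z c ?x)) ?x h + dir_deriv T ?x (dir_deriv (rep Z c) ?x h)"
      if Z: "smooth_vector_field \<A> W Z" for Z h
    proof -
      have Zd: "(rep Z d has_derivative dir_deriv (rep Z d) (snd d p)) (at (T ?x))"
        using smooth_field_differentiable[OF W Z p d] frechet_derivative_works c
        unfolding rep_def T_def by auto
      have Zc: "(rep Z c has_derivative dir_deriv (rep Z c) ?x) (at ?x)"
        using smooth_field_differentiable[OF W Z p c] frechet_derivative_works
        unfolding rep_def by auto
      have 1: "((\<lambda>y. rep Z d (T y)) has_derivative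
          (\<lambda>h. dir_deriv (rep Z d) (snd d p) (dir_deriv T ?x h))) (at ?x)"
        by (rule has_derivative_compose[OF T Zd])
      have "((\<lambda>y. \<Sum>b\<in>Basis. (rep Z c y \<bullet> b) *\<^sub>R dir_deriv T y b) has_derivative
          (\<lambda>h. \<Sum>b\<in>Basis. (rep Z c ?x \<bullet> b) *\<^sub>R dir_deriv (\<lambda>y. dir_deriv T y b) ?x h
            + (dir_deriv (rep Z c) ?x h \<bullet> b) *\<^sub>R dir_deriv T ?x b)) (at ?x)"
        by (intro has_derivative_sum has_derivative_scaleR has_derivative_inner_left Zc T2)
      moreover have "(\<Sum>b\<in>Basis. (rep Z c y \<bullet> b) *\<^sub>R dir_deriv T y b) = rep Z d (T y)" if "y \<in> ?S" for y
      proof -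
        have repd: "rep Z d (T y) = dir_deriv T y (rep Z c y)"
          using that Z tangent_transform[OF _ c(1) d(1)] c d unfolding S
          by (auto simp: rep_def T_def smooth_vector_field_def)
        show ?thesis
          unfolding repd by (rule linear_expand_Basis[OF lin[OF that], symmetric])
      qed
      ultimately have 2: "((\<lambda>y. rep Z d (T y)) has_derivative
          (\<lambda>h. \<Sum>b\<in>Basis. (rep Z c ?x \<bullet> b) *\<^sub>R dir_deriv (\<lambda>y. dir_deriv T y b) ?x h
            + (dir_deriv (rep Z c) ?x h \<bullet> b) *\<^sub>R dir_deriv T ?x b)) (at ?x)"
        by (rule has_derivative_transform_within_open[OF _ open_S x])
      have "((\<lambda>y. \<Sum>b\<in>Basis. (w \<bullet> b) *\<^sub>R dir_deriv T y b) has_derivative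
          (\<lambda>h. \<Sum>b\<in>Basis. (w \<bullet> b) *\<^sub>R dir_deriv (\<lambda>y. dir_deriv T y b) ?x h)) (at ?x)" for w
        by (intro has_derivative_sum has_derivative_scaleR_right T2)
      then have "((\<lambda>y. dir_deriv T y w) has_derivative
          (\<lambda>h. \<Sum>b\<in>Basis. (w \<bullet> b) *\<^sub>R dir_deriv (\<lambda>y. dir_deriv T y b) ?x h)) (at ?x)" for w
        by (rule has_derivative_transform_within_open[OF _ open_S x])
          (rule linear_expand_Basis[OF lin, symmetric])
      then have expand: "(\<Sum>b\<in>Basis. (w \<bullet> b) *\<^sub>R dir_deriv (\<lambda>y. dir_deriv T y b) ?x h)
          = dir_deriv (\<lambda>y. dir_deriv T y w) ?x h" for w
        by (rule fun_cong[OF frechet_derivative_at])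
      have "dir_deriv (rep Z d) (snd d p) (dir_deriv T ?x h)
          = (\<Sum>b\<in>Basis. (rep Z c ?x \<bullet> b) *\<^sub>R dir_deriv (\<lambda>y. dir_deriv T y b) ?x h)
            + (\<Sum>b\<in>Basis. (dir_deriv (rep Z c) ?x h \<bullet> b) *\<^sub>R dir_deriv T ?x b)"
        using fun_cong[OF has_derivative_unique[OF 1 2], of h] by (simp only: sum.distrib)
      then show ?thesis
        by (simp only: expand linear_expand_Basis[OF lin[OF x], symmetric])
    qed
    have comp: "Z p d = dir_deriv T ?x (Z p c)" "rep Z c ?x = Z p c"
      if "smooth_vector_field \<A> W Z" for Z
      using that p tangent_transform[OF _ c(1) d(1) c(2) d(2)] c
      by (auto simp: smooth_vector_field_def T_def rep_def)
    have sym: "dir_deriv (\<lambda>y. dir_deriv T y u) ?x v = dir_deriv (\<lambda>y. dir_deriv T y v) ?x u" for u v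
      unfolding T_def using x
      by (intro dir_deriv_commute[OF open_overlap[OF c(1) d(1)] smooth_transition[OF c(1) d(1)]]) auto
    have "lie_bracket \<A> X Y p d
        = dir_deriv (rep Y d) (snd d p) (X p d) - dir_deriv (rep X d) (snd d p) (Y p d)"
      using d by (simp add: lie_bracket_def rep_def)
    also have "\<dots> = dir_deriv T ?x (dir_deriv (rep Y c) ?x (X p c))
        - dir_deriv T ?x (dir_deriv (rep X c) ?x (Y p c))"
      unfolding comp(1)[OF X] comp(1)[OF Y] deriv[OF X] deriv[OF Y]
      by (simp add: comp(2) X Y sym[of "Y p c" "X p c"])
    also have "\<dots> = dir_deriv T ?x (lie_bracket \<A> X Y p c)"
      using c by (simp add: lie_bracket_def rep_def linear_diff[OF lin[OF x]])
    finally show ?thesis by (simp add: T_def)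
  qed
  then show ?thesis
    by (rule tangentI) (auto simp: lie_bracket_def)
qed

end

locale acs_on_atlas = smooth_atlas \<A> for \<A> :: "('m, 'e::euclidean_space) chart set" +
  fixes J :: "'m \<Rightarrow> ('m, 'e) tangent \<Rightarrow> ('m, 'e) tangent"
  assumes acs: "almost_complex_structure \<A> J"
begin

definition chart_rep :: "('m, 'e) chart \<Rightarrow> 'e \<Rightarrow> 'e \<Rightarrow> 'e" where
  "chart_rep c y u = J (chart_inv c y) (chart_vector \<A> c (chart_inv c y) u) c"

lemma J_tangent:
  assumes "u \<in> tangent_space \<A> p" "c \<in> \<A>" "p \<in> fst c"
  shows "J p u \<in> tangent_space \<A> p" and "J p (J p u) = (\<lambda>c. - u c)"
    and "v \<in> tangent_space \<A> p \<Longrightarrow>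
      J p (\<lambda>c. a *\<^sub>R u c + b *\<^sub>R v c) = (\<lambda>c. a *\<^sub>R J p u c + b *\<^sub>R J p v c)"
  using acs assms unfolding almost_complex_structure_def by blast+

lemma J_component:
  assumes "u \<in> tangent_space \<A> p" "c \<in> \<A>" "p \<in> fst c"
  shows "J p u c = chart_rep c (snd c p) (u c)"
  using assms by (simp add: chart_rep_def chart_vector_component)

lemma smooth_J_field:
  assumes "atlas_open \<A> W" "smooth_vector_field \<A> W X"
  shows "smooth_vector_field \<A> W (\<lambda>p. J p (X p))"
  using acs assms unfolding almost_complex_structure_def by blast

lemma euclidean_acs_chart_rep:
  assumes c: "c \<in> \<A>"
  shows "euclidean_acs (snd c ` fst c) (chart_rep c)"
proof (rule euclidean_acs.intro)
  show "open (snd c ` fst c)" by (rule open_chart_image[OF c])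
next
  fix z u :: 'e assume "z \<in> snd c ` fst c"
  then obtain p where p: "p \<in> fst c" "z = snd c p" by auto
  note cv = chart_vector_in_tangent_space[OF c p(1)]
  have lincomb: "chart_rep c z (a *\<^sub>R v + b *\<^sub>R w) = a *\<^sub>R chart_rep c z v + b *\<^sub>R chart_rep c z w"
    for a b v w
    using p c J_tangent(3)[OF cv c p(1) cv]
    by (simp add: chart_rep_def chart_vector_lincomb)
  show "linear (chart_rep c z)"
    using lincomb[of 1 _ 1] lincomb[of _ _ 0] by (intro linearI) auto
  have "chart_rep c z u = J p (chart_vector \<A> c p u) c"
    using p c by (simp add: chart_rep_def)
  then have "chart_rep c z (chart_rep c z u) = J p (J p (chart_vector \<A> c p u)) c"
    using J_component[OF J_tangent(1)[OF cv c p(1)] c p(1)] p(2) by simp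
  then show "chart_rep c z (chart_rep c z u) = - u"
    using J_tangent(2)[OF cv c p(1)] chart_vector_self[OF c p(1)] by simp
  show "(\<lambda>y. chart_rep c y u) differentiable at z"
    unfolding p(2) chart_rep_def
    by (rule smooth_field_differentiable[OF atlas_open_chart[OF c]
          smooth_J_field[OF atlas_open_chart[OF c] smooth_chart_vector_field[OF c]] p(1) c p(1)])
qed

text \<open>Linearity of \<open>J\<close> is only known on tangent vectors; the brackets to which \<open>J\<close> is applied are
  tangent vectors by \<open>lie_bracket_in_tangent_space\<close>.\<close>

lemma nijenhuis_component:
  assumes W: "atlas_open \<A> W" and X: "smooth_vector_field \<A> W X" and Y: "smooth_vector_field \<A> W Y"
    and p: "p \<in> W" and c: "c \<in> \<A>" "p \<in> fst c"
  shows "nijenhuis \<A> J X Y p c = nijenhuis_tensor (chart_rep c) (snd c p) (X p c) (Y p c)"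
proof -
  interpret euclidean_acs "snd c ` fst c" "chart_rep c"
    by (rule euclidean_acs_chart_rep[OF c(1)])
  let ?z = "snd c p"
  let ?r = "\<lambda>Z y. Z (chart_inv c y) c"
  have z: "?z \<in> snd c ` fst c" using c by simp
  have open_W: "open (snd c ` (W \<inter> fst c))" and zW: "?z \<in> snd c ` (W \<inter> fst c)"
    using W c p by (auto simp: atlas_open_def)
  have JZ: "dir_deriv (\<lambda>y. J (chart_inv c y) (Z (chart_inv c y)) c) ?z
      = dir_deriv (\<lambda>y. chart_rep c y (?r Z y)) ?z" if Z: "smooth_vector_field \<A> W Z" for Z
    by (rule frechet_derivative_transform_within_open[OF _ open_W zW])
      (use smooth_field_differentiable[OF W smooth_J_field[OF W Z] p c] c Z
        in \<open>auto simp: J_component smooth_vector_field_def\<close>)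
  have bracket: "lie_bracket \<A> U V p c = euclidean_bracket (?r U) (?r V) ?z" for U V
    using c by (simp add: lie_bracket_def euclidean_bracket_def)
  have tangent: "U p \<in> tangent_space \<A> p" if "smooth_vector_field \<A> W U" for U
    using that p by (auto simp: smooth_vector_field_def)
  note JX = smooth_J_field[OF W X] and JY = smooth_J_field[OF W Y]
  have comp: "J p (X p) c = chart_rep c ?z (X p c)" "J p (Y p) c = chart_rep c ?z (Y p c)"
    using J_component[OF tangent c] X Y by auto
  have "nijenhuis \<A> J X Y p c =
      lie_bracket \<A> (\<lambda>q. J q (X q)) (\<lambda>q. J q (Y q)) p c
      - chart_rep c ?z (lie_bracket \<A> (\<lambda>q. J q (X q)) Y p c)
      - chart_rep c ?z (lie_bracket \<A> X (\<lambda>q. J q (Y q)) p c)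
      - lie_bracket \<A> X Y p c"
    unfolding nijenhuis_def
    by (simp add: J_component[OF lie_bracket_in_tangent_space[OF W JX Y p] c]
        J_component[OF lie_bracket_in_tangent_space[OF W X JY p] c])
  also have "\<dots> = nijenhuis_tensor (chart_rep c) ?z (?r X ?z) (?r Y ?z)"
    using nijenhuis_tensor_eq_brackets[OF z smooth_field_differentiable[OF W X p c]
        smooth_field_differentiable[OF W Y p c]] c
    by (simp add: bracket euclidean_bracket_def JZ[OF X] JZ[OF Y] comp)
  finally show ?thesis using c by simp
qed

text \<open>Restricting the quantified fields in the definition of integrability to coordinate fields shows
  that the tensor vanishes in each chart. Conversely the tensor computes the bracket expression of
  all smooth fields.\<close>

lemma integrable_iff_nijenhuis_tensor:
  "integrable_acs \<A> J \<longleftrightarrow>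
    (\<forall>c\<in>\<A>. \<forall>z\<in>snd c ` fst c. \<forall>u v. nijenhuis_tensor (chart_rep c) z u v = 0)"
proof
  assume int: "integrable_acs \<A> J"
  show "\<forall>c\<in>\<A>. \<forall>z\<in>snd c ` fst c. \<forall>u v. nijenhuis_tensor (chart_rep c) z u v = 0"
  proof (intro ballI allI)
    fix c z u v assume c: "c \<in> \<A>" and "z \<in> snd c ` fst c"
    then obtain p where p: "p \<in> fst c" "z = snd c p" by auto
    let ?X = "\<lambda>w p. chart_vector \<A> c p w"
    note X = smooth_chart_vector_field[OF c]
    have "nijenhuis \<A> J (?X u) (?X v) p c = 0"
      using int atlas_open_chart[OF c] X p(1) unfolding integrable_acs_def by metis
    then show "nijenhuis_tensor (chart_rep c) z u v = 0"
      using nijenhuis_component[OF atlas_open_chart[OF c] X X p(1) c p(1)]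
        chart_vector_self[OF c p(1)] p(2) by simp
  qed
next
  assume zero: "\<forall>c\<in>\<A>. \<forall>z\<in>snd c ` fst c. \<forall>u v. nijenhuis_tensor (chart_rep c) z u v = 0"
  show "integrable_acs \<A> J"
    unfolding integrable_acs_def
  proof (intro allI impI ballI ext)
    fix W X Y p c
    assume WXY: "atlas_open \<A> W \<and> smooth_vector_field \<A> W X \<and> smooth_vector_field \<A> W Y" and p: "p \<in> W"
    then have W: "atlas_open \<A> W" and X: "smooth_vector_field \<A> W X" and Y: "smooth_vector_field \<A> W Y"
      by auto
    show "nijenhuis \<A> J X Y p c = 0"
    proof (cases "c \<in> \<A> \<and> p \<in> fst c")
      case True
      then show ?thesis
        using nijenhuis_component[OF W X Y p] zero by simp
    next
      case False
      obtain d where d: "d \<in> \<A>" "p \<in> fst d"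
        using W p by (auto simp: atlas_open_def)
      have "J p v c = 0" if "v \<in> tangent_space \<A> p" for v
        by (rule tangent_outside[OF J_tangent(1)[OF that d] False])
      moreover note lie_bracket_in_tangent_space[OF W smooth_J_field[OF W X] Y p]
        lie_bracket_in_tangent_space[OF W X smooth_J_field[OF W Y] p]
      moreover have "lie_bracket \<A> U V p c = 0" for U V
        using False by (auto simp: lie_bracket_def)
      ultimately show ?thesis
        by (simp add: nijenhuis_def)
    qed
  qed
qed

end


section \<open>The atlas of the cotangent bundle\<close>

text \<open>Openness of the overlaps is not part of the definition of a manifold; it follows because the
  charts are homeomorphisms onto open sets.\<close>

lemma smooth_manifold_atlas:
  assumes "smooth_manifold M \<A>"
  shows "smooth_atlas \<A>"
proof
  fix c d assume c: "c \<in> \<A>" and d: "d \<in> \<A>"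
  have open_c: "openin M (fst c)" "open (snd c ` fst c)"
    and hom: "homeomorphic_map (subtopology M (fst c)) (top_of_set (snd c ` fst c)) (snd c)"
    and open_d: "openin M (fst d)"
    using assms c d unfolding smooth_manifold_def by blast+
  have space: "topspace (subtopology M (fst c)) = fst c"
    using openin_subset[OF open_c(1)] by (auto simp: topspace_subtopology)
  show "inj_on (snd c) (fst c)"
    using hom space unfolding homeomorphic_eq_everything_map by simp
  have "openin (subtopology M (fst c)) (fst c \<inter> fst d)"
    using open_d by (subst Int_commute) (rule openin_subtopology_Int)
  then have "openin (top_of_set (snd c ` fst c)) (snd c ` (fst c \<inter> fst d))"
    using homeomorphic_map_openness[OF hom, of "fst c \<inter> fst d"] unfolding space by blast
  then show "open (snd c ` (fst c \<inter> fst d))"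
    using open_c(2) openin_open_trans by blast
  show "smooth_on (snd c ` (fst c \<inter> fst d)) (transition c d)"
    using assms c d unfolding smooth_manifold_def by blast
qed

locale coordinate_atlas = smooth_atlas \<A> for \<A> :: "('m, real^'n::finite) chart set"
begin

lemma cotangent_chart_domain:
  "P \<in> fst (cotangent_chart \<A> c) \<longleftrightarrow> fst P \<in> fst c \<and> snd P \<in> cotangent_space \<A> (fst P)"
  by (simp add: cotangent_chart_def)

lemma cotangent_chart_apply: "snd (cotangent_chart \<A> c) P = (snd c (fst P), momenta \<A> c P)"
  by (simp add: cotangent_chart_def)

text \<open>Covectors are functionals on chart-independent tangent vectors, so the pairing with the
  components in any one chart recovers them.\<close>

lemma covector_eq_momenta:
  assumes c: "c \<in> \<A>" and P: "P \<in> fst (cotangent_chart \<A> c)" and u: "u \<in> tangent_space \<A> (fst P)"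
  shows "snd P u = momenta \<A> c P \<bullet> u c"
proof -
  let ?f = "\<lambda>w. snd P (chart_vector \<A> c (fst P) w)"
  have p: "fst P \<in> fst c" and \<omega>: "snd P \<in> cotangent_space \<A> (fst P)"
    using P by (auto simp: cotangent_chart_domain)
  have lincomb: "?f (a *\<^sub>R v + b *\<^sub>R w) = a * ?f v + b * ?f w" for a b v w
    using \<omega> chart_vector_in_tangent_space[OF c p]
    unfolding chart_vector_lincomb[OF c p] cotangent_space_def by blast
  have "linear ?f"
    using lincomb[of 1 _ 1] lincomb[of _ _ 0] by (intro linearI) auto
  from linear_inner_vec[OF this, of "u c"] show ?thesis
    by (simp add: momenta_def chart_vector_component[OF u c p])
qed

text \<open>The inverse of the induced chart.\<close>

definition covector_at ::
  "('m, real^'n) chart \<Rightarrow> (real^'n) \<times> (real^'n) \<Rightarrow> ('m, real^'n) cotangent" where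
  "covector_at c z =
    (let p = chart_inv c (fst z) in (p, restrict (\<lambda>u. snd z \<bullet> u c) (tangent_space \<A> p)))"

lemma covector_at:
  assumes c: "c \<in> \<A>" and p: "p \<in> fst c"
  shows "fst (covector_at c (snd c p, m)) = p"
    and "\<And>u. u \<in> tangent_space \<A> p \<Longrightarrow> snd (covector_at c (snd c p, m)) u = m \<bullet> u c"
    and "snd (covector_at c (snd c p, m)) \<in> cotangent_space \<A> p"
    and "\<And>d. d \<in> \<A> \<Longrightarrow> p \<in> fst d \<Longrightarrow> momenta \<A> d (covector_at c (snd c p, m))
      = (\<chi> j. m \<bullet> chart_vector \<A> d p (axis j 1) c)"
proof -
  show 1: "fst (covector_at c (snd c p, m)) = p"
    using c p by (simp add: covector_at_def)
  show 2: "snd (covector_at c (snd c p, m)) u = m \<bullet> u c" if "u \<in> tangent_space \<A> p" for u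
    using c p that by (simp add: covector_at_def)
  show "snd (covector_at c (snd c p, m)) \<in> cotangent_space \<A> p"
    using c p tangent_space_lincomb
    by (simp add: covector_at_def cotangent_space_def inner_add_right)
  show "momenta \<A> d (covector_at c (snd c p, m))
      = (\<chi> j. m \<bullet> chart_vector \<A> d p (axis j 1) c)" if "d \<in> \<A>" "p \<in> fst d" for d
    unfolding momenta_def 1 by (simp add: 2 chart_vector_in_tangent_space that)
qed

text \<open>Covectors are extensional functions, hence determined by their values on tangent vectors, hence
  by their momenta.\<close>

lemma inj_cotangent_chart:
  assumes c: "c \<in> \<A>"
  shows "inj_on (snd (cotangent_chart \<A> c)) (fst (cotangent_chart \<A> c))"
proof (rule inj_onI)
  fix P Q assume P: "P \<in> fst (cotangent_chart \<A> c)" and Q: "Q \<in> fst (cotangent_chart \<A> c)"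
    and eq: "snd (cotangent_chart \<A> c) P = snd (cotangent_chart \<A> c) Q"
  have base: "fst P = fst Q"
    using eq P Q inj_chart[OF c] by (auto simp: cotangent_chart_apply cotangent_chart_domain inj_on_def)
  have "snd P u = snd Q u" if "u \<in> tangent_space \<A> (fst P)" for u
    using covector_eq_momenta[OF c P that] covector_eq_momenta[OF c Q] that base eq
    by (simp add: cotangent_chart_apply)
  moreover have "snd P \<in> extensional (tangent_space \<A> (fst P))" "snd Q \<in> extensional (tangent_space \<A> (fst P))"
    using P Q base by (auto simp: cotangent_chart_domain cotangent_space_def)
  ultimately have "snd P = snd Q"
    by (intro extensionalityI)
  with base show "P = Q" by (simp add: prod_eq_iff)
qed

lemma cotangent_chart_image:
  assumes c: "c \<in> \<A>" and d: "d \<in> \<A>"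
  shows "snd (cotangent_chart \<A> c) ` (fst (cotangent_chart \<A> c) \<inter> fst (cotangent_chart \<A> d))
    = snd c ` (fst c \<inter> fst d) \<times> UNIV"
proof (intro set_eqI iffI)
  fix z assume "z \<in> snd c ` (fst c \<inter> fst d) \<times> (UNIV :: (real^'n) set)"
  then obtain p m where p: "p \<in> fst c" "p \<in> fst d" and z: "z = (snd c p, m)" by auto
  have "chart_vector \<A> c p w c = w" for w
    by (rule chart_vector_self[OF c p(1)])
  then have "z = snd (cotangent_chart \<A> c) (covector_at c (snd c p, m))"
    using c p by (simp add: z cotangent_chart_apply covector_at(1,4) inner_axis)
  moreover have "covector_at c (snd c p, m) \<in> fst (cotangent_chart \<A> c) \<inter> fst (cotangent_chart \<A> d)"
    using c p by (simp add: cotangent_chart_domain covector_at(1,3))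
  ultimately show "z \<in> snd (cotangent_chart \<A> c) `
      (fst (cotangent_chart \<A> c) \<inter> fst (cotangent_chart \<A> d))"
    by blast
qed (auto simp: cotangent_chart_domain cotangent_chart_apply)

lemma cotangent_chart_inv:
  assumes c: "c \<in> \<A>" and p: "p \<in> fst c"
  shows "chart_inv (cotangent_chart \<A> c) (snd c p, m) = covector_at c (snd c p, m)"
proof (rule inv_into_f_eq[OF inj_cotangent_chart[OF c]])
  show "covector_at c (snd c p, m) \<in> fst (cotangent_chart \<A> c)"
    using c p by (simp add: cotangent_chart_domain covector_at(1,3))
  show "snd (cotangent_chart \<A> c) (covector_at c (snd c p, m)) = (snd c p, m)"
    using c p chart_vector_self[OF c p] by (simp add: cotangent_chart_apply covector_at(1,4) inner_axis)
qed

text \<open>Momenta transform by the transposed derivative of the inverse transition map.\<close>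

lemma cotangent_transition:
  assumes c: "c \<in> \<A>" and d: "d \<in> \<A>" and x: "x \<in> snd c ` (fst c \<inter> fst d)"
  shows "transition (cotangent_chart \<A> c) (cotangent_chart \<A> d) (x, m) =
    (transition c d x,
     \<Sum>j\<in>UNIV. (m \<bullet> dir_deriv (transition d c) (transition c d x) (axis j 1)) *\<^sub>R axis j 1)"
proof -
  obtain p where p: "p \<in> fst c" "p \<in> fst d" "x = snd c p" using x by auto
  have "transition (cotangent_chart \<A> c) (cotangent_chart \<A> d) (x, m)
      = (snd d p, \<chi> j. m \<bullet> chart_vector \<A> d p (axis j 1) c)"
    using c d p
    by (simp add: transition_def[of "cotangent_chart \<A> c"] cotangent_chart_inv cotangent_chart_apply
        covector_at(1,4))
  also have "(\<chi> j. m \<bullet> chart_vector \<A> d p (axis j 1) c)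
      = (\<Sum>j\<in>UNIV. (m \<bullet> dir_deriv (transition d c) (snd d p) (axis j 1)) *\<^sub>R axis j 1)"
    using c p by (simp add: vec_eq_iff axis_def chart_vector_def if_distrib cong: if_cong)
  finally show ?thesis using c p by simp
qed

lemma smooth_cotangent_transition:
  assumes c: "c \<in> \<A>" and d: "d \<in> \<A>"
  shows "smooth_on (snd c ` (fst c \<inter> fst d) \<times> UNIV)
    (transition (cotangent_chart \<A> c) (cotangent_chart \<A> d))"
proof -
  let ?S = "snd c ` (fst c \<inter> fst d)" and ?T = "snd d ` (fst d \<inter> fst c)"
  let ?S' = "?S \<times> (UNIV :: (real^'n) set)"
  let ?D = "\<lambda>j x. dir_deriv (transition d c) (transition c d x) (axis j 1)"
  have S: "open ?S" and T: "open ?T" and S': "open ?S'"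
    by (intro open_overlap open_Times open_UNIV c d)+
  have tr: "transition c d ` ?S \<subseteq> ?T" using c by auto
  have D: "smooth_on ?S (?D j)" for j
    by (rule smooth_on_compose[OF S T tr smooth_on_dir_deriv[OF T smooth_transition[OF d c]]
          smooth_transition[OF c d]])
  have fst': "k_smooth_on k ?S' fst" and snd': "k_smooth_on k ?S' snd" for k
    by (rule k_smooth_on_linear[OF S' bounded_linear_fst] k_smooth_on_linear[OF S' bounded_linear_snd])+
  have sub: "fst ` ?S' \<subseteq> ?S" by auto
  have "k_smooth_on k ?S' (\<lambda>z. (transition c d (fst z), \<Sum>j\<in>UNIV. (snd z \<bullet> ?D j (fst z)) *\<^sub>R axis j 1))" for k
  proof (rule k_smooth_on_Pair[OF S'])
    show "k_smooth_on k ?S' (\<lambda>z. transition c d (fst z))"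
      by (rule k_smooth_on_compose[OF S' S sub _ fst'])
        (use smooth_transition[OF c d] in \<open>simp add: smooth_on_def\<close>)
    have "k_smooth_on k ?S' (\<lambda>z. ?D j (fst z))" for j
      by (rule k_smooth_on_compose[OF S' S sub _ fst']) (use D in \<open>simp add: smooth_on_def\<close>)
    from k_smooth_on_bilinear[OF S' bounded_bilinear_inner snd' this]
    have "k_smooth_on k ?S' (\<lambda>z. snd z \<bullet> ?D j (fst z))" for j .
    from k_smooth_on_linear_comp[OF S' bounded_linear_scaleR_left this]
    show "k_smooth_on k ?S' (\<lambda>z. \<Sum>j\<in>UNIV. (snd z \<bullet> ?D j (fst z)) *\<^sub>R axis j 1)"
      by (intro k_smooth_on_sum[OF S']) auto
  qed
  then have "smooth_on ?S' (\<lambda>z. (transition c d (fst z), \<Sum>j\<in>UNIV. (snd z \<bullet> ?D j (fst z)) *\<^sub>R axis j 1))"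
    unfolding smooth_on_def by (rule allI)
  then show ?thesis
    by (rule smooth_on_cong[THEN iffD1, rotated])
      (auto simp: cotangent_transition[OF c d] simp del: transition_chart)
qed

lemma smooth_atlas_cotangent: "smooth_atlas (cotangent_atlas \<A>)"
proof
  fix c' d' assume "c' \<in> cotangent_atlas \<A>" "d' \<in> cotangent_atlas \<A>"
  then obtain c d where cd: "c \<in> \<A>" "d \<in> \<A>" "c' = cotangent_chart \<A> c" "d' = cotangent_chart \<A> d"
    by (auto simp: cotangent_atlas_def)
  show "inj_on (snd c') (fst c')"
    using cd inj_cotangent_chart by simp
  show "open (snd c' ` (fst c' \<inter> fst d'))"
    using cd by (simp add: cotangent_chart_image open_Times open_overlap)
  show "smooth_on (snd c' ` (fst c' \<inter> fst d')) (transition c' d')"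
    using cd by (simp add: cotangent_chart_image smooth_cotangent_transition)
qed

end


section \<open>Matrix equations depending differentiably on a parameter\<close>

lemma differentiable_prod:
  fixes f :: "'i \<Rightarrow> 'a::real_normed_vector \<Rightarrow> real"
  assumes "finite I" "\<And>i. i \<in> I \<Longrightarrow> f i differentiable at x"
  shows "(\<lambda>y. \<Prod>i\<in>I. f i y) differentiable at x"
  using assms by (induction I rule: finite_induct) auto

lemma differentiable_det:
  fixes M :: "'a::real_normed_vector \<Rightarrow> real^'n^'n"
  assumes "\<And>i j. (\<lambda>y. M y $ i $ j) differentiable at x"
  shows "(\<lambda>y. det (M y)) differentiable at x"
proof -
  have "finite {p. p permutes (UNIV :: 'n set)}"
    by (rule finite_permutations) simp
  then show ?thesis
    unfolding det_def
    by (intro differentiable_sum ballI differentiable_mult differentiable_const differentiable_prod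
        assms) auto
qed

lemma differentiable_vec_nth_iff:
  fixes f :: "'a::real_normed_vector \<Rightarrow> real^'n"
  shows "f differentiable at x \<longleftrightarrow> (\<forall>i. (\<lambda>y. f y $ i) differentiable at x)"
  by (subst differentiable_componentwise_within)
    (auto simp: Basis_vec_def inner_axis)

lemma matrix_inv_inverse:
  fixes M :: "real^'n^'n"
  assumes "invertible M"
  shows "M ** matrix_inv M = mat 1" "matrix_inv M ** M = mat 1"
  using someI_ex[OF assms[unfolded invertible_def]] unfolding matrix_inv_def by auto

text \<open>By Cramer's rule the solution is a rational function of the coefficients.\<close>

lemma differentiable_matrix_inv_mult:
  fixes M :: "'a::real_normed_vector \<Rightarrow> real^'n^'n"
  assumes "open S" "x \<in> S" and inv: "\<And>y. y \<in> S \<Longrightarrow> invertible (M y)"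
    and M: "\<And>i j. (\<lambda>y. M y $ i $ j) differentiable at x"
    and w: "w differentiable at x"
  shows "(\<lambda>y. matrix_inv (M y) *v w y) differentiable at x"
proof -
  have wi: "(\<lambda>y. w y $ i) differentiable at x" for i
    using w differentiable_vec_nth_iff by blast
  have "(\<lambda>y. det (\<chi> i j. if j = k then w y $ i else M y $ i $ j) / det (M y)) differentiable at x" for k
  proof (intro differentiable_divide differentiable_det)
    show "(\<lambda>y. (\<chi> i j. if j = k then w y $ i else M y $ i $ j) $ i $ j) differentiable at x" for i j
      using wi M by (cases "j = k") simp_all
    show "det (M x) \<noteq> 0"
      using inv[OF assms(2)] invertible_det_nz by blast
  qed (rule M)
  then have cramer_diff: "(\<lambda>y. \<chi> k. det (\<chi> i j. if j = k then w y $ i else M y $ i $ j) / det (M y))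
      differentiable at x"
    by (subst differentiable_vec_nth_iff) simp
  have sol: "matrix_inv (M y) *v w y
      = (\<chi> k. det (\<chi> i j. if j = k then w y $ i else M y $ i $ j) / det (M y))" if "y \<in> S" for y
  proof (rule iffD1[OF cramer])
    show "det (M y) \<noteq> 0"
      using inv[OF that] invertible_det_nz by blast
    show "M y *v (matrix_inv (M y) *v w y) = w y"
      using matrix_inv_inverse(1)[OF inv[OF that]] by (simp add: matrix_vector_mul_assoc)
  qed
  show ?thesis
    unfolding differentiable_def
    by (rule exI, rule has_derivative_transform_within_open[OF has_derivative_dir_deriv[OF cramer_diff]
          assms(1,2)], rule sol[symmetric])
qed


section \<open>Riemannian metrics on open subsets of a Euclidean space\<close>

text \<open>The components of a metric in one chart, as functions on the image of the chart.\<close>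

locale local_metric =
  fixes U :: "(real^'n::finite) set" and G :: "real^'n \<Rightarrow> real^'n^'n"
  assumes open_U: "open U"
    and smooth_G: "smooth_on U (\<lambda>y. G y $ i $ j)"
    and sym_G: "y \<in> U \<Longrightarrow> G y $ i $ j = G y $ j $ i"
    and pos_G: "y \<in> U \<Longrightarrow> v \<noteq> 0 \<Longrightarrow> v \<bullet> (G y *v v) > 0"
begin

definition inner_at :: "real^'n \<Rightarrow> real^'n \<Rightarrow> real^'n \<Rightarrow> real" where
  "inner_at y a b = a \<bullet> (G y *v b)"

definition d_inner_at :: "real^'n \<Rightarrow> real^'n \<Rightarrow> real^'n \<Rightarrow> real^'n \<Rightarrow> real" where
  "d_inner_at y h a b = dir_deriv (\<lambda>z. inner_at z a b) y h"

lemma inner_at_sum: "inner_at y a b = (\<Sum>i\<in>UNIV. \<Sum>j\<in>UNIV. (a $ i * b $ j) *\<^sub>R G y $ i $ j)"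
  by (simp add: inner_at_def inner_vec_def matrix_vector_mult_def sum_distrib_left mult_ac)

lemma inner_at_commute: "y \<in> U \<Longrightarrow> inner_at y a b = inner_at y b a"
  unfolding inner_at_sum by (subst sum.swap) (simp add: sym_G mult_ac)

lemma linear_inner_at_left: "linear (\<lambda>a. inner_at y a b)"
  by (rule linearI) (simp_all add: inner_at_def inner_add_left)

lemma linear_inner_at_right: "linear (inner_at y a)"
  by (rule linearI)
    (simp_all add: inner_at_def inner_add_right linear_add[OF matrix_vector_mul_linear]
      linear_scale[OF matrix_vector_mul_linear])

lemmas inner_at_linear_simps =
  linear_add[OF linear_inner_at_left] linear_add[OF linear_inner_at_right]
  linear_diff[OF linear_inner_at_left] linear_diff[OF linear_inner_at_right]
  linear_scale[OF linear_inner_at_left] linear_scale[OF linear_inner_at_right]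
  linear_0[OF linear_inner_at_left] linear_0[OF linear_inner_at_right]

lemma inner_at_pos: "y \<in> U \<Longrightarrow> v \<noteq> 0 \<Longrightarrow> inner_at y v v > 0"
  by (simp add: inner_at_def pos_G)

lemma inner_at_eqI:
  assumes "y \<in> U" "\<And>c. inner_at y c a = inner_at y c b"
  shows "a = b"
proof (rule ccontr)
  assume "a \<noteq> b"
  then have "inner_at y (a - b) (a - b) > 0"
    using inner_at_pos assms(1) by simp
  then show False
    using assms(2)[of "a - b"] by (simp add: inner_at_linear_simps)
qed

lemma smooth_inner_at: "smooth_on U (\<lambda>z. inner_at z a b)"
  unfolding smooth_on_def inner_at_sum
  using smooth_G[unfolded smooth_on_def]
  by (intro allI k_smooth_on_sum k_smooth_on_linear_comp[OF _ bounded_linear_scaleR_right] open_U)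
    auto

lemma has_derivative_inner_at: "y \<in> U \<Longrightarrow> ((\<lambda>z. inner_at z a b) has_derivative (\<lambda>h. d_inner_at y h a b)) (at y)"
  unfolding d_inner_at_def by (rule smooth_on_has_derivative[OF open_U smooth_inner_at])

lemma d_inner_at_commute:
  assumes "y \<in> U"
  shows "d_inner_at y h a b = d_inner_at y h b a"
proof -
  have "((\<lambda>z. inner_at z a b) has_derivative (\<lambda>h. d_inner_at y h b a)) (at y)"
    by (rule has_derivative_transform_within_open[OF has_derivative_inner_at[OF assms] open_U assms])
      (rule inner_at_commute)
  then show ?thesis
    unfolding d_inner_at_def by (rule dir_deriv_eqI)
qed

lemma linear_d_inner_at_right:
  assumes "y \<in> U"
  shows "linear (d_inner_at y h a)"
proof (rule linearI)
  fix b b' and r :: real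
  have "((\<lambda>z. inner_at z a (b + b')) has_derivative (\<lambda>h. d_inner_at y h a b + d_inner_at y h a b')) (at y)"
    unfolding inner_at_linear_simps by (intro has_derivative_add has_derivative_inner_at assms)
  then show "d_inner_at y h a (b + b') = d_inner_at y h a b + d_inner_at y h a b'"
    by (subst d_inner_at_def) (rule dir_deriv_eqI)
  have "((\<lambda>z. inner_at z a (r *\<^sub>R b)) has_derivative (\<lambda>h. r *\<^sub>R d_inner_at y h a b)) (at y)"
    unfolding inner_at_linear_simps by (intro has_derivative_scaleR_right has_derivative_inner_at assms)
  then show "d_inner_at y h a (r *\<^sub>R b) = r *\<^sub>R d_inner_at y h a b"
    by (subst d_inner_at_def) (rule dir_deriv_eqI)
qed

lemma linear_d_inner_at_left:
  assumes "y \<in> U"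
  shows "linear (\<lambda>a. d_inner_at y h a b)"
proof -
  have "(\<lambda>a. d_inner_at y h a b) = d_inner_at y h b"
    using d_inner_at_commute[OF assms] by (intro ext)
  then show ?thesis
    by (simp only: linear_d_inner_at_right[OF assms])
qed

lemma linear_d_inner_at_dir: "y \<in> U \<Longrightarrow> linear (\<lambda>h. d_inner_at y h a b)"
  using has_derivative_inner_at has_derivative_linear by blast

lemma has_derivative_inner_at_field:
  assumes "(f has_derivative f') (at z)" "f z \<in> U" "(w has_derivative w') (at z)"
  shows "((\<lambda>z. inner_at (f z) e (w z)) has_derivative
    (\<lambda>k. d_inner_at (f z) (f' k) e (w z) + inner_at (f z) e (w' k))) (at z)"
proof -
  have "((\<lambda>z. \<Sum>b\<in>Basis. (w z \<bullet> b) *\<^sub>R inner_at (f z) e b) has_derivative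
      (\<lambda>k. \<Sum>b\<in>Basis. (w z \<bullet> b) *\<^sub>R d_inner_at (f z) (f' k) e b + (w' k \<bullet> b) *\<^sub>R inner_at (f z) e b)) (at z)"
    by (intro has_derivative_sum has_derivative_scaleR has_derivative_inner_left assms
        has_derivative_compose[OF assms(1) has_derivative_inner_at])
  then show ?thesis
    by (simp only: sum.distrib linear_expand_Basis[OF linear_inner_at_right, symmetric]
        linear_expand_Basis[OF linear_d_inner_at_right[OF assms(2)], symmetric])
qed

lemma invertible_G: "y \<in> U \<Longrightarrow> invertible (G y)"
proof -
  assume y: "y \<in> U"
  have "inj ((*v) (G y))"
  proof (rule injI)
    fix a b assume "G y *v a = G y *v b"
    then show "a = b"
      by (intro inner_at_eqI[OF y]) (simp add: inner_at_def)
  qed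
  then show ?thesis
    using invertible_left_inverse matrix_left_invertible_injective by blast
qed

lemma inner_at_matrix_inv:
  assumes "y \<in> U"
  shows "inner_at y c (matrix_inv (G y) *v r) = c \<bullet> r"
  using matrix_inv_inverse(1)[OF invertible_G[OF assms]]
  by (simp add: inner_at_def matrix_vector_mul_assoc)

lemma differentiable_sharp:
  assumes "(f has_derivative f') (at z)" "f z \<in> U" "open S" "z \<in> S" "f ` S \<subseteq> U" "w differentiable at z"
  shows "(\<lambda>z. matrix_inv (G (f z)) *v w z) differentiable at z"
proof (rule differentiable_matrix_inv_mult[OF assms(3,4) _ _ assms(6)])
  show "(\<lambda>y. G (f y) $ i $ j) differentiable at z" for i j
    using has_derivative_compose[OF assms(1) smooth_on_has_derivative[OF open_U smooth_G assms(2)]]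
    unfolding differentiable_def by blast
qed (use assms(5) invertible_G in auto)

text \<open>The Christoffel symbols as a bilinear map.\<close>

definition gamma :: "real^'n \<Rightarrow> real^'n \<Rightarrow> real^'n \<Rightarrow> real^'n" where
  "gamma y a b = matrix_inv (G y) *v
    (\<chi> h. (d_inner_at y a (axis h 1) b + d_inner_at y b (axis h 1) a - d_inner_at y (axis h 1) a b) / 2)"

definition d_gamma :: "real^'n \<Rightarrow> real^'n \<Rightarrow> real^'n \<Rightarrow> real^'n \<Rightarrow> real^'n" where
  "d_gamma y h a b = dir_deriv (\<lambda>z. gamma z a b) y h"

definition curvature :: "real^'n \<Rightarrow> real^'n \<Rightarrow> real^'n \<Rightarrow> real^'n \<Rightarrow> real^'n" where
  "curvature y a b c = d_gamma y a b c - d_gamma y b a c + gamma y a (gamma y b c) - gamma y b (gamma y a c)"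

text \<open>Koszul's formula for coordinate fields; it characterizes the Christoffel symbols without the
  inverse matrix of the metric.\<close>

lemma inner_at_gamma:
  assumes y: "y \<in> U"
  shows "inner_at y c (gamma y a b) = (d_inner_at y a c b + d_inner_at y b c a - d_inner_at y c a b) / 2"
proof -
  let ?f = "\<lambda>c. (d_inner_at y a c b + d_inner_at y b c a - d_inner_at y c a b) / 2"
  have lin: "linear ?f"
    by (rule linearI)
      (simp_all add: linear_add[OF linear_d_inner_at_left[OF y]] linear_scale[OF linear_d_inner_at_left[OF y]]
        linear_add[OF linear_d_inner_at_dir[OF y]] linear_scale[OF linear_d_inner_at_dir[OF y]] field_simps)
  have "?f (\<Sum>h\<in>UNIV. c $ h *\<^sub>R axis h 1) = (\<Sum>h\<in>UNIV. c $ h *\<^sub>R ?f (axis h 1))"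
    by (simp only: linear_sum[OF lin] linear_scale[OF lin])
  moreover have "(\<Sum>h\<in>UNIV. c $ h *\<^sub>R axis h 1) = c"
    by (simp add: vec_eq_iff axis_def if_distrib cong: if_cong)
  ultimately have "?f c = (\<Sum>h\<in>UNIV. c $ h *\<^sub>R ?f (axis h 1))"
    by simp
  then show ?thesis
    by (simp add: gamma_def inner_at_matrix_inv[OF y] inner_vec_def)
qed

lemma gamma_commute:
  assumes "y \<in> U"
  shows "gamma y a b = gamma y b a"
proof (rule inner_at_eqI[OF assms])
  show "inner_at y c (gamma y a b) = inner_at y c (gamma y b a)" for c
    unfolding inner_at_gamma[OF assms] d_inner_at_commute[OF assms, of c a b] by simp
qed

lemma linear_gamma_right:
  assumes y: "y \<in> U"
  shows "linear (gamma y a)"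
proof (rule linearI)
  show "gamma y a (b + b') = gamma y a b + gamma y a b'" for b b'
    by (rule inner_at_eqI[OF y])
      (simp add: inner_at_gamma[OF y] inner_at_linear_simps linear_add[OF linear_d_inner_at_right[OF y]]
        linear_add[OF linear_d_inner_at_dir[OF y]] field_simps)
  show "gamma y a (r *\<^sub>R b) = r *\<^sub>R gamma y a b" for r b
    by (rule inner_at_eqI[OF y])
      (simp add: inner_at_gamma[OF y] inner_at_linear_simps linear_scale[OF linear_d_inner_at_right[OF y]]
        linear_scale[OF linear_d_inner_at_dir[OF y]] field_simps)
qed

lemma linear_gamma_left:
  assumes "y \<in> U"
  shows "linear (\<lambda>a. gamma y a b)"
proof -
  have "(\<lambda>a. gamma y a b) = gamma y b"
    using gamma_commute[OF assms] by (intro ext)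
  then show ?thesis
    by (simp only: linear_gamma_right[OF assms])
qed

text \<open>The Levi-Civita connection preserves the metric.\<close>

lemma metric_compatible:
  assumes "y \<in> U"
  shows "d_inner_at y a b c = inner_at y (gamma y a b) c + inner_at y b (gamma y a c)"
  using d_inner_at_commute[OF assms, of a b c] d_inner_at_commute[OF assms, of b a c] d_inner_at_commute[OF assms, of c a b]
  unfolding inner_at_commute[OF assms, of "gamma y a b"] inner_at_gamma[OF assms] by (simp add: field_simps)

lemma smooth_d_inner_at: "smooth_on U (\<lambda>z. d_inner_at z h a b)"
  unfolding d_inner_at_def by (rule smooth_on_dir_deriv[OF open_U smooth_inner_at])

definition dd_inner_at :: "real^'n \<Rightarrow> real^'n \<Rightarrow> real^'n \<Rightarrow> real^'n \<Rightarrow> real^'n \<Rightarrow> real" where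
  "dd_inner_at y h k a b = dir_deriv (\<lambda>z. d_inner_at z k a b) y h"

lemma has_derivative_d_inner_at: "y \<in> U \<Longrightarrow> ((\<lambda>z. d_inner_at z k a b) has_derivative (\<lambda>h. dd_inner_at y h k a b)) (at y)"
  unfolding dd_inner_at_def by (rule smooth_on_has_derivative[OF open_U smooth_d_inner_at])

lemma dd_inner_at_commute_dir: "y \<in> U \<Longrightarrow> dd_inner_at y h k a b = dd_inner_at y k h a b"
  unfolding dd_inner_at_def d_inner_at_def by (rule dir_deriv_commute[OF open_U smooth_inner_at])

lemma dd_inner_at_commute:
  assumes "y \<in> U"
  shows "dd_inner_at y h k a b = dd_inner_at y h k b a"
proof -
  have "((\<lambda>z. d_inner_at z k a b) has_derivative (\<lambda>h. dd_inner_at y h k b a)) (at y)"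
    by (rule has_derivative_transform_within_open[OF has_derivative_d_inner_at[OF assms] open_U assms])
      (rule d_inner_at_commute)
  then show ?thesis
    unfolding dd_inner_at_def by (rule dir_deriv_eqI)
qed

lemma differentiable_gamma:
  assumes "y \<in> U"
  shows "(\<lambda>z. gamma z a b) differentiable at y"
  unfolding gamma_def
proof (rule differentiable_sharp[OF has_derivative_ident assms open_U assms])
  have "(\<lambda>z. d_inner_at z h c d) differentiable at y" for h c d
    using has_derivative_d_inner_at[OF assms] unfolding differentiable_def by blast
  then show "(\<lambda>z. \<chi> h. (d_inner_at z a (axis h 1) b + d_inner_at z b (axis h 1) a - d_inner_at z (axis h 1) a b) / 2)
      differentiable at y"
    by (subst differentiable_vec_nth_iff) simp
qed simp

lemma has_derivative_gamma: "y \<in> U \<Longrightarrow> ((\<lambda>z. gamma z a b) has_derivative (\<lambda>h. d_gamma y h a b)) (at y)"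
  unfolding d_gamma_def by (rule has_derivative_dir_deriv[OF differentiable_gamma])

lemma d_gamma_commute:
  assumes "y \<in> U"
  shows "d_gamma y h a b = d_gamma y h b a"
proof -
  have "((\<lambda>z. gamma z a b) has_derivative (\<lambda>h. d_gamma y h b a)) (at y)"
    by (rule has_derivative_transform_within_open[OF has_derivative_gamma[OF assms] open_U assms])
      (rule gamma_commute)
  then show ?thesis
    unfolding d_gamma_def by (rule dir_deriv_eqI)
qed

lemma linear_d_gamma_right:
  assumes "y \<in> U"
  shows "linear (d_gamma y h a)"
proof (rule linearI)
  fix b b' and r :: real
  have "((\<lambda>z. gamma z a (b + b')) has_derivative (\<lambda>h. d_gamma y h a b + d_gamma y h a b')) (at y)"
    by (rule has_derivative_transform_within_open[OF has_derivative_add[OF has_derivative_gamma[OF assms]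
            has_derivative_gamma[OF assms]] open_U assms])
      (simp add: linear_add[OF linear_gamma_right])
  then show "d_gamma y h a (b + b') = d_gamma y h a b + d_gamma y h a b'"
    by (subst d_gamma_def) (rule dir_deriv_eqI)
  have "((\<lambda>z. gamma z a (r *\<^sub>R b)) has_derivative (\<lambda>h. r *\<^sub>R d_gamma y h a b)) (at y)"
    by (rule has_derivative_transform_within_open[OF has_derivative_scaleR_right[OF
            has_derivative_gamma[OF assms]] open_U assms])
      (simp add: linear_scale[OF linear_gamma_right])
  then show "d_gamma y h a (r *\<^sub>R b) = r *\<^sub>R d_gamma y h a b"
    by (subst d_gamma_def) (rule dir_deriv_eqI)
qed

lemma linear_d_gamma_left:
  assumes "y \<in> U"
  shows "linear (\<lambda>a. d_gamma y h a b)"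
proof -
  have "(\<lambda>a. d_gamma y h a b) = d_gamma y h b"
    using d_gamma_commute[OF assms] by (intro ext)
  then show ?thesis
    by (simp only: linear_d_gamma_right[OF assms])
qed

lemma linear_d_gamma_dir: "y \<in> U \<Longrightarrow> linear (\<lambda>h. d_gamma y h a b)"
  using has_derivative_gamma has_derivative_linear by blast

lemma linear_curvature:
  assumes y: "y \<in> U"
  shows "linear (\<lambda>a. curvature y a b c)" "linear (\<lambda>b. curvature y a b c)" "linear (\<lambda>c. curvature y a b c)"
  unfolding curvature_def
  by (rule linearI; simp add: algebra_simps linear_add[OF linear_d_gamma_right[OF y]] linear_scale[OF linear_d_gamma_right[OF y]]
        linear_add[OF linear_d_gamma_left[OF y]] linear_scale[OF linear_d_gamma_left[OF y]]
        linear_add[OF linear_d_gamma_dir[OF y]] linear_scale[OF linear_d_gamma_dir[OF y]]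
        linear_add[OF linear_gamma_left[OF y]] linear_scale[OF linear_gamma_left[OF y]]
        linear_add[OF linear_gamma_right[OF y]] linear_scale[OF linear_gamma_right[OF y]])+

lemma curvature_antisym: "curvature y b a c = - curvature y a b c"
  by (simp add: curvature_def)

lemma curvature_bianchi:
  assumes y: "y \<in> U"
  shows "curvature y a b c + curvature y b c a + curvature y c a b = 0"
  unfolding curvature_def
  using d_gamma_commute[OF y, of a b c] d_gamma_commute[OF y, of b c a] d_gamma_commute[OF y, of c a b]
    gamma_commute[OF y, of b c] gamma_commute[OF y, of c a] gamma_commute[OF y, of a b]
  by simp

text \<open>Differentiating the defining equation of the Christoffel symbols expresses the curvature by
  the second derivatives of the metric and by products of Christoffel symbols; both parts are
  visibly antisymmetric in the last two arguments.\<close>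

lemma curvature_metric_antisym:
  assumes y: "y \<in> U"
  shows "inner_at y d (curvature y a b c) = - inner_at y c (curvature y a b d)"
proof -
  have deriv: "inner_at y d (d_gamma y a b c + gamma y a (gamma y b c))
      = (dd_inner_at y a b d c + dd_inner_at y a c d b - dd_inner_at y a d b c) / 2 - inner_at y (gamma y a d) (gamma y b c)" for a b c d
  proof -
    have 1: "((\<lambda>z. inner_at z d (gamma z b c)) has_derivative
        (\<lambda>h. d_inner_at y h d (gamma y b c) + inner_at y d (d_gamma y h b c))) (at y)"
      by (rule has_derivative_inner_at_field[OF has_derivative_ident y has_derivative_gamma[OF y]])
    have "((\<lambda>z. (d_inner_at z b d c + d_inner_at z c d b - d_inner_at z d b c) / 2) has_derivative
        (\<lambda>h. (dd_inner_at y h b d c + dd_inner_at y h c d b - dd_inner_at y h d b c) / 2)) (at y)"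
      by (intro bounded_linear.has_derivative[OF bounded_linear_divide] has_derivative_add has_derivative_diff
          has_derivative_d_inner_at y)
    then have 2: "((\<lambda>z. inner_at z d (gamma z b c)) has_derivative
        (\<lambda>h. (dd_inner_at y h b d c + dd_inner_at y h c d b - dd_inner_at y h d b c) / 2)) (at y)"
      by (rule has_derivative_transform_within_open[OF _ open_U y]) (simp add: inner_at_gamma)
    have "d_inner_at y a d (gamma y b c) + inner_at y d (d_gamma y a b c)
        = (dd_inner_at y a b d c + dd_inner_at y a c d b - dd_inner_at y a d b c) / 2"
      by (rule fun_cong[OF has_derivative_unique[OF 1 2]])
    then show ?thesis
      by (simp add: metric_compatible[OF y] inner_at_linear_simps field_simps)
  qed
  have lower: "inner_at y d (curvature y a b c) = (dd_inner_at y a c d b - dd_inner_at y a d b c - dd_inner_at y b c d a + dd_inner_at y b d a c) / 2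
      - inner_at y (gamma y a d) (gamma y b c) + inner_at y (gamma y b d) (gamma y a c)" for a b c d
  proof -
    have "inner_at y d (curvature y a b c) = inner_at y d (d_gamma y a b c + gamma y a (gamma y b c))
        - inner_at y d (d_gamma y b a c + gamma y b (gamma y a c))"
      by (simp add: curvature_def inner_at_linear_simps)
    then show ?thesis
      unfolding deriv using dd_inner_at_commute_dir[OF y, of a b d c] by (simp add: field_simps)
  qed
  show ?thesis
    unfolding lower
    using dd_inner_at_commute[OF y, of a c d b] dd_inner_at_commute[OF y, of a d b c] dd_inner_at_commute[OF y, of b c d a]
      dd_inner_at_commute[OF y, of b d a c]
      inner_at_commute[OF y, of "gamma y a d" "gamma y b c"] inner_at_commute[OF y, of "gamma y b d" "gamma y a c"]
    by (simp add: field_simps)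
qed

end


section \<open>Phase space of a local metric\<close>

context local_metric
begin

text \<open>The horizontal lift of \<open>a\<close> at the point \<open>z = (x, p)\<close> is \<open>(a, hor_lift z a)\<close>; this is
  \<open>\<delta>/\<delta>q\<^sup>i\<close> for the \<open>i\<close>-th unit vector.\<close>

definition hor_lift :: "(real^'n) \<times> (real^'n) \<Rightarrow> real^'n \<Rightarrow> real^'n" where
  "hor_lift z a = (\<chi> h. snd z \<bullet> gamma (fst z) a (axis h 1))"

definition sharp :: "(real^'n) \<times> (real^'n) \<Rightarrow> real^'n" where
  "sharp z = matrix_inv (G (fst z)) *v snd z"

definition kinetic :: "(real^'n) \<times> (real^'n) \<Rightarrow> real" where
  "kinetic z = (snd z \<bullet> sharp z) / 2"

lemma inner_hor_lift:
  assumes "fst z \<in> U"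
  shows "hor_lift z a \<bullet> c = snd z \<bullet> gamma (fst z) a c"
proof -
  have "linear (\<lambda>c. snd z \<bullet> gamma (fst z) a c)"
    by (rule linearI)
      (simp_all add: linear_add[OF linear_gamma_right[OF assms]] linear_scale[OF linear_gamma_right[OF assms]]
        inner_add_right)
  then show ?thesis
    unfolding hor_lift_def by (rule linear_inner_vec)
qed

lemma linear_hor_lift:
  assumes "fst z \<in> U"
  shows "linear (hor_lift z)"
  unfolding hor_lift_def
  by (rule linearI)
    (simp_all add: vec_eq_iff linear_add[OF linear_gamma_left[OF assms]]
      linear_scale[OF linear_gamma_left[OF assms]] inner_add_right)

lemma open_phase_space: "open (U \<times> (UNIV :: (real^'n) set))"
  by (rule open_Times[OF open_U open_UNIV])

lemma inner_at_sharp: "fst z \<in> U \<Longrightarrow> inner_at (fst z) e (sharp z) = snd z \<bullet> e"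
  by (simp add: sharp_def inner_at_matrix_inv inner_commute)

lemma kinetic_eq: "fst z \<in> U \<Longrightarrow> 2 * kinetic z = snd z \<bullet> sharp z"
  by (simp add: kinetic_def)

lemma kinetic_nonneg: "fst z \<in> U \<Longrightarrow> kinetic z \<ge> 0"
  using inner_at_sharp[of z "sharp z"] inner_at_pos[of "fst z" "sharp z"]
  by (cases "sharp z = 0") (auto simp: kinetic_def)

lemma differentiable_sharp_phase:
  assumes "fst z \<in> U"
  shows "sharp differentiable at z"
  unfolding sharp_def
  by (rule differentiable_sharp[OF has_derivative_fst[OF has_derivative_ident] assms
        open_phase_space])
    (use assms in \<open>auto simp: mem_Times_iff intro!: bounded_linear_imp_differentiable bounded_linear_snd\<close>)

lemma has_derivative_kinetic:
  assumes z: "fst z \<in> U"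
  shows "(kinetic has_derivative
    (\<lambda>k. snd k \<bullet> sharp z - d_inner_at (fst z) (fst k) (sharp z) (sharp z) / 2)) (at z)"
proof -
  let ?P = "sharp z" and ?P' = "dir_deriv sharp z"
  have P: "(sharp has_derivative ?P') (at z)"
    by (rule has_derivative_dir_deriv[OF differentiable_sharp_phase[OF z]])
  have snd': "(snd has_derivative snd) (at z)"
    by (rule bounded_linear_imp_has_derivative[OF bounded_linear_snd])
  have key: "d_inner_at (fst z) (fst k) e ?P + inner_at (fst z) e (?P' k) = snd k \<bullet> e" for e k
  proof -
    have 1: "((\<lambda>z. inner_at (fst z) e (sharp z)) has_derivative
        (\<lambda>k. d_inner_at (fst z) (fst k) e ?P + inner_at (fst z) e (?P' k))) (at z)"
      by (rule has_derivative_inner_at_field[OF has_derivative_fst[OF has_derivative_ident] z P])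
    have 2: "((\<lambda>z. inner_at (fst z) e (sharp z)) has_derivative (\<lambda>k. snd k \<bullet> e)) (at z)"
      by (rule has_derivative_transform_within_open[OF has_derivative_inner_left[OF snd']
            open_phase_space])
        (use z in \<open>auto simp: mem_Times_iff inner_at_sharp\<close>)
    show ?thesis
      by (rule fun_cong[OF has_derivative_unique[OF 1 2]])
  qed
  have "(kinetic has_derivative (\<lambda>k. (snd z \<bullet> ?P' k + snd k \<bullet> ?P) / 2)) (at z)"
    unfolding kinetic_def
    by (rule bounded_linear.has_derivative[OF bounded_linear_divide has_derivative_inner[OF snd' P]])
  moreover have "(snd z \<bullet> ?P' k + snd k \<bullet> ?P) / 2
      = snd k \<bullet> ?P - d_inner_at (fst z) (fst k) ?P ?P / 2" for k
    using key[of k ?P] inner_at_sharp[OF z, of "?P' k"] inner_at_commute[OF z, of ?P "?P' k"]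
    by (simp add: field_simps)
  ultimately show ?thesis by simp
qed

text \<open>The energy is constant along horizontal curves, as parallel transport preserves the
  metric.\<close>

lemma kinetic_derivative_horizontal:
  assumes z: "fst z \<in> U"
  shows "hor_lift z a \<bullet> sharp z - d_inner_at (fst z) a (sharp z) (sharp z) / 2 = 0"
proof -
  have "hor_lift z a \<bullet> sharp z = inner_at (fst z) (sharp z) (gamma (fst z) a (sharp z))"
    using inner_hor_lift[OF z] inner_at_sharp[OF z] inner_at_commute[OF z] by metis
  then show ?thesis
    using d_inner_at_commute[OF z] by (simp add: inner_at_gamma[OF z])
qed

lemma has_derivative_momentum_gamma:
  assumes z: "fst z \<in> U"
  shows "((\<lambda>z. snd z \<bullet> gamma (fst z) a c) has_derivative
      (\<lambda>k. snd z \<bullet> d_gamma (fst z) (fst k) a c + snd k \<bullet> gamma (fst z) a c)) (at z)"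
  by (intro has_derivative_inner bounded_linear_imp_has_derivative bounded_linear_snd
      has_derivative_compose[OF has_derivative_fst[OF has_derivative_ident] has_derivative_gamma[OF z]])

lemma differentiable_hor_lift:
  assumes z: "fst z \<in> U"
  shows "(\<lambda>z. hor_lift z a) differentiable at z"
proof -
  have "(\<lambda>z. snd z \<bullet> gamma (fst z) a (axis h 1)) differentiable at z" for h
    using has_derivative_momentum_gamma[OF z] unfolding differentiable_def by blast
  then show ?thesis
    by (subst differentiable_vec_nth_iff) (simp add: hor_lift_def)
qed

lemma inner_dir_deriv_hor_lift:
  assumes z: "fst z \<in> U"
  shows "dir_deriv (\<lambda>z. hor_lift z a) z k \<bullet> c
    = snd k \<bullet> gamma (fst z) a c + snd z \<bullet> d_gamma (fst z) (fst k) a c"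
proof -
  have "((\<lambda>z. hor_lift z a \<bullet> c) has_derivative
      (\<lambda>k. snd z \<bullet> d_gamma (fst z) (fst k) a c + snd k \<bullet> gamma (fst z) a c)) (at z)"
    by (rule has_derivative_transform_within_open[OF has_derivative_momentum_gamma[OF z] open_phase_space])
      (use z in \<open>auto simp: mem_Times_iff inner_hor_lift\<close>)
  then show ?thesis
    unfolding inner_dir_deriv[OF differentiable_hor_lift[OF z]]
    by (subst dir_deriv_eqI) (auto simp: add.commute)
qed

text \<open>The Lie bracket of horizontal lifts is the curvature.\<close>

lemma inner_bracket_horizontal:
  assumes z: "fst z \<in> U"
  shows "(dir_deriv (\<lambda>z. hor_lift z b) z (a, hor_lift z a) - dir_deriv (\<lambda>z. hor_lift z a) z (b, hor_lift z b)) \<bullet> c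
    = snd z \<bullet> curvature (fst z) a b c"
  by (simp add: inner_diff_left inner_dir_deriv_hor_lift[OF z] inner_hor_lift[OF z] curvature_def inner_diff_right
      inner_add_right)

end

text \<open>The negative of the curvature constant that the natural almost complex structure would need at
  energy \<open>t\<close> to be integrable.\<close>

definition obstruction ::
  "real \<Rightarrow> (real \<Rightarrow> real) \<Rightarrow> (real \<Rightarrow> real) \<Rightarrow> (real \<Rightarrow> real) \<Rightarrow> real \<Rightarrow> real" where
  "obstruction A lam b1 lam' t =
     ((A + 2 * t * lam t * b1 t) * A * lam' t + A * b1 t * (lam t)\<^sup>2) / lam t ^ 3"

text \<open>The values of \<open>J\<close> on horizontal vectors determine those on vertical ones by \<open>J\<^sup>2 = -1\<close>, so
  only the former appear.\<close>

locale phase_acs = local_metric U G + euclidean_acs "U \<times> UNIV" J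
  for U :: "(real^'n::finite) set" and G :: "real^'n \<Rightarrow> real^'n^'n"
    and J :: "(real^'n) \<times> (real^'n) \<Rightarrow> (real^'n) \<times> (real^'n) \<Rightarrow> (real^'n) \<times> (real^'n)" +
  fixes A :: real and lam b1 lam' b1' :: "real \<Rightarrow> real"
  assumes lam_pos: "t \<ge> 0 \<Longrightarrow> lam t > 0"
    and lam_deriv: "t \<ge> 0 \<Longrightarrow> (lam has_real_derivative lam' t) (at t within {0..})"
    and b1_deriv: "t \<ge> 0 \<Longrightarrow> (b1 has_real_derivative b1' t) (at t within {0..})"
    and J_horizontal: "fst z \<in> U \<Longrightarrow>
      J z (a, hor_lift z a) = (0, (A / lam (kinetic z)) *\<^sub>R (G (fst z) *v a) + (b1 (kinetic z) * (snd z \<bullet> a)) *\<^sub>R snd z)"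
begin

text \<open>The vertical component of \<open>J\<close> applied to the horizontal lift of \<open>a\<close>; its inner product with \<open>c\<close>
  is \<open>J\<^sup>(\<^sup>1\<^sup>)(a,c)\<close>.\<close>

definition vert_J :: "(real^'n) \<times> (real^'n) \<Rightarrow> real^'n \<Rightarrow> real^'n" where
  "vert_J z a = (A / lam (kinetic z)) *\<^sub>R (G (fst z) *v a) + (b1 (kinetic z) * (snd z \<bullet> a)) *\<^sub>R snd z"

lemma J_hor_lift: "fst z \<in> U \<Longrightarrow> J z (a, hor_lift z a) = (0, vert_J z a)"
  by (simp add: J_horizontal vert_J_def)

lemma inner_vert_J:
  assumes "fst z \<in> U"
  shows "vert_J z a \<bullet> c = A / lam (kinetic z) * inner_at (fst z) a c + b1 (kinetic z) * (snd z \<bullet> a) * (snd z \<bullet> c)"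
  by (simp add: vert_J_def inner_add_left inner_at_commute[OF assms, of a c])
    (simp add: inner_at_def inner_commute)

text \<open>At \<open>p = 0\<close> the energy is on the boundary of the half line, where \<open>\<lambda>\<close> and \<open>b\<^sub>1\<close> have one-sided
  derivatives only. The chain rule holds nevertheless, since the energy never becomes negative.\<close>

lemma has_derivative_compose_kinetic:
  assumes f: "\<And>t. t \<ge> 0 \<Longrightarrow> (f has_real_derivative f' t) (at t within {0..})" and z: "fst z \<in> U"
  shows "((\<lambda>z. f (kinetic z)) has_derivative
    (\<lambda>k. f' (kinetic z) * (snd k \<bullet> sharp z - d_inner_at (fst z) (fst k) (sharp z) (sharp z) / 2))) (at z)"
proof -
  have zS: "z \<in> U \<times> UNIV" using z by (simp add: mem_Times_iff)
  have "((\<lambda>z. f (kinetic z)) has_derivative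
    (\<lambda>k. f' (kinetic z) * (snd k \<bullet> sharp z - d_inner_at (fst z) (fst k) (sharp z) (sharp z) / 2)))
      (at z within U \<times> UNIV)"
  proof (rule has_derivative_in_compose2[where t = "{0..}" and g' = "\<lambda>t. (*) (f' t)"])
    show "(f has_derivative (*) (f' t)) (at t within {0..})" if "t \<in> {0..}" for t
      using f[of t] that by (simp add: has_field_derivative_def)
    show "kinetic ` (U \<times> UNIV) \<subseteq> {0..}"
      using kinetic_nonneg by auto
    show "z \<in> U \<times> UNIV" by (rule zS)
    show "(kinetic has_derivative (\<lambda>k. snd k \<bullet> sharp z - d_inner_at (fst z) (fst k) (sharp z) (sharp z) / 2))
        (at z within U \<times> UNIV)"
      by (rule has_derivative_at_withinI[OF has_derivative_kinetic[OF z]])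
  qed
  then show ?thesis
    by (simp only: at_within_open[OF zS open_phase_space])
qed

abbreviation d_kinetic :: "(real^'n) \<times> (real^'n) \<Rightarrow> (real^'n) \<times> (real^'n) \<Rightarrow> real" where
  "d_kinetic z k \<equiv> snd k \<bullet> sharp z - d_inner_at (fst z) (fst k) (sharp z) (sharp z) / 2"

text \<open>The derivative of \<open>z \<mapsto> J\<^sup>(\<^sup>1\<^sup>)(b,c)\<close> in the direction \<open>k\<close>.\<close>

definition d_vert_J :: "(real^'n) \<times> (real^'n) \<Rightarrow> (real^'n) \<times> (real^'n) \<Rightarrow> real^'n \<Rightarrow> real^'n \<Rightarrow> real" where
  "d_vert_J z k b c =
     - A * lam' (kinetic z) / (lam (kinetic z))\<^sup>2 * d_kinetic z k * inner_at (fst z) b c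
     + A / lam (kinetic z) * d_inner_at (fst z) (fst k) b c
     + b1' (kinetic z) * d_kinetic z k * (snd z \<bullet> b) * (snd z \<bullet> c)
     + b1 (kinetic z) * ((snd k \<bullet> b) * (snd z \<bullet> c) + (snd z \<bullet> b) * (snd k \<bullet> c))"

lemma has_derivative_vert_form:
  assumes z: "fst z \<in> U"
  shows "((\<lambda>z. A / lam (kinetic z) * inner_at (fst z) b c + b1 (kinetic z) * (snd z \<bullet> b) * (snd z \<bullet> c))
    has_derivative (\<lambda>k. d_vert_J z k b c)) (at z)"
proof -
  have "((\<lambda>t. A / lam t) has_real_derivative - A * lam' t / (lam t)\<^sup>2) (at t within {0..})"
    if "t \<ge> 0" for t
    using lam_pos[OF that]
    by (auto intro!: derivative_eq_intros lam_deriv that simp: power2_eq_square)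
  note \<alpha> = has_derivative_compose_kinetic[OF this z]
  note \<beta> = has_derivative_compose_kinetic[OF b1_deriv z]
  have ipd: "((\<lambda>z. inner_at (fst z) b c) has_derivative (\<lambda>k. d_inner_at (fst z) (fst k) b c)) (at z)"
    by (rule has_derivative_compose[OF has_derivative_fst[OF has_derivative_ident] has_derivative_inner_at[OF z]])
  have p: "((\<lambda>z. snd z \<bullet> e) has_derivative (\<lambda>k. snd k \<bullet> e)) (at z)" for e :: "real^'n"
    by (rule has_derivative_inner_left[OF bounded_linear_imp_has_derivative[OF bounded_linear_snd]])
  have "((\<lambda>z. A / lam (kinetic z) * inner_at (fst z) b c + b1 (kinetic z) * (snd z \<bullet> b) * (snd z \<bullet> c)) has_derivative
    (\<lambda>k. (A / lam (kinetic z) * d_inner_at (fst z) (fst k) b c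
        + - A * lam' (kinetic z) / (lam (kinetic z))\<^sup>2 * d_kinetic z k * inner_at (fst z) b c)
      + (b1 (kinetic z) * (snd z \<bullet> b) * (snd k \<bullet> c)
        + (b1 (kinetic z) * (snd k \<bullet> b) + b1' (kinetic z) * d_kinetic z k * (snd z \<bullet> b)) * (snd z \<bullet> c)))) (at z)"
    by (intro has_derivative_add has_derivative_mult \<alpha> \<beta> ipd p)
  moreover have "(A / lam (kinetic z) * d_inner_at (fst z) (fst k) b c
        + - A * lam' (kinetic z) / (lam (kinetic z))\<^sup>2 * d_kinetic z k * inner_at (fst z) b c)
      + (b1 (kinetic z) * (snd z \<bullet> b) * (snd k \<bullet> c)
        + (b1 (kinetic z) * (snd k \<bullet> b) + b1' (kinetic z) * d_kinetic z k * (snd z \<bullet> b)) * (snd z \<bullet> c))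
     = d_vert_J z k b c" for k
    unfolding d_vert_J_def by (simp only: distrib_left distrib_right mult_ac add_ac)
  ultimately show ?thesis by simp
qed

lemma differentiable_vert_J:
  assumes z: "fst z \<in> U"
  shows "(\<lambda>z. vert_J z b) differentiable at z"
proof (subst differentiable_vec_nth_iff, rule allI)
  fix h
  have component: "A / lam (kinetic y) * inner_at (fst y) b (axis h 1) + b1 (kinetic y) * (snd y \<bullet> b) * (snd y \<bullet> axis h 1)
      = vert_J y b $ h" if "fst y \<in> U" for y
    using inner_vert_J[OF that, of b "axis h 1"] by (simp add: inner_axis)
  have "((\<lambda>z. vert_J z b $ h) has_derivative (\<lambda>k. d_vert_J z k b (axis h 1))) (at z)"
    by (rule has_derivative_transform_within_open[OF has_derivative_vert_form[OF z] open_phase_space])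
      (use z component in \<open>auto simp: mem_Times_iff\<close>)
  then show "(\<lambda>z. vert_J z b $ h) differentiable at z"
    unfolding differentiable_def by blast
qed

lemma inner_dir_deriv_vert_J:
  assumes z: "fst z \<in> U"
  shows "dir_deriv (\<lambda>z. vert_J z b) z k \<bullet> c = d_vert_J z k b c"
proof -
  have "((\<lambda>z. vert_J z b \<bullet> c) has_derivative (\<lambda>k. d_vert_J z k b c)) (at z)"
    by (rule has_derivative_transform_within_open[OF has_derivative_vert_form[OF z] open_phase_space])
      (use z in \<open>auto simp: mem_Times_iff inner_vert_J\<close>)
  then show ?thesis
    unfolding inner_dir_deriv[OF differentiable_vert_J[OF z]] by (rule dir_deriv_eqI)
qed

text \<open>The horizontal derivative of the natural tensor is given by the Christoffel symbols, since
  metric, momentum and energy are parallel.\<close>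

lemma d_vert_J_horizontal:
  assumes z: "fst z \<in> U"
  shows "d_vert_J z (a, hor_lift z a) b c = vert_J z b \<bullet> gamma (fst z) a c + vert_J z c \<bullet> gamma (fst z) a b"
proof -
  have d_kinetic: "d_kinetic z (a, hor_lift z a) = 0"
    using kinetic_derivative_horizontal[OF z] by simp
  have "d_vert_J z (a, hor_lift z a) b c = A / lam (kinetic z) * d_inner_at (fst z) a b c
      + b1 (kinetic z) * ((snd z \<bullet> gamma (fst z) a b) * (snd z \<bullet> c) + (snd z \<bullet> b) * (snd z \<bullet> gamma (fst z) a c))"
    unfolding d_vert_J_def d_kinetic by (simp add: inner_hor_lift[OF z])
  also have "d_inner_at (fst z) a b c = inner_at (fst z) c (gamma (fst z) a b) + inner_at (fst z) b (gamma (fst z) a c)"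
    unfolding metric_compatible[OF z] inner_at_commute[OF z, of c] ..
  finally show ?thesis
    by (simp add: inner_vert_J[OF z] algebra_simps)
qed

text \<open>Only the terms with the factor \<open>g(b,c)\<close> or \<open>g(a,c)\<close> survive antisymmetrization: those with \<open>b\<^sub>1'\<close> are
  symmetric in \<open>a\<close> and \<open>b\<close>, and so are those with the square of \<open>b\<^sub>1\<close>.\<close>

lemma d_vert_J_vertical:
  assumes z: "fst z \<in> U"
  shows "d_vert_J z (0, vert_J z a) b c - d_vert_J z (0, vert_J z b) a c
    = - obstruction A lam b1 lam' (kinetic z) * ((snd z \<bullet> a) * inner_at (fst z) b c - (snd z \<bullet> b) * inner_at (fst z) a c)"
proof -
  define t where "t = kinetic z"
  have lam: "lam t > 0"
    unfolding t_def by (rule lam_pos[OF kinetic_nonneg[OF z]])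
  have zero: "d_inner_at (fst z) 0 b c = 0" for b c
    by (rule linear_0[OF linear_d_inner_at_dir[OF z]])
  define \<alpha> where "\<alpha> = A / lam t"
  define \<gamma> where "\<gamma> = A * lam' t / (lam t)\<^sup>2"
  have P: "vert_J z a \<bullet> sharp z = (\<alpha> + 2 * t * b1 t) * (snd z \<bullet> a)" for a
    by (simp add: inner_vert_J[OF z] inner_at_sharp[OF z] kinetic_eq[OF z, symmetric] t_def \<alpha>_def algebra_simps)
  have obs: "obstruction A lam b1 lam' t = (\<alpha> + 2 * t * b1 t) * \<gamma> + b1 t * \<alpha>"
    using lam unfolding obstruction_def \<alpha>_def \<gamma>_def
    by (simp add: field_simps power2_eq_square power3_eq_cube)
  have dg: "d_vert_J z (0, vert_J z a) b c =
      - \<gamma> * ((\<alpha> + 2 * t * b1 t) * (snd z \<bullet> a)) * inner_at (fst z) b c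
      + b1' t * ((\<alpha> + 2 * t * b1 t) * (snd z \<bullet> a)) * (snd z \<bullet> b) * (snd z \<bullet> c)
      + b1 t * ((\<alpha> * inner_at (fst z) a b + b1 t * (snd z \<bullet> a) * (snd z \<bullet> b)) * (snd z \<bullet> c)
        + (snd z \<bullet> b) * (\<alpha> * inner_at (fst z) a c + b1 t * (snd z \<bullet> a) * (snd z \<bullet> c)))" for a b
    unfolding d_vert_J_def fst_conv snd_conv zero P
    by (simp add: inner_vert_J[OF z] t_def[symmetric] \<alpha>_def[symmetric] \<gamma>_def)
  have "inner_at (fst z) a b = inner_at (fst z) b a"
    by (rule inner_at_commute[OF z])
  then show ?thesis
    unfolding t_def[symmetric] obs dg by (simp add: algebra_simps)
qed

text \<open>The sum of the mixed brackets \<open>[JX,Y]\<close> and \<open>[X,JY]\<close> vanishes by \<open>d_vert_J_horizontal\<close> and the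
  symmetry of the Christoffel symbols, so that \<open>N(X,Y) = [JX,JY] - [X,Y]\<close>.\<close>

lemma nijenhuis_horizontal:
  assumes z: "fst z \<in> U"
  shows "fst (nijenhuis_tensor J z (a, hor_lift z a) (b, hor_lift z b)) = 0"
    and "snd (nijenhuis_tensor J z (a, hor_lift z a) (b, hor_lift z b)) \<bullet> c
      = - obstruction A lam b1 lam' (kinetic z) * ((snd z \<bullet> a) * inner_at (fst z) b c - (snd z \<bullet> b) * inner_at (fst z) a c)
        - snd z \<bullet> curvature (fst z) a b c"
proof -
  let ?H = "\<lambda>a z. (a, hor_lift z a)"
  have zS: "z \<in> U \<times> UNIV" using z by (simp add: mem_Times_iff)
  have dH: "((\<lambda>z. (a, hor_lift z a)) has_derivative (\<lambda>k. (0, dir_deriv (\<lambda>z. hor_lift z a) z k))) (at z)" for a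
    by (intro has_derivative_Pair has_derivative_const has_derivative_dir_deriv differentiable_hor_lift z)
  have dV: "((\<lambda>z. J z (a, hor_lift z a)) has_derivative (\<lambda>k. (0, dir_deriv (\<lambda>z. vert_J z a) z k))) (at z)" for a
  proof (rule has_derivative_transform_within_open[OF _ open_phase_space zS])
    show "((\<lambda>z. (0, vert_J z a)) has_derivative (\<lambda>k. (0, dir_deriv (\<lambda>z. vert_J z a) z k))) (at z)"
      by (intro has_derivative_Pair has_derivative_const has_derivative_dir_deriv differentiable_vert_J z)
    show "(0, vert_J y a) = J y (a, hor_lift y a)" if "y \<in> U \<times> UNIV" for y
      using that by (auto simp: J_hor_lift)
  qed
  note d = dir_deriv_eqI[OF dH] dir_deriv_eqI[OF dV] J_hor_lift[OF z]
  have diff: "?H a differentiable at z" for a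
    using dH unfolding differentiable_def by blast
  define D where "D a b = dir_deriv (\<lambda>z. hor_lift z b) z (0, vert_J z a) - dir_deriv (\<lambda>z. vert_J z a) z (b, hor_lift z b)" for a b
  have mixed: "D a b - D b a = 0"
  proof (rule vector_eq_ldot[THEN iffD1, rule_format])
    fix c :: "real^'n"
    have "D a b \<bullet> c - D b a \<bullet> c = 0"
      unfolding D_def
      using gamma_commute[OF z, of a b] linear_0[OF linear_d_gamma_dir[OF z]]
      by (simp add: inner_diff_left inner_dir_deriv_hor_lift[OF z] inner_dir_deriv_vert_J[OF z]
          d_vert_J_horizontal[OF z])
    then show "c \<bullet> (D a b - D b a) = c \<bullet> 0"
      by (simp add: inner_diff_right inner_commute)
  qed
  let ?N = "nijenhuis_tensor J z (a, hor_lift z a) (b, hor_lift z b)"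
  have "?N = (0, dir_deriv (\<lambda>z. vert_J z b) z (0, vert_J z a) - dir_deriv (\<lambda>z. vert_J z a) z (0, vert_J z b))
      - J z (0, D a b) - J z (0, - D b a)
      - (0, dir_deriv (\<lambda>z. hor_lift z b) z (a, hor_lift z a) - dir_deriv (\<lambda>z. hor_lift z a) z (b, hor_lift z b))"
    using nijenhuis_tensor_eq_brackets[OF zS diff[of a] diff[of b]]
    by (simp add: euclidean_bracket_def d D_def)
  also have "J z (0, - D b a) = - J z (0, D a b)"
    using mixed linear_neg[OF linear_J[OF zS], of "(0, D a b)"] by simp
  finally have N: "?N = (0, (dir_deriv (\<lambda>z. vert_J z b) z (0, vert_J z a) - dir_deriv (\<lambda>z. vert_J z a) z (0, vert_J z b))
      - (dir_deriv (\<lambda>z. hor_lift z b) z (a, hor_lift z a) - dir_deriv (\<lambda>z. hor_lift z a) z (b, hor_lift z b)))"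
    by simp
  show "fst ?N = 0" by (simp add: N)
  show "snd ?N \<bullet> c = - obstruction A lam b1 lam' (kinetic z) * ((snd z \<bullet> a) * inner_at (fst z) b c - (snd z \<bullet> b) * inner_at (fst z) a c)
        - snd z \<bullet> curvature (fst z) a b c"
    unfolding N snd_conv inner_diff_left[of "_ - _" "_ - _"] inner_bracket_horizontal[OF z]
      d_vert_J_vertical[OF z, symmetric]
    by (simp add: inner_diff_left inner_dir_deriv_vert_J[OF z])
qed

text \<open>As \<open>J\<^sup>2 = -1\<close>, \<open>J\<close> is injective on the horizontal vectors, so by dimension it maps them onto the
  vertical ones.\<close>

lemma horizontal_span:
  assumes z: "fst z \<in> U"
  shows "\<exists>x\<in>range (\<lambda>a. (a, hor_lift z a)). \<exists>y\<in>range (\<lambda>a. (a, hor_lift z a)). u = x + J z y"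
proof -
  have zS: "z \<in> U \<times> UNIV" using z by (simp add: mem_Times_iff)
  have lin: "linear (vert_J z)"
    unfolding vert_J_def
    by (rule linearI)
      (simp_all add: linear_add[OF matrix_vector_mul_linear] linear_scale[OF matrix_vector_mul_linear]
        inner_add_right algebra_simps)
  have "a = 0" if "vert_J z a = 0" for a
  proof -
    have "J z (J z (a, hor_lift z a)) = 0"
      using that by (simp add: J_hor_lift[OF z] linear_0[OF linear_J[OF zS], unfolded zero_prod_def] zero_prod_def)
    then show ?thesis by (simp add: J_J[OF zS] zero_prod_def)
  qed
  then have "surj (vert_J z)"
    using linear_injective_imp_surjective[OF lin] linear_injective_0[OF lin] by blast
  then obtain b where "vert_J z b = snd u - hor_lift z (fst u)"
    by (metis surjD)
  then have "u = (fst u, hor_lift z (fst u)) + J z (b, hor_lift z b)"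
    by (simp add: J_hor_lift[OF z] prod_eq_iff)
  then show ?thesis by blast
qed

theorem nijenhuis_vanishes_iff:
  "(\<forall>z\<in>U \<times> UNIV. \<forall>u v. nijenhuis_tensor J z u v = 0) \<longleftrightarrow>
    (\<forall>z\<in>U \<times> UNIV. \<forall>a b c. snd z \<bullet> curvature (fst z) a b c
      = - obstruction A lam b1 lam' (kinetic z) * ((snd z \<bullet> a) * inner_at (fst z) b c - (snd z \<bullet> b) * inner_at (fst z) a c))"
proof (rule ball_cong[OF refl])
  fix z :: "(real^'n) \<times> (real^'n)" assume zS: "z \<in> U \<times> UNIV"
  then have z: "fst z \<in> U" by auto
  have "(\<forall>u v. nijenhuis_tensor J z u v = 0) \<longleftrightarrow>
      (\<forall>a b. nijenhuis_tensor J z (a, hor_lift z a) (b, hor_lift z b) = 0)"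
    by (subst nijenhuis_tensor_vanishes_iff[OF zS horizontal_span[OF z]]) auto
  also have "\<dots> \<longleftrightarrow> (\<forall>a b. snd (nijenhuis_tensor J z (a, hor_lift z a) (b, hor_lift z b)) = 0)"
    using nijenhuis_horizontal(1)[OF z] by (simp add: prod_eq_iff)
  also have "\<dots> \<longleftrightarrow> (\<forall>a b c. snd (nijenhuis_tensor J z (a, hor_lift z a) (b, hor_lift z b)) \<bullet> c = 0)"
    by (metis inner_eq_zero_iff inner_zero_left)
  also have "\<dots> \<longleftrightarrow> (\<forall>a b c. snd z \<bullet> curvature (fst z) a b c
      = - obstruction A lam b1 lam' (kinetic z) * ((snd z \<bullet> a) * inner_at (fst z) b c - (snd z \<bullet> b) * inner_at (fst z) a c))"
    unfolding nijenhuis_horizontal(2)[OF z] by auto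
  finally show "(\<forall>u v. nijenhuis_tensor J z u v = 0) \<longleftrightarrow> (\<forall>a b c. snd z \<bullet> curvature (fst z) a b c
      = - obstruction A lam b1 lam' (kinetic z) * ((snd z \<bullet> a) * inner_at (fst z) b c - (snd z \<bullet> b) * inner_at (fst z) a c))" .
qed

end


section \<open>Constant sectional curvature\<close>

text \<open>A curvature form is determined by its values on planes, by polarization.\<close>

lemma curvature_form_vanishes:
  fixes S :: "'a::plus \<Rightarrow> 'a \<Rightarrow> 'a \<Rightarrow> 'a \<Rightarrow> real"
  assumes add1: "\<And>a a' b c d. S (a + a') b c d = S a b c d + S a' b c d"
    and add3: "\<And>a b c c' d. S a b (c + c') d = S a b c d + S a b c' d"
    and anti12: "\<And>a b c d. S b a c d = - S a b c d"
    and anti34: "\<And>a b c d. S a b d c = - S a b c d"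
    and bianchi: "\<And>a b c d. S a b c d + S b c a d + S c a b d = 0"
    and diag: "\<And>u v. S u v v u = 0"
  shows "S a b c d = 0"
proof -
  \<comment> \<open>the pair symmetry is the signed sum of four cyclic Bianchi identities\<close>
  have pair: "S a b c d = S c d a b" for a b c d
    using bianchi[of a b c d] bianchi[of b c d a] bianchi[of c d a b] bianchi[of d a b c]
      anti34[of c d b a] anti12[of b d c a] anti34[of b d c a] anti12[of b d a c]
      anti34[of b c a d] anti12[of a d c b] anti34[of a d b c] anti12[of a d b c] anti34[of c a b d]
      anti12[of c a b d] anti12[of c a d b] anti34[of a b d c] anti12[of c d b a] anti34[of d a b c]
      anti34[of a c b d] anti34[of c a d b] anti34[of d b a c] anti34[of d b c a] anti34[of d a c b]
      anti34[of a b c d]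
    by linarith
  have add2: "S a (b + b') c d = S a b c d + S a b' c d" for a b b' c d
    using anti12[of a "b + b'" c d] anti12[of a b c d] anti12[of a b' c d] add1[of b b' a c d] by linarith
  have add4: "S a b c (d + d') = S a b c d + S a b c d'" for a b c d d'
    using anti34[of a b c "d + d'"] anti34[of a b c d] anti34[of a b c d'] add3[of a b d d' c] by linarith
  have 1: "S u v w u = 0" for u v w
  proof -
    have "S u v w u + S u w v u = 0"
      using diag[of u "v + w"] diag[of u v] diag[of u w] by (simp add: add2 add3)
    moreover have "S u w v u = S u v w u"
      using pair[of u w v u] anti12[of u v u w] anti34[of u v w u] by linarith
    ultimately show ?thesis by simp
  qed
  \<comment> \<open>invariance under cyclic permutations turns the Bianchi identity into \<open>3 S = 0\<close>\<close>
  have cyc: "S u v w z = S w u v z" for u v w z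
  proof -
    have "S u v w z + S z v w u = 0"
      using 1[of "u + z" v w] 1[of u v w] 1[of z v w] by (simp add: add1 add4)
    moreover have "S z v w u = - S w u v z"
      using pair[of z v w u] anti34[of w u v z] by linarith
    ultimately show ?thesis by simp
  qed
  show ?thesis
    using bianchi[of a b c d] cyc[of a b c d] cyc[of c a b d] by linarith
qed

context local_metric
begin

text \<open>The strict Cauchy-Schwarz inequality, from the square of the part of \<open>u\<close> orthogonal to \<open>v\<close>.\<close>

lemma inner_at_gram_pos:
  assumes y: "y \<in> U" and indep: "\<And>r s. r *\<^sub>R u + s *\<^sub>R v = 0 \<Longrightarrow> r = 0 \<and> s = 0"
  shows "inner_at y u u * inner_at y v v - (inner_at y u v)\<^sup>2 > 0"
proof -
  have "v \<noteq> 0" using indep[of 0 1] by auto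
  then have v: "inner_at y v v > 0" by (rule inner_at_pos[OF y])
  let ?w = "inner_at y v v *\<^sub>R u + (- inner_at y u v) *\<^sub>R v"
  have "?w \<noteq> 0" using indep[of "inner_at y v v" "- inner_at y u v"] v by auto
  then have "inner_at y ?w ?w > 0" by (rule inner_at_pos[OF y])
  also have "inner_at y ?w ?w = inner_at y v v * (inner_at y u u * inner_at y v v - (inner_at y u v)\<^sup>2)"
    using inner_at_commute[OF y, of v u]
    by (simp only: inner_at_linear_simps) (simp add: algebra_simps power2_eq_square)
  finally show ?thesis
    using v by (simp add: zero_less_mult_iff)
qed

text \<open>For the direction from left to right, the difference of both sides of the space form equation,
  as a form in four arguments, has the symmetries of a curvature tensor and vanishes on all planes.\<close>

lemma constant_curvature_iff:
  assumes y: "y \<in> U"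
  shows "(\<forall>u v. (\<forall>r s. r *\<^sub>R u + s *\<^sub>R v = 0 \<longrightarrow> r = 0 \<and> s = 0) \<longrightarrow>
        inner_at y u (curvature y u v v) / (inner_at y u u * inner_at y v v - (inner_at y u v)\<^sup>2) = \<kappa>)
    \<longleftrightarrow> (\<forall>a b c. curvature y a b c = \<kappa> *\<^sub>R (inner_at y b c *\<^sub>R a - inner_at y a c *\<^sub>R b))"
    (is "?sec \<longleftrightarrow> ?space_form")
proof
  assume space_form: ?space_form
  show ?sec
  proof (intro allI impI)
    fix u v :: "real^'n" assume "\<forall>r s. r *\<^sub>R u + s *\<^sub>R v = 0 \<longrightarrow> r = 0 \<and> s = 0"
    then have "inner_at y u u * inner_at y v v - (inner_at y u v)\<^sup>2 > 0"
      by (intro inner_at_gram_pos[OF y]) auto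
    moreover have "curvature y u v v = \<kappa> *\<^sub>R (inner_at y v v *\<^sub>R u - inner_at y u v *\<^sub>R v)"
      using space_form by blast
    then have "inner_at y u (curvature y u v v) = \<kappa> * (inner_at y u u * inner_at y v v - (inner_at y u v)\<^sup>2)"
      by (simp add: inner_at_linear_simps power2_eq_square mult.commute)
    ultimately show "inner_at y u (curvature y u v v) / (inner_at y u u * inner_at y v v - (inner_at y u v)\<^sup>2) = \<kappa>"
      by simp
  qed
next
  assume sec: ?sec
  define S where "S a b c d = inner_at y d (curvature y a b c) - \<kappa> * (inner_at y b c * inner_at y a d - inner_at y a c * inner_at y b d)"
    for a b c d
  note curvature_linear_simps = linear_add[OF linear_curvature(1)[OF y]] linear_add[OF linear_curvature(2)[OF y]]
    linear_add[OF linear_curvature(3)[OF y]] linear_scale[OF linear_curvature(1)[OF y]]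
    linear_scale[OF linear_curvature(2)[OF y]] linear_scale[OF linear_curvature(3)[OF y]]
  have anti12: "S b a c d = - S a b c d" for a b c d
    unfolding S_def curvature_antisym[of y b a c] using linear_neg[OF linear_inner_at_right, of y d "curvature y a b c"]
    by (simp add: algebra_simps)
  have S_diag: "S u u v w = 0" for u v w
    using anti12[of u u v w] by simp
  have diag: "S u v v u = 0" for u v
  proof (cases "\<forall>r s. r *\<^sub>R u + s *\<^sub>R v = 0 \<longrightarrow> r = 0 \<and> s = 0")
    case True
    then have "inner_at y u u * inner_at y v v - (inner_at y u v)\<^sup>2 > 0"
      by (intro inner_at_gram_pos[OF y]) auto
    moreover have "inner_at y u (curvature y u v v) / (inner_at y u u * inner_at y v v - (inner_at y u v)\<^sup>2) = \<kappa>"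
      using sec True by blast
    ultimately have "inner_at y u (curvature y u v v) = \<kappa> * (inner_at y u u * inner_at y v v - (inner_at y u v)\<^sup>2)"
      by (simp add: divide_eq_eq)
    then show ?thesis
      unfolding S_def using inner_at_commute[OF y, of v u] by (simp add: power2_eq_square algebra_simps)
  next
    case False
    then obtain r s where rs: "r *\<^sub>R u + s *\<^sub>R v = 0" "r \<noteq> 0 \<or> s \<noteq> 0" by blast
    have "(\<exists>k. u = k *\<^sub>R v) \<or> (\<exists>k. v = k *\<^sub>R u)"
    proof (cases "r = 0")
      case True
      with rs show ?thesis by (intro disjI2 exI[of _ 0]) simp
    next
      case False
      have "u = (1 / r) *\<^sub>R (r *\<^sub>R u + s *\<^sub>R v) - (s / r) *\<^sub>R v"
        using False by (simp add: scaleR_add_right)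
      then have "u = (- s / r) *\<^sub>R v" using rs(1) by simp
      then show ?thesis by blast
    qed
    moreover have "S (k *\<^sub>R v) v v (k *\<^sub>R v) = k * (k * S v v v v)" for k v
      unfolding S_def by (simp add: inner_at_linear_simps curvature_linear_simps algebra_simps)
    moreover have "S u (k *\<^sub>R u) (k *\<^sub>R u) u = k * (k * S u u u u)" for k u
      unfolding S_def by (simp add: inner_at_linear_simps curvature_linear_simps algebra_simps)
    ultimately show ?thesis using S_diag by auto
  qed
  have zero: "S a b c d = 0" for a b c d
  proof (rule curvature_form_vanishes[of S])
    show "S u v v u = 0" for u v by (rule diag)
    show "S (a + a') b c d = S a b c d + S a' b c d" for a a' b c d
      unfolding S_def by (simp add: inner_at_linear_simps curvature_linear_simps algebra_simps)
    show "S a b (c + c') d = S a b c d + S a b c' d" for a b c c' d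
      unfolding S_def by (simp add: inner_at_linear_simps curvature_linear_simps algebra_simps)
    show "S b a c d = - S a b c d" for a b c d by (rule anti12)
    show "S a b d c = - S a b c d" for a b c d
      unfolding S_def curvature_metric_antisym[OF y, of c a b d] by (simp add: algebra_simps)
    show "S a b c d + S b c a d + S c a b d = 0" for a b c d
    proof -
      have "inner_at y d (curvature y a b c + curvature y b c a + curvature y c a b) = 0"
        by (simp only: curvature_bianchi[OF y] inner_at_linear_simps)
      then show ?thesis
        unfolding S_def inner_at_linear_simps
        using inner_at_commute[OF y, of a b] inner_at_commute[OF y, of b c] inner_at_commute[OF y, of c a]
        by (simp add: algebra_simps)
    qed
  qed
  show ?space_form
  proof (intro allI)
    fix a b c
    show "curvature y a b c = \<kappa> *\<^sub>R (inner_at y b c *\<^sub>R a - inner_at y a c *\<^sub>R b)"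
    proof (rule inner_at_eqI[OF y])
      fix d
      show "inner_at y d (curvature y a b c) = inner_at y d (\<kappa> *\<^sub>R (inner_at y b c *\<^sub>R a - inner_at y a c *\<^sub>R b))"
        using zero[of a b c d] inner_at_commute[OF y, of d a] inner_at_commute[OF y, of d b]
        unfolding S_def inner_at_linear_simps by (simp add: mult.commute)
    qed
  qed
qed

end


section \<open>The obstruction function\<close>

lemma half_line_has_derivative:
  assumes "smooth_on {0..} f" "t \<ge> 0"
  shows "(f has_real_derivative half_line_deriv f t) (at t within {0..})"
proof -
  have "k_smooth_on (Suc 0) {0..} f"
    using assms(1) unfolding smooth_on_def by blast
  then have "f differentiable (at t within {0..})"
    using assms(2) by (simp add: differentiable_on_def)
  then show ?thesis
    unfolding half_line_deriv_def
    by (simp add: has_real_derivative_iff_has_vector_derivative vector_derivative_works)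
qed

lemma continuous_on_half_line_deriv:
  assumes "smooth_on {0..} f"
  shows "continuous_on {0..} (half_line_deriv f)"
proof -
  have smooth: "k_smooth_on (Suc 0) {0..} f"
    using assms(1) unfolding smooth_on_def by blast
  then have "continuous_on {0..} (\<lambda>t. frechet_derivative f (at t within {0..}) 1)"
    by simp
  moreover have "frechet_derivative f (at t within {0..}) 1 = half_line_deriv f t" if "t \<in> {0..}" for t
  proof -
    have "f differentiable (at t within {0..})"
      using smooth that by (simp add: differentiable_on_def)
    then have "(f has_derivative frechet_derivative f (at t within {0..})) (at t within {0..})"
      by (simp add: frechet_derivative_works)
    then have "(f has_vector_derivative frechet_derivative f (at t within {0..}) 1) (at t within {0..})"
      unfolding has_vector_derivative_def
      using linear_scale[OF has_derivative_linear, of f _ "at t within {0..}" _ 1] by simp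
    moreover have "(f has_vector_derivative half_line_deriv f t) (at t within {0..})"
      using half_line_has_derivative[OF assms] that
      by (simp add: has_real_derivative_iff_has_vector_derivative)
    moreover have "at t within {0..} \<noteq> bot"
      using islimpt_subset[OF islimpt_greaterThanLessThan1, of t "t + 1" "{0..}"] that
      by (force simp: trivial_limit_within)
    ultimately show ?thesis
      by (rule vector_derivative_unique_within[rotated 1])
  qed
  ultimately show ?thesis
    by (rule continuous_on_eq)
qed

locale natural_coefficients =
  fixes A :: real and lam b1 :: "real \<Rightarrow> real"
  assumes A_pos: "A > 0"
    and smooth_lam: "smooth_on {0..} lam"
    and smooth_b1: "smooth_on {0..} b1"
    and lam_pos: "t \<ge> 0 \<Longrightarrow> lam t > 0"
    and metric_pos: "t \<ge> 0 \<Longrightarrow> A + 2 * t * lam t * b1 t > 0"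
begin

abbreviation lam' where "lam' \<equiv> half_line_deriv lam"
abbreviation obs where "obs \<equiv> obstruction A lam b1 lam'"

lemma continuous_obstruction: "continuous_on {0..} obs"
proof -
  have lam: "continuous_on {0..} lam" and b1: "continuous_on {0..} b1"
    using smooth_lam smooth_b1 unfolding smooth_on_def by (metis k_smooth_on.simps(1))+
  have "lam t \<noteq> 0" if "t \<in> {0..}" for t using lam_pos[of t] that by auto
  then show ?thesis
    unfolding obstruction_def
    by (intro continuous_intros lam b1 continuous_on_half_line_deriv smooth_lam) auto
qed

lemma obstruction_eq_iff:
  assumes "t \<ge> 0"
  shows "obs t = - \<kappa> \<longleftrightarrow>
    A\<^sup>2 * lam' t + \<kappa> * lam t ^ 3 + A * b1 t * lam t * (lam t + 2 * t * lam' t) = 0"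
proof -
  have "obs t = - \<kappa> \<longleftrightarrow> (A + 2 * t * lam t * b1 t) * A * lam' t + A * b1 t * (lam t)\<^sup>2 = - \<kappa> * lam t ^ 3"
    using lam_pos[OF assms] unfolding obstruction_def by (simp add: divide_eq_eq)
  then show ?thesis
    by (simp add: algebra_simps power2_eq_square) linarith
qed

lemma b1_given_by_obstruction:
  assumes "b1_given_by A lam b1 \<kappa>" "t \<ge> 0"
  shows "obs t = - \<kappa>"
proof -
  have D: "lam t + 2 * t * lam' t \<noteq> 0"
    and b1: "b1 t = - ((\<kappa> * lam t ^ 3 + A\<^sup>2 * lam' t) / (A * lam t * (lam t + 2 * t * lam' t)))"
    using assms unfolding b1_given_by_def by auto
  have "A * lam t * (lam t + 2 * t * lam' t) \<noteq> 0"
    using D A_pos lam_pos[OF assms(2)] by auto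
  then have "b1 t * (A * lam t * (lam t + 2 * t * lam' t)) = - (\<kappa> * lam t ^ 3 + A\<^sup>2 * lam' t)"
    unfolding b1 by simp
  then show ?thesis
    unfolding obstruction_eq_iff[OF assms(2)] by (simp add: algebra_simps)
qed

text \<open>Eliminating \<open>\<lambda>'\<close> from \<open>\<lambda> + 2 t \<lambda>'\<close> by means of the equation for the obstruction.\<close>

lemma denominator_identity:
  assumes "obs t = - \<kappa>" "t \<ge> 0"
  shows "A * (A + 2 * t * lam t * b1 t) * (lam t + 2 * t * lam' t)
    = lam t * (A\<^sup>2 - 2 * \<kappa> * t * (lam t)\<^sup>2)"
proof -
  have "A\<^sup>2 * lam' t + \<kappa> * lam t ^ 3 + A * b1 t * lam t * (lam t + 2 * t * lam' t) = 0"
    using assms obstruction_eq_iff by blast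
  then have "2 * t * (A\<^sup>2 * lam' t + \<kappa> * lam t ^ 3 + A * b1 t * lam t * (lam t + 2 * t * lam' t)) = 0"
    by simp
  then show ?thesis
    by (simp add: algebra_simps power2_eq_square power3_eq_cube)
qed

text \<open>The function \<open>A\<^sup>2 - 2 c t \<lambda>\<^sup>2\<close> satisfies a homogeneous linear differential equation with
  positive initial value, hence stays positive.\<close>

lemma space_form_factor_pos:
  assumes obs: "\<And>t. t \<ge> 0 \<Longrightarrow> obs t = - \<kappa>" and T: "T \<ge> 0"
  shows "A\<^sup>2 - 2 * \<kappa> * T * (lam T)\<^sup>2 > 0"
proof -
  define u where "u t = A\<^sup>2 - 2 * \<kappa> * t * (lam t)\<^sup>2" for t
  \<comment> \<open>\<open>exp H\<close> is the integrating factor of \<open>u' = - h u\<close>\<close>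
  define h where "h t = 2 * \<kappa> * (lam t)\<^sup>2 / (A * (A + 2 * t * lam t * b1 t))" for t
  define H where "H t = integral {0..t} h" for t
  have lam: "continuous_on {0..} lam" and b1: "continuous_on {0..} b1"
    using smooth_lam smooth_b1 unfolding smooth_on_def by (metis k_smooth_on.simps(1))+
  have "A * (A + 2 * t * lam t * b1 t) \<noteq> 0" if "t \<in> {0..}" for t
    using A_pos metric_pos[of t] that by auto
  then have "continuous_on {0..} h"
    unfolding h_def by (intro continuous_intros lam b1) auto
  then have h: "continuous_on {0..T} h"
    by (rule continuous_on_subset) auto
  have u': "(u has_real_derivative - h t * u t) (at t within {0..T})" if "t \<in> {0..T}" for t
  proof -
    have t: "t \<ge> 0" using that by simp
    have "(lam has_real_derivative lam' t) (at t within {0..T})"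
      by (rule DERIV_subset[OF half_line_has_derivative[OF smooth_lam t]]) auto
    then have "(u has_real_derivative - (2 * \<kappa> * (lam t)\<^sup>2 + 2 * \<kappa> * t * (2 * lam t * lam' t))) (at t within {0..T})"
      unfolding u_def by (auto intro!: derivative_eq_intros)
    moreover have "- (2 * \<kappa> * (lam t)\<^sup>2 + 2 * \<kappa> * t * (2 * lam t * lam' t))
        = - (2 * \<kappa> * lam t * (lam t + 2 * t * lam' t))"
      by (simp add: algebra_simps power2_eq_square)
    moreover have E: "lam t + 2 * t * lam' t = lam t * u t / (A * (A + 2 * t * lam t * b1 t))"
      using denominator_identity[OF obs[OF t] t] A_pos metric_pos[OF t]
      by (simp add: u_def eq_divide_eq mult_ac)
    moreover have "2 * \<kappa> * lam t * (lam t * u t / (A * (A + 2 * t * lam t * b1 t))) = h t * u t"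
      by (simp add: h_def power2_eq_square)
    ultimately show ?thesis
      by (simp only: E mult_minus_left)
  qed
  have H': "(H has_real_derivative h t) (at t within {0..T})" if "t \<in> {0..T}" for t
    unfolding H_def by (rule integral_has_real_derivative[OF h that])
  have "((\<lambda>t. u t * exp (H t)) has_real_derivative 0) (at t within {0..T})" if "t \<in> {0..T}" for t
    by (rule derivative_eq_intros u' H' that refl | simp add: algebra_simps that)+
  then obtain k where k: "\<And>t. t \<in> {0..T} \<Longrightarrow> u t * exp (H t) = k"
    using has_field_derivative_zero_constant[of "{0..T}" "\<lambda>t. u t * exp (H t)"] by auto
  have "u 0 * exp (H 0) = A\<^sup>2"
    by (simp add: u_def H_def)
  then have "u T * exp (H T) = A\<^sup>2"
    using k[of 0] k[of T] T by simp
  then have "u T * exp (H T) > 0"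
    using A_pos by simp
  then show ?thesis
    by (simp add: u_def zero_less_mult_iff)
qed

text \<open>The formula for \<open>b\<^sub>1\<close> is the constancy of the obstruction, solved for \<open>b\<^sub>1\<close>.\<close>

lemma obstruction_b1_given_by:
  assumes obs: "\<And>t. t \<ge> 0 \<Longrightarrow> obs t = - \<kappa>"
  shows "b1_given_by A lam b1 \<kappa>"
  unfolding b1_given_by_def
proof (intro allI impI conjI)
  fix t :: real assume t: "t \<ge> 0"
  show D: "lam t + 2 * t * lam' t \<noteq> 0"
    using denominator_identity[OF obs[OF t] t] space_form_factor_pos[OF obs t] lam_pos[OF t] by auto
  have "A * lam t * (lam t + 2 * t * lam' t) \<noteq> 0"
    using D A_pos lam_pos[OF t] by auto
  moreover have "b1 t * (A * lam t * (lam t + 2 * t * lam' t)) = - (\<kappa> * lam t ^ 3 + A\<^sup>2 * lam' t)"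
    using obs[OF t] unfolding obstruction_eq_iff[OF t] by (simp add: algebra_simps)
  ultimately show "b1 t = - ((\<kappa> * lam t ^ 3 + A\<^sup>2 * lam' t) / (A * lam t * (lam t + 2 * t * lam' t)))"
    by (metis minus_divide_left nonzero_eq_divide_eq)
qed

lemma space_form_quotient_pos:
  assumes "b1_given_by A lam b1 \<kappa>" "t \<ge> 0"
  shows "(A\<^sup>2 - 2 * \<kappa> * t * (lam t)\<^sup>2) / (lam t + 2 * t * lam' t) > 0"
proof -
  have D: "lam t + 2 * t * lam' t \<noteq> 0"
    using assms unfolding b1_given_by_def by auto
  have "(A\<^sup>2 - 2 * \<kappa> * t * (lam t)\<^sup>2) / (lam t + 2 * t * lam' t) = A * (A + 2 * t * lam t * b1 t) / lam t"
    using denominator_identity[OF b1_given_by_obstruction[OF assms] assms(2)] D lam_pos[OF assms(2)]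
    by (simp add: field_simps)
  then show ?thesis
    using A_pos metric_pos[OF assms(2)] lam_pos[OF assms(2)] by simp
qed

end


section \<open>Riemannian metrics in charts\<close>

lemma (in local_metric) inner_at_axis: "inner_at y (axis i 1) (axis j 1) = G y $ i $ j"
  by (simp add: inner_at_def inner_axis' matrix_vector_mul_component inner_axis)

locale metric_atlas = coordinate_atlas \<A> for \<A> :: "('m, real^'n::finite) chart set" +
  fixes g :: "('m, 'n) metric"
  assumes metric: "riemannian_metric \<A> g"
begin

abbreviation G where "G c \<equiv> metric_comp \<A> g c"

lemma metric_lincomb:
  assumes "c \<in> \<A>" "p \<in> fst c" "u \<in> tangent_space \<A> p" "v \<in> tangent_space \<A> p" "w \<in> tangent_space \<A> p"
  shows "g p (\<lambda>c. a *\<^sub>R u c + b *\<^sub>R v c) w = a * g p u w + b * g p v w"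
  using metric assms unfolding riemannian_metric_def by blast

lemma metric_commute:
  assumes "c \<in> \<A>" "p \<in> fst c" "u \<in> tangent_space \<A> p" "v \<in> tangent_space \<A> p"
  shows "g p u v = g p v u"
  using metric assms unfolding riemannian_metric_def by blast

lemma metric_chart_vector:
  assumes c: "c \<in> \<A>" and p: "p \<in> fst c"
  shows "g p (chart_vector \<A> c p a) (chart_vector \<A> c p b) = a \<bullet> (G c (snd c p) *v b)"
proof -
  let ?e = "\<lambda>w. chart_vector \<A> c p w"
  note cv = chart_vector_in_tangent_space[OF c p]
  have lincomb: "g p (?e (r *\<^sub>R u + s *\<^sub>R v)) (?e w) = r * g p (?e u) (?e w) + s * g p (?e v) (?e w)"
    for r s u v w
    unfolding chart_vector_lincomb[OF c p] by (rule metric_lincomb[OF c p cv cv cv])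
  have lin: "linear (\<lambda>u. g p (?e u) (?e w))" for w
    using lincomb[of 1 _ 1] lincomb[of _ _ 0] by (intro linearI) auto
  have "(\<lambda>w. g p (?e u) (?e w)) = (\<lambda>w. g p (?e w) (?e u))" for u
    using metric_commute[OF c p cv cv] by blast
  then have lin': "linear (\<lambda>w. g p (?e u) (?e w))" for u
    using lin by simp
  have "g p (?e a) (?e b) = (\<Sum>i\<in>UNIV. a $ i * g p (?e (axis i 1)) (?e b))"
    by (rule linear_expand_axis[OF lin])
  also have "\<dots> = (\<Sum>i\<in>UNIV. a $ i * (\<Sum>j\<in>UNIV. b $ j * g p (?e (axis i 1)) (?e (axis j 1))))"
    by (simp only: linear_expand_axis[OF lin', of _ b])
  also have "\<dots> = a \<bullet> (G c (snd c p) *v b)"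
    using c p by (simp add: inner_vec_def matrix_vector_mult_def metric_comp_def mult_ac)
  finally show ?thesis .
qed

lemma local_metric_chart:
  assumes c: "c \<in> \<A>"
  shows "local_metric (snd c ` fst c) (G c)"
proof
  show "open (snd c ` fst c)" by (rule open_chart_image[OF c])
  show "smooth_on (snd c ` fst c) (\<lambda>y. G c y $ i $ j)" for i j
    using metric c unfolding riemannian_metric_def by blast
  fix y assume "y \<in> snd c ` fst c"
  then obtain p where p: "p \<in> fst c" "y = snd c p" by blast
  note cv = chart_vector_in_tangent_space[OF c p(1)]
  show "G c y $ i $ j = G c y $ j $ i" for i j
    using metric_commute[OF c p(1) cv cv] c p by (simp add: metric_comp_def)
  fix v :: "real^'n" assume "v \<noteq> 0"
  then have "chart_vector \<A> c p v \<noteq> (\<lambda>c. 0)"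
    using chart_vector_self[OF c p(1), of v] by metis
  then have "g p (chart_vector \<A> c p v) (chart_vector \<A> c p v) > 0"
    using metric c p(1) cv unfolding riemannian_metric_def by blast
  then show "v \<bullet> (G c y *v v) > 0"
    by (simp add: metric_chart_vector[OF c p(1)] p(2))
qed

lemma metric_eq_inner_at:
  assumes c: "c \<in> \<A>" and p: "p \<in> fst c" and "u \<in> tangent_space \<A> p" "v \<in> tangent_space \<A> p"
  shows "g p u v = local_metric.inner_at (G c) (snd c p) (u c) (v c)"
  using metric_chart_vector[OF c p, of "u c" "v c"] assms
  by (simp add: chart_vector_component local_metric.inner_at_def[OF local_metric_chart[OF c]])

lemma christoffel_eq_gamma:
  assumes c: "c \<in> \<A>"
  shows "christoffel \<A> g c y k i j = local_metric.gamma (G c) y (axis i 1) (axis j 1) $ k"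
proof -
  interpret local_metric "snd c ` fst c" "G c" by (rule local_metric_chart[OF c])
  have "partial_deriv i (\<lambda>z. G c z $ h $ j) y = d_inner_at y (axis i 1) (axis h 1) (axis j 1)" for i h j
    by (simp add: partial_deriv_def d_inner_at_def inner_at_axis)
  then show ?thesis
    by (simp add: christoffel_def gamma_def metric_inv_def matrix_vector_mult_def sum_divide_distrib)
qed

text \<open>The index expressions for connection and curvature are the components of the coordinate-free
  maps on unit vectors.\<close>

lemma curvature_comp_eq_curvature:
  assumes c: "c \<in> \<A>" and y: "y \<in> snd c ` fst c"
  shows "curvature_comp \<A> g c y l k i j
    = local_metric.curvature (G c) y (axis i 1) (axis j 1) (axis k 1) $ l"
proof -
  interpret local_metric "snd c ` fst c" "G c" by (rule local_metric_chart[OF c])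
  have D: "partial_deriv i (\<lambda>z. christoffel \<A> g c z l j k) y = d_gamma y (axis i 1) (axis j 1) (axis k 1) $ l" for i j k
  proof -
    have "((\<lambda>z. gamma z (axis j 1) (axis k 1) \<bullet> axis l 1) has_derivative
        (\<lambda>h. d_gamma y h (axis j 1) (axis k 1) \<bullet> axis l 1)) (at y)"
      by (rule has_derivative_inner_left[OF has_derivative_gamma[OF y]])
    then show ?thesis
      unfolding partial_deriv_def christoffel_eq_gamma[OF c]
      by (subst dir_deriv_eqI) (auto simp: inner_axis)
  qed
  have lin: "linear (\<lambda>w. gamma y a w $ l)" for a
    using linear_gamma_right[OF y, of a] by (intro linearI) (simp_all add: linear_add linear_scale)
  have Q: "gamma y (axis i 1) (gamma y (axis j 1) (axis k 1)) $ l
      = (\<Sum>h\<in>UNIV. christoffel \<A> g c y l i h * christoffel \<A> g c y h j k)" for i j k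
    by (subst linear_expand_axis[OF lin]) (simp add: christoffel_eq_gamma[OF c] mult.commute)
  show ?thesis
    by (simp add: curvature_comp_def D curvature_def Q sum_subtractf)
qed

lemma sectional_curvature_eq_curvature:
  assumes c: "c \<in> \<A>" and p: "p \<in> fst c" and u: "u \<in> tangent_space \<A> p" and v: "v \<in> tangent_space \<A> p"
  shows "sectional_curvature \<A> g c p u v =
    local_metric.inner_at (G c) (snd c p) (u c) (local_metric.curvature (G c) (snd c p) (u c) (v c) (v c))
    / (local_metric.inner_at (G c) (snd c p) (u c) (u c) * local_metric.inner_at (G c) (snd c p) (v c) (v c)
       - (local_metric.inner_at (G c) (snd c p) (u c) (v c))\<^sup>2)"
proof -
  interpret local_metric "snd c ` fst c" "G c" by (rule local_metric_chart[OF c])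
  let ?y = "snd c p"
  have y: "?y \<in> snd c ` fst c" using p by simp
  have lin: "linear (\<lambda>w. curvature ?y a b w $ l)" "linear (\<lambda>w. curvature ?y w a b $ l)" "linear (\<lambda>w. curvature ?y a w b $ l)"
    for a b l
    by (rule linearI; simp add: linear_add[OF linear_curvature(1)[OF y]] linear_add[OF linear_curvature(2)[OF y]]
      linear_add[OF linear_curvature(3)[OF y]] linear_scale[OF linear_curvature(1)[OF y]]
      linear_scale[OF linear_curvature(2)[OF y]] linear_scale[OF linear_curvature(3)[OF y]])+
  have expand: "curvature ?y a b w $ l = (\<Sum>k\<in>UNIV. \<Sum>i\<in>UNIV. \<Sum>j\<in>UNIV.
      curvature ?y (axis i 1) (axis j 1) (axis k 1) $ l * a $ i * b $ j * w $ k)" for a b w l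
  proof -
    have "curvature ?y a b w $ l = (\<Sum>k\<in>UNIV. w $ k * (\<Sum>i\<in>UNIV. a $ i * (\<Sum>j\<in>UNIV. b $ j *
        curvature ?y (axis i 1) (axis j 1) (axis k 1) $ l)))"
      by (subst linear_expand_axis[OF lin(1)], subst linear_expand_axis[OF lin(2)],
          subst linear_expand_axis[OF lin(3)]) (rule refl)
    then show ?thesis
      by (simp add: sum_distrib_left mult_ac)
  qed
  have "(\<Sum>m\<in>UNIV. \<Sum>l\<in>UNIV. \<Sum>k\<in>UNIV. \<Sum>i\<in>UNIV. \<Sum>j\<in>UNIV.
        G c ?y $ l $ m * curvature_comp \<A> g c ?y l k i j * u c $ i * v c $ j * v c $ k * u c $ m)
      = (\<Sum>m\<in>UNIV. \<Sum>l\<in>UNIV. u c $ m * G c ?y $ l $ m * curvature ?y (u c) (v c) (v c) $ l)"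
    by (simp add: curvature_comp_eq_curvature[OF c y] expand[of "u c" "v c" "v c"] sum_distrib_left mult_ac)
  also have "\<dots> = inner_at ?y (curvature ?y (u c) (v c) (v c)) (u c)"
    unfolding inner_at_sum by (subst sum.swap) (simp add: mult_ac)
  also have "\<dots> = inner_at ?y (u c) (curvature ?y (u c) (v c) (v c))"
    by (rule inner_at_commute[OF y])
  finally show ?thesis
    by (simp add: sectional_curvature_def metric_eq_inner_at[OF c p] u v)
qed

lemma constant_sectional_curvature_iff:
  "constant_sectional_curvature \<A> g \<kappa> \<longleftrightarrow>
    (\<forall>c\<in>\<A>. \<forall>y\<in>snd c ` fst c. \<forall>a b v. local_metric.curvature (G c) y a b v
      = \<kappa> *\<^sub>R (local_metric.inner_at (G c) y b v *\<^sub>R a - local_metric.inner_at (G c) y a v *\<^sub>R b))"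
proof -
  have "(\<forall>u\<in>tangent_space \<A> p. \<forall>v\<in>tangent_space \<A> p.
        (\<forall>a b. (\<lambda>d. a *\<^sub>R u d + b *\<^sub>R v d) = (\<lambda>d. 0) \<longrightarrow> a = 0 \<and> b = 0) \<longrightarrow>
        sectional_curvature \<A> g c p u v = \<kappa>)
    \<longleftrightarrow> (\<forall>a b v. local_metric.curvature (G c) (snd c p) a b v
      = \<kappa> *\<^sub>R (local_metric.inner_at (G c) (snd c p) b v *\<^sub>R a - local_metric.inner_at (G c) (snd c p) a v *\<^sub>R b))"
    (is "?sec \<longleftrightarrow> ?flat")
    if c: "c \<in> \<A>" and p: "p \<in> fst c" for c p
  proof -
    interpret local_metric "snd c ` fst c" "G c" by (rule local_metric_chart[OF c])
    let ?y = "snd c p"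
    have y: "?y \<in> snd c ` fst c" using p by simp
    let ?K = "\<lambda>u v. inner_at ?y u (curvature ?y u v v) / (inner_at ?y u u * inner_at ?y v v - (inner_at ?y u v)\<^sup>2)"
    let ?e = "\<lambda>w. chart_vector \<A> c p w"
    note cv = chart_vector_in_tangent_space[OF c p]
    have zero: "(\<lambda>d. a *\<^sub>R u d + b *\<^sub>R v d) = (\<lambda>d. 0) \<longleftrightarrow> a *\<^sub>R u c + b *\<^sub>R v c = 0"
      if "u \<in> tangent_space \<A> p" "v \<in> tangent_space \<A> p" for a b u v
      using tangent_eqI[OF tangent_space_lincomb[OF that, of a b] tangent_space_zero c p]
      by (auto dest: fun_cong)
    have "?sec \<longleftrightarrow> (\<forall>u\<in>tangent_space \<A> p. \<forall>v\<in>tangent_space \<A> p.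
        (\<forall>a b. a *\<^sub>R u c + b *\<^sub>R v c = 0 \<longrightarrow> a = 0 \<and> b = 0) \<longrightarrow> ?K (u c) (v c) = \<kappa>)"
      by (intro ball_cong refl) (simp only: zero sectional_curvature_eq_curvature[OF c p])
    also have "\<dots> \<longleftrightarrow> (\<forall>u v. (\<forall>a b. a *\<^sub>R u + b *\<^sub>R v = 0 \<longrightarrow> a = 0 \<and> b = 0) \<longrightarrow> ?K u v = \<kappa>)"
      (is "?L \<longleftrightarrow> ?R")
    proof
      assume L: ?L
      show ?R
      proof (intro allI)
        fix u v
        show "(\<forall>a b. a *\<^sub>R u + b *\<^sub>R v = 0 \<longrightarrow> a = 0 \<and> b = 0) \<longrightarrow> ?K u v = \<kappa>"
          using L[rule_format, OF cv cv, of u v] by (simp add: chart_vector_self[OF c p])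
      qed
    qed blast
    also have "\<dots> \<longleftrightarrow> ?flat"
      by (rule constant_curvature_iff[OF y])
    finally show ?thesis .
  qed
  then show ?thesis
    unfolding constant_sectional_curvature_def by simp
qed

end


section \<open>The natural almost complex structure\<close>

locale natural_structure =
  metric_atlas \<A> g + natural_coefficients A lam b1
  for \<A> :: "('m, real^'n::finite) chart set" and g :: "('m, 'n) metric"
    and A :: real and lam b1 :: "real \<Rightarrow> real" +
  fixes J :: "('m, real^'n) cotangent \<Rightarrow> ('m, 'n) bitangent \<Rightarrow> ('m, 'n) bitangent"
  assumes natural: "is_natural_acs \<A> g A lam b1 J"
begin

sublocale cot: acs_on_atlas "cotangent_atlas \<A>" J
  by (intro acs_on_atlas.intro smooth_atlas_cotangent acs_on_atlas_axioms.intro)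
    (use natural in \<open>simp add: is_natural_acs_def\<close>)

lemma cotangent_chart_in_atlas: "c \<in> \<A> \<Longrightarrow> cotangent_chart \<A> c \<in> cotangent_atlas \<A>"
  by (simp add: cotangent_atlas_def)

text \<open>The adapted frame consists of horizontal lifts; this also shows that its members are tangent
  vectors.\<close>

lemma delta_dq_eq_chart_vector:
  assumes c: "c \<in> \<A>" and P: "P \<in> fst (cotangent_chart \<A> c)"
  shows "delta_dq \<A> g c i P = chart_vector (cotangent_atlas \<A>) (cotangent_chart \<A> c) P
    (axis i 1, local_metric.hor_lift (G c) (snd (cotangent_chart \<A> c) P) (axis i 1))"
proof
  fix d
  interpret local_metric "snd c ` fst c" "G c" by (rule local_metric_chart[OF c])
  let ?c = "cotangent_chart \<A> c" and ?m = "momenta \<A> c P"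
  let ?\<Gamma> = "\<lambda>k h. christoffel \<A> g c (snd c (fst P)) k i h"
  have hor_lift_eq: "(axis i 1, hor_lift (snd ?c P) (axis i 1)) = (axis i 1, 0)
      + (\<Sum>k\<in>UNIV. \<Sum>h\<in>UNIV. (?m $ k * ?\<Gamma> k h) *\<^sub>R (0, axis h 1))"
  proof -
    have "(\<Sum>k\<in>UNIV. \<Sum>h\<in>UNIV. (?m $ k * ?\<Gamma> k h) *\<^sub>R axis h 1) = hor_lift (snd ?c P) (axis i 1)"
      by (simp add: vec_eq_iff hor_lift_def cotangent_chart_apply christoffel_eq_gamma[OF c] inner_vec_def
          axis_def if_distrib cong: if_cong)
    then show ?thesis
      by (simp add: prod_eq_iff fst_sum snd_sum)
  qed
  show "delta_dq \<A> g c i P d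
      = chart_vector (cotangent_atlas \<A>) ?c P (axis i 1, hor_lift (snd ?c P) (axis i 1)) d"
  proof (cases "d \<in> cotangent_atlas \<A> \<and> P \<in> fst d")
    case True
    have lin: "linear (dir_deriv (transition ?c d) (snd ?c P))"
      using True P by (intro cot.linear_transition_deriv cotangent_chart_in_atlas c) auto
    show ?thesis
      using True
      by (simp add: delta_dq_def d_dq_def d_dp_def chart_vector_def hor_lift_eq linear_add[OF lin]
          linear_sum[OF lin] linear_scale[OF lin] del: scaleR_Pair)
  next
    case False
    then have "chart_vector (cotangent_atlas \<A>) ?c P w d = 0" for w
      by (auto simp: chart_vector_def)
    then show ?thesis
      by (simp add: delta_dq_def d_dq_def d_dp_def)
  qed
qed

lemma phase_acs_chart:
  assumes c: "c \<in> \<A>"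
  shows "phase_acs (snd c ` fst c) (G c) (cot.chart_rep (cotangent_chart \<A> c)) A lam b1
    lam' (half_line_deriv b1)"
proof -
  let ?c = "cotangent_chart \<A> c" and ?U = "snd c ` fst c"
  interpret lm: local_metric ?U "G c" by (rule local_metric_chart[OF c])
  have c': "?c \<in> cotangent_atlas \<A>" by (rule cotangent_chart_in_atlas[OF c])
  have image: "snd ?c ` fst ?c = ?U \<times> UNIV"
    using cotangent_chart_image[OF c c] by simp
  interpret acs: euclidean_acs "?U \<times> UNIV" "cot.chart_rep ?c"
    using cot.euclidean_acs_chart_rep[OF c'] by (simp add: image)
  have J_hor_lift: "cot.chart_rep ?c z (a, lm.hor_lift z a) = (0, (A / lam (lm.kinetic z)) *\<^sub>R (G c (fst z) *v a)
      + (b1 (lm.kinetic z) * (snd z \<bullet> a)) *\<^sub>R snd z)"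
    if z: "fst z \<in> ?U" for z a
  proof -
    have zS: "z \<in> ?U \<times> UNIV" using z by (simp add: mem_Times_iff)
    then obtain P where P: "P \<in> fst ?c" "z = snd ?c P"
      unfolding image[symmetric] by blast
    have z_eq: "fst z = snd c (fst P)" "snd z = momenta \<A> c P"
      by (simp_all add: P(2) cotangent_chart_apply)
    let ?F = "\<lambda>a. (A / lam (lm.kinetic z)) *\<^sub>R (G c (fst z) *v a) + (b1 (lm.kinetic z) * (snd z \<bullet> a)) *\<^sub>R snd z"
    have kinetic: "energy \<A> g c P = lm.kinetic z"
      by (simp add: energy_def lm.kinetic_def lm.sharp_def z_eq metric_inv_def inner_vec_def
          matrix_vector_mult_def sum_distrib_left mult_ac)
    have J1: "J1 \<A> g A lam b1 c P i j = ?F (axis i 1) $ j" for i j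
      using lm.sym_G[OF z, of i j]
      by (simp add: J1_def Let_def kinetic z_eq matrix_vector_mult_basis column_def inner_axis mult_ac)
    have basis: "cot.chart_rep ?c z (axis i 1, lm.hor_lift z (axis i 1)) = (0, ?F (axis i 1))" for i
    proof -
      let ?v = "chart_vector (cotangent_atlas \<A>) ?c P (axis i 1, lm.hor_lift z (axis i 1))"
      have "J P (delta_dq \<A> g c i P) = (\<lambda>d. \<Sum>j\<in>UNIV. J1 \<A> g A lam b1 c P i j *\<^sub>R d_dp \<A> c j P d)"
        using natural c P(1) unfolding is_natural_acs_def by blast
      then have "J P ?v = (\<lambda>d. \<Sum>j\<in>UNIV. J1 \<A> g A lam b1 c P i j *\<^sub>R d_dp \<A> c j P d)"
        by (simp only: delta_dq_eq_chart_vector[OF c P(1)] P(2))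
      then have "J P ?v ?c = (\<Sum>j\<in>UNIV. J1 \<A> g A lam b1 c P i j *\<^sub>R (0, axis j 1))"
        by (simp add: d_dp_def cot.chart_vector_self[OF c' P(1)])
      also have "\<dots> = (0, ?F (axis i 1))"
        by (simp add: J1 prod_eq_iff fst_sum snd_sum vec_eq_iff axis_def if_distrib cong: if_cong)
      finally show ?thesis
        using cot.J_component[OF cot.chart_vector_in_tangent_space[OF c' P(1)] c' P(1)]
        by (simp add: cot.chart_vector_self[OF c' P(1)] P(2))
    qed
    have linJ: "linear (cot.chart_rep ?c z)" by (rule acs.linear_J[OF zS])
    have lin1: "linear (\<lambda>a. cot.chart_rep ?c z (a, lm.hor_lift z a))"
    proof (rule linearI)
      show "cot.chart_rep ?c z (a + b, lm.hor_lift z (a + b))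
          = cot.chart_rep ?c z (a, lm.hor_lift z a) + cot.chart_rep ?c z (b, lm.hor_lift z b)" for a b
        by (simp add: linear_add[OF lm.linear_hor_lift[OF z]] linear_add[OF linJ, symmetric])
      show "cot.chart_rep ?c z (r *\<^sub>R a, lm.hor_lift z (r *\<^sub>R a)) = r *\<^sub>R cot.chart_rep ?c z (a, lm.hor_lift z a)" for r a
        by (simp add: linear_scale[OF lm.linear_hor_lift[OF z]] linear_scale[OF linJ, symmetric])
    qed
    have lin2: "linear (\<lambda>a. (0 :: real^'n, ?F a))"
      by (rule linearI)
        (simp_all add: linear_add[OF matrix_vector_mul_linear] linear_scale[OF matrix_vector_mul_linear]
          inner_add_right algebra_simps)
    have "(\<lambda>a. cot.chart_rep ?c z (a, lm.hor_lift z a)) = (\<lambda>a. (0, ?F a))"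
    proof (rule linear_eq_stdbasis[OF lin1 lin2])
      show "cot.chart_rep ?c z (b, lm.hor_lift z b) = (0, ?F b)" if "b \<in> Basis" for b
        using that basis by (auto simp: Basis_vec_def)
    qed
    then show ?thesis by (rule fun_cong)
  qed
  show ?thesis
    by (intro phase_acs.intro lm.local_metric_axioms acs.euclidean_acs_axioms phase_acs_axioms.intro
        lam_pos half_line_has_derivative smooth_lam smooth_b1 J_hor_lift)
qed

lemma integrable_iff_obstruction:
  "integrable_acs (cotangent_atlas \<A>) J \<longleftrightarrow>
    (\<forall>c\<in>\<A>. \<forall>z\<in>snd c ` fst c \<times> UNIV. \<forall>a b v. snd z \<bullet> local_metric.curvature (G c) (fst z) a b v
      = - obs (local_metric.kinetic (G c) z)
        * ((snd z \<bullet> a) * local_metric.inner_at (G c) (fst z) b v - (snd z \<bullet> b) * local_metric.inner_at (G c) (fst z) a v))"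
proof -
  have image: "snd (cotangent_chart \<A> c) ` fst (cotangent_chart \<A> c) = snd c ` fst c \<times> UNIV"
    if "c \<in> \<A>" for c
    using cotangent_chart_image[OF that that] by simp
  have charts: "(\<forall>c\<in>cotangent_atlas \<A>. Q c) \<longleftrightarrow> (\<forall>c\<in>\<A>. Q (cotangent_chart \<A> c))" for Q
    by (simp add: cotangent_atlas_def)
  show ?thesis
    unfolding cot.integrable_iff_nijenhuis_tensor charts
  proof (rule ball_cong[OF refl])
    fix c assume c: "c \<in> \<A>"
    show "(\<forall>z\<in>snd (cotangent_chart \<A> c) ` fst (cotangent_chart \<A> c). \<forall>u v.
        nijenhuis_tensor (cot.chart_rep (cotangent_chart \<A> c)) z u v = 0)
      \<longleftrightarrow> (\<forall>z\<in>snd c ` fst c \<times> UNIV. \<forall>a b v. snd z \<bullet> local_metric.curvature (G c) (fst z) a b v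
        = - obs (local_metric.kinetic (G c) z) * ((snd z \<bullet> a) * local_metric.inner_at (G c) (fst z) b v
          - (snd z \<bullet> b) * local_metric.inner_at (G c) (fst z) a v))"
      unfolding image[OF c] by (rule phase_acs.nijenhuis_vanishes_iff[OF phase_acs_chart[OF c]])
  qed
qed

text \<open>Rescaling a covector changes the energy but scales the curvature term linearly; hence the
  obstruction function is constant.\<close>

lemma obstruction_constant:
  assumes dim: "CARD('n) > 1" and c: "c \<in> \<A>" and y: "y \<in> snd c ` fst c"
    and eq: "\<And>p a b v. p \<bullet> local_metric.curvature (G c) y a b v
      = - obs (local_metric.kinetic (G c) (y, p))
        * ((p \<bullet> a) * local_metric.inner_at (G c) y b v - (p \<bullet> b) * local_metric.inner_at (G c) y a v)"
  shows "\<exists>k. \<forall>t\<ge>0. obs t = k"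
proof -
  interpret local_metric "snd c ` fst c" "G c" by (rule local_metric_chart[OF c])
  obtain p :: "real^'n" where p: "p \<noteq> 0"
    using zero_neq_one by blast
  \<comment> \<open>\<open>b\<close> orthogonal to \<open>p\<close> makes the right hand side for \<open>p, p, b, b\<close> a nonzero multiple of the obstruction\<close>
  have "2 \<le> DIM(real^'n)" using dim by simp
  then obtain b where b: "b \<noteq> 0" "orthogonal p b"
    using orthogonal_to_vector_exists by blast
  define t0 where "t0 = kinetic (y, p)"
  define m where "m = (p \<bullet> p) * inner_at y b b"
  have m: "m > 0"
    using p inner_at_pos[OF y b(1)] by (simp add: m_def)
  have kinetic_scale: "kinetic (y, s *\<^sub>R p) = s\<^sup>2 * t0" for s
    by (simp add: kinetic_def sharp_def t0_def linear_scale[OF matrix_vector_mul_linear] power2_eq_square)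
  have t0: "t0 > 0"
  proof -
    have "sharp (y, p) \<noteq> 0"
      using inner_at_sharp[of "(y, p)" p] y p linear_0[OF linear_inner_at_right] by auto
    then have "inner_at y (sharp (y, p)) (sharp (y, p)) > 0"
      by (rule inner_at_pos[OF y])
    then show ?thesis
      using inner_at_sharp[of "(y, p)" "sharp (y, p)"] y by (simp add: t0_def kinetic_def)
  qed
  have val: "obs t = - (p \<bullet> curvature y p b b) / m" if "t > 0" for t
  proof -
    define s where "s = sqrt (t / t0)"
    have s: "s > 0" "s\<^sup>2 * t0 = t"
      using that t0 by (auto simp: s_def)
    have "s * (p \<bullet> curvature y p b b) = s * (- obs t * m)"
      using eq[of "s *\<^sub>R p" p b b] b(2) by (simp add: kinetic_scale s(2) m_def orthogonal_def)
    then have "p \<bullet> curvature y p b b = - obs t * m"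
      using s(1) by (metis less_irrefl mult_cancel_left)
    then show ?thesis
      using m by simp
  qed
  have "obs t = - (p \<bullet> curvature y p b b) / m" if "t \<ge> 0" for t
  proof (rule continuous_constant_on_closure[of "{0<..}" obs])
    show "continuous_on (closure {0<..}) obs"
      using continuous_obstruction by simp
  qed (use val that in auto)
  then show ?thesis by blast
qed

theorem integrable_iff:
  assumes "CARD('n) > 1" and nonempty: "\<exists>c\<in>\<A>. fst c \<noteq> {}"
  shows "integrable_acs (cotangent_atlas \<A>) J \<longleftrightarrow>
    (\<exists>\<kappa>. constant_sectional_curvature \<A> g \<kappa> \<and> b1_given_by A lam b1 \<kappa>)"
proof
  assume "integrable_acs (cotangent_atlas \<A>) J"
  then have eq: "p \<bullet> local_metric.curvature (G c) y a b v
      = - obs (local_metric.kinetic (G c) (y, p))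
        * ((p \<bullet> a) * local_metric.inner_at (G c) y b v - (p \<bullet> b) * local_metric.inner_at (G c) y a v)"
    if "c \<in> \<A>" "y \<in> snd c ` fst c" for c y p a b v
    using that unfolding integrable_iff_obstruction by fastforce
  obtain c0 y0 where "c0 \<in> \<A>" "y0 \<in> snd c0 ` fst c0"
    using nonempty by blast
  with obstruction_constant[OF assms(1) _ _ eq] obtain k where k: "\<And>t. t \<ge> 0 \<Longrightarrow> obs t = k"
    by metis
  have "local_metric.curvature (G c) y a b v
      = (- k) *\<^sub>R (local_metric.inner_at (G c) y b v *\<^sub>R a - local_metric.inner_at (G c) y a v *\<^sub>R b)"
    if c: "c \<in> \<A>" and y: "y \<in> snd c ` fst c" for c y a b v
  proof -
    interpret local_metric "snd c ` fst c" "G c" by (rule local_metric_chart[OF c])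
    have "p \<bullet> curvature y a b v = p \<bullet> ((- k) *\<^sub>R (inner_at y b v *\<^sub>R a - inner_at y a v *\<^sub>R b))" for p
    proof -
      have "obs (kinetic (y, p)) = k"
        using kinetic_nonneg[of "(y, p)"] y k by simp
      then show ?thesis
        using eq[OF c y, of p a b v] by (simp add: inner_diff_right algebra_simps)
    qed
    then show ?thesis
      using vector_eq_ldot by blast
  qed
  then have "constant_sectional_curvature \<A> g (- k)"
    unfolding constant_sectional_curvature_iff by blast
  moreover have "b1_given_by A lam b1 (- k)"
    by (rule obstruction_b1_given_by) (simp add: k)
  ultimately show "\<exists>\<kappa>. constant_sectional_curvature \<A> g \<kappa> \<and> b1_given_by A lam b1 \<kappa>"
    by blast
next
  assume "\<exists>\<kappa>. constant_sectional_curvature \<A> g \<kappa> \<and> b1_given_by A lam b1 \<kappa>"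
  then obtain \<kappa> where curv: "constant_sectional_curvature \<A> g \<kappa>" and b1: "b1_given_by A lam b1 \<kappa>"
    by blast
  show "integrable_acs (cotangent_atlas \<A>) J"
    unfolding integrable_iff_obstruction
  proof (intro ballI allI)
    fix c z a b v assume c: "c \<in> \<A>" and zS: "z \<in> snd c ` fst c \<times> (UNIV :: (real^'n) set)"
    interpret local_metric "snd c ` fst c" "G c" by (rule local_metric_chart[OF c])
    have z: "fst z \<in> snd c ` fst c" using zS by auto
    have curvature: "curvature (fst z) a b v = \<kappa> *\<^sub>R (inner_at (fst z) b v *\<^sub>R a - inner_at (fst z) a v *\<^sub>R b)"
      using curv c z unfolding constant_sectional_curvature_iff by blast
    have obs: "obs (kinetic z) = - \<kappa>"
      by (rule b1_given_by_obstruction[OF b1 kinetic_nonneg[OF z]])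
    show "snd z \<bullet> curvature (fst z) a b v
        = - obs (kinetic z) * ((snd z \<bullet> a) * inner_at (fst z) b v - (snd z \<bullet> b) * inner_at (fst z) a v)"
      unfolding curvature obs by (simp add: inner_diff_right algebra_simps)
  qed
qed

end

theorem theorem4:
  fixes M :: "'m topology"
    and \<A> :: "('m, real^'n::finite) chart set"
    and g :: "('m, 'n) metric"
    and A :: real
    and lam b1 :: "real \<Rightarrow> real"
    and J :: "('m, real^'n) cotangent \<Rightarrow> ('m, 'n) bitangent \<Rightarrow> ('m, 'n) bitangent"
  assumes "smooth_manifold M \<A>"
    and "riemannian_metric \<A> g"
    and "CARD('n) > 1"
    and "A > 0"
    and "smooth_on {0..} lam"
    and "smooth_on {0..} b1"
    and "\<And>t. t \<ge> 0 \<Longrightarrow> lam t > 0"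
    and "\<And>t. t \<ge> 0 \<Longrightarrow> A + 2 * t * lam t * b1 t > 0"
    and "is_natural_acs \<A> g A lam b1 J"
  shows "(integrable_acs (cotangent_atlas \<A>) J \<longleftrightarrow>
            (\<exists>\<kappa>. constant_sectional_curvature \<A> g \<kappa> \<and> b1_given_by A lam b1 \<kappa>)) \<and>
         (\<forall>\<kappa>. constant_sectional_curvature \<A> g \<kappa> \<and> b1_given_by A lam b1 \<kappa> \<longrightarrow>
            (\<forall>t\<ge>0. lam t > 0 \<and>
               (A\<^sup>2 - 2 * \<kappa> * t * (lam t)\<^sup>2) / (lam t + 2 * t * half_line_deriv lam t) > 0) \<and>
            A > 0)"
proof -
  interpret natural_structure \<A> g A lam b1 J
    by (intro natural_structure.intro metric_atlas.intro coordinate_atlas.intro smooth_manifold_atlas[OF assms(1)]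
        metric_atlas_axioms.intro natural_coefficients.intro natural_structure_axioms.intro assms)
  have "topspace M \<noteq> {}" "(\<Union>c\<in>\<A>. fst c) = topspace M"
    using assms(1) by (auto simp: smooth_manifold_def)
  then have "\<exists>c\<in>\<A>. fst c \<noteq> {}"
    by blast
  then show ?thesis
    using integrable_iff[OF assms(3)] space_form_quotient_pos lam_pos A_pos by blast
qed

end
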